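(* Let $\mathfrak{g}$ be a finite-dimensional Heisenberg Lie superalgebra over $\mathbb{F}$. Then the cup product on the adjoint cohomology $\mathrm{H}^{\bullet}(\mathfrak{g},\mathfrak{g})$ is trivial, i.e. the cup product of any two classes in $\mathrm{H}^{\bullet}(\mathfrak{g},\mathfrak{g})$ is zero.
   Context: $\mathbb{F}$ is an algebraically closed field of characteristic zero; all vector spaces and algebras are over $\mathbb{F}$. A Lie superalgebra is a $\mathbb{Z}_2$-graded algebra whose bracket satisfies skew-supersymmetry and the super Jacobi identity. Put $\mathfrak{g}^0=\mathfrak{g}$, $\mathfrak{g}^{i+1}=[\mathfrak{g},\mathfrak{g}^i]$; $\mathfrak{g}$ is two-step nilpotent if $\mathfrak{g}^1\neq0$ and $\mathfrak{g}^2=0$. A Heisenberg Lie superalgebra is a two-step nilpotent Lie superalgebra with one-dimensional center. The finite-dimensional ones fall into two classes according to the parity of the center: $\mathfrak{h}_{2m,n}$, with even basis $z,x_1,\dots,x_{2m}$, odd basis $y_1,\dots,y_n$, and non-zero brackets $[x_i,x_{m+i}]=[y_j,y_j]=z$ ($1\le i\le m$, $1\le j\le n$); and $\mathfrak{ba}_n$, with even basis $x_1,\dots,x_n$, odd basis $z,y_1,\dots,y_n$, and non-zero brackets $[x_i,y_i]=z$ ($1\le i\le n$). $|v|$ denotes the $\mathbb{Z}_2$-degree, and $\|\cdot\|$ the $\mathbb{Z}$-degree of cochains. For a superspace $V$, $\bigwedge^{\bullet}V$ is the super-exterior algebra: the quotient of the tensor superalgebra by the ideal generated by all $x\otimes y+(-1)^{|x||y|}y\otimes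 x$ ($x,y\in V$ homogeneous). Differential: let $\{x_i\}_{i\in I}$ be a homogeneous basis of $\mathfrak{g}$ ($I$ totally ordered), $\{x_i^*\}$ the dual basis, $[x_k,x_l]=\sum_i a_{kl}^i x_i$. On $\bigwedge^\bullet\mathfrak{g}^*$, $\mathrm{d}(x_i^* )=\sum_{k<l}(-1)^{|x_k||x_l|+1}a_{kl}^i x_k^*\wedge x_l^*+\frac12\sum_k a_{kk}^i (x_k^{*})^{2}$ and $\mathrm{d}(x\wedge y)=\mathrm{d}(x)\wedge y+(-1)^{\|x\|}x\wedge\mathrm{d}(y)$. For a $\mathfrak{g}$-module $M$, on $M\otimes\bigwedge^\bullet\mathfrak{g}^*$: $\mathrm{d}(m)=\sum_i(-1)^{|x_i||m|}(x_i\cdot m)\otimes x_i^*$ and $\mathrm{d}(m\otimes w)=\mathrm{d}(m)\wedge w+m\otimes\mathrm{d}(w)$. $\mathrm{H}^\bullet(\mathfrak{g},M)$ is the cohomology of this complex; the adjoint cohomology is $\mathrm{H}^\bullet(\mathfrak{g},\mathfrak{g})$, with $M=\mathfrak{g}$ the adjoint module. Cup product on $\mathfrak{g}\otimes\bigwedge^\bullet\mathfrak{g}^*$ (with respect to the bracket of $\mathfrak{g}$): the bilinear map given, for homogeneous $a,b\in\mathfrak{g}$ and $u,v\in\bigwedge^\bullet\mathfrak{g}^*$, by $(a\otimes u)\cup(b\otimes v)=(-1)^{|u||b|}[a,b]\otimes(u\wedge v)$. It satisfies $\mathrm{d}(f\cup g)=\mathrm{d}f\cup g+(-1)^{\|f\|}f\cup\mathrm{d}g$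 and hence induces a product on $\mathrm{H}^\bullet(\mathfrak{g},\mathfrak{g})$. *)

theory Defs
  imports
    "HOL-Library.Z2"
    "HOL-Library.Poly_Mapping"
    "HOL-Computational_Algebra.Polynomial"
begin

text \<open>The sign \<open>(-1)^p\<close> of a parity \<open>p\<close>.\<close>

definition psign :: "bit \<Rightarrow> 'f::field"
  where "psign p = (if p = 0 then 1 else - 1)"


section \<open>Lie superalgebras\<close>

locale superspace = vector_space scale
  for scale :: "'f::field \<Rightarrow> 'v::ab_group_add \<Rightarrow> 'v" +
  fixes gr :: "bit \<Rightarrow> 'v set"
  assumes gr_subspace: "subspace (gr p)"
    and gr_direct_sum: "\<exists>!u. u \<in> gr 0 \<and> v - u \<in> gr 1"
begin

definition component :: "bit \<Rightarrow> 'v \<Rightarrow> 'v"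
  where "component p v = (THE u. u \<in> gr p \<and> v - u \<in> gr (p + 1))"

text \<open>This is the parity of \<open>v\<close> only for non-zero homogeneous \<open>v\<close>.\<close>

definition parity :: "'v \<Rightarrow> bit"
  where "parity v = (if v \<in> gr 1 then 1 else 0)"

end

locale lie_superalgebra = superspace scale gr
  for scale :: "'f::field \<Rightarrow> 'g::ab_group_add \<Rightarrow> 'g" and gr :: "bit \<Rightarrow> 'g set" +
  fixes br :: "'g \<Rightarrow> 'g \<Rightarrow> 'g"
  assumes br_linear_left: "Vector_Spaces.linear scale scale (\<lambda>x. br x y)"
    and br_linear_right: "Vector_Spaces.linear scale scale (br x)"
    and br_graded: "\<lbrakk>x \<in> gr p; y \<in> gr q\<rbrakk> \<Longrightarrow> br x y \<in> gr (p + q)"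
    and skew_supersymmetry:
      "\<lbrakk>x \<in> gr p; y \<in> gr q\<rbrakk> \<Longrightarrow> br x y = - scale (psign (p * q)) (br y x)"
    and super_jacobi:
      "\<lbrakk>x \<in> gr p; y \<in> gr q; z \<in> gr r\<rbrakk> \<Longrightarrow>
        br x (br y z) = br (br x y) z + scale (psign (p * q)) (br y (br x z))"
begin

primrec lower_central :: "nat \<Rightarrow> 'g set" where
  "lower_central 0 = UNIV"
| "lower_central (Suc i) = span {br x y | x y. y \<in> lower_central i}"

definition two_step_nilpotent :: bool
  where "two_step_nilpotent \<longleftrightarrow> lower_central 1 \<noteq> {0} \<and> lower_central 2 = {0}"

definition center :: "'g set"
  where "center = {z. \<forall>x. br z x = 0}"

end

locale heisenberg_lie_superalgebra = lie_superalgebra +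
  assumes two_step: "two_step_nilpotent"
    and dim_center: "dim center = 1"

locale homogeneous_basis = superspace scale gr
  for scale :: "'f::field \<Rightarrow> 'g::ab_group_add \<Rightarrow> 'g" and gr :: "bit \<Rightarrow> 'g set" +
  fixes I :: "'i::linorder set" and e :: "'i \<Rightarrow> 'g"
  assumes basis_inj: "inj_on e I"
    and basis_independent: "independent (e ` I)"
    and basis_span: "span (e ` I) = UNIV"
    and basis_homogeneous: "i \<in> I \<Longrightarrow> e i \<in> gr 0 \<or> e i \<in> gr 1"


section \<open>The tensor superalgebra\<close>

text \<open>
  Words under concatenation are the free monoid. If \<open>I\<close> indexes a basis of \<open>V\<close>, then the
  tensor algebra of \<open>V\<close> is the monoid algebra of the words with letters in \<open>I\<close>, and for a
  vector space \<open>M\<close> the tensor product of \<open>M\<close> with it consists of the finitely supported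
  \<open>M\<close>-valued functions on these words: \<open>Poly_Mapping.single w m\<close> stands for \<open>m \<otimes> w\<close>.
\<close>

datatype 'i word = Word (letters: "'i list")

instantiation word :: (type) monoid_add
begin

definition zero_word :: "'a word"
  where "0 = Word []"

definition plus_word :: "'a word \<Rightarrow> 'a word \<Rightarrow> 'a word"
  where "u + v = Word (letters u @ letters v)"

instance
  by standard (simp_all add: zero_word_def plus_word_def)

end

definition tensors_over :: "'i set \<Rightarrow> ('i word \<Rightarrow>\<^sub>0 'b::zero) set"
  where "tensors_over I = {t. \<forall>w \<in> Poly_Mapping.keys t. set (letters w) \<subseteq> I}"

definition vectors_over :: "'i set \<Rightarrow> ('i \<Rightarrow> bit) \<Rightarrow> bit \<Rightarrow> ('i word \<Rightarrow>\<^sub>0 'b::zero) set"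
  where "vectors_over I par p =
    {t. Poly_Mapping.keys t \<subseteq> {Word [i] | i. i \<in> I \<and> par i = p}}"

text \<open>
  The two-sided ideal defining the super-exterior algebra, for a space with basis indexed by \<open>I\<close>
  whose \<open>i\<close>-th member has parity \<open>par i\<close>.
\<close>

inductive_set ext_ideal :: "'i set \<Rightarrow> ('i \<Rightarrow> bit) \<Rightarrow> ('i word \<Rightarrow>\<^sub>0 'f::field) set"
  for I :: "'i set" and par :: "'i \<Rightarrow> bit" where
  generator: "\<lbrakk>x \<in> vectors_over I par p; y \<in> vectors_over I par q\<rbrakk> \<Longrightarrow>
    x * y + Poly_Mapping.single 0 (psign (p * q)) * (y * x) \<in> ext_ideal I par"
| zero: "0 \<in> ext_ideal I par"
| add: "\<lbrakk>s \<in> ext_ideal I par; t \<in> ext_ideal I par\<rbrakk> \<Longrightarrow> s + t \<in> ext_ideal I par"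
| mult_left: "\<lbrakk>s \<in> tensors_over I; t \<in> ext_ideal I par\<rbrakk> \<Longrightarrow> s * t \<in> ext_ideal I par"
| mult_right: "\<lbrakk>s \<in> ext_ideal I par; t \<in> tensors_over I\<rbrakk> \<Longrightarrow> s * t \<in> ext_ideal I par"


section \<open>The adjoint cochain complex\<close>

locale lie_superalgebra_basis =
  lie_superalgebra scale gr br + homogeneous_basis scale gr I e
  for scale :: "'f::field \<Rightarrow> 'g::ab_group_add \<Rightarrow> 'g" and gr :: "bit \<Rightarrow> 'g set"
    and br :: "'g \<Rightarrow> 'g \<Rightarrow> 'g" and I :: "'i::linorder set" and e :: "'i \<Rightarrow> 'g"
begin

text \<open>
  The letter \<open>i\<close> stands for the dual basis vector of \<open>e i\<close>, of the same parity as \<open>e i\<close>.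
  The sums over \<open>I\<close> below are the intended ones for finite \<open>I\<close>, that is, for a finite-dimensional
  Lie superalgebra.
\<close>

abbreviation par :: "'i \<Rightarrow> bit"
  where "par i \<equiv> parity (e i)"

definition word_parity :: "'i word \<Rightarrow> bit"
  where "word_parity w = sum_list (map par (letters w))"

definition structure_const :: "'i \<Rightarrow> 'i \<Rightarrow> 'i \<Rightarrow> 'f"
  where "structure_const k l i = representation (e ` I) (br (e k) (e l)) (e i)"

subsection \<open>Differential and cup product on tensors\<close>

definition d_letter :: "'i \<Rightarrow> ('i word \<Rightarrow>\<^sub>0 'f)"
  where "d_letter i =
    (\<Sum>(k, l) \<in> {(k, l). k \<in> I \<and> l \<in> I \<and> k < l}.
       Poly_Mapping.single (Word [k, l]) (psign (par k * par l + 1) * structure_const k l i)) +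
    (\<Sum>k\<in>I. Poly_Mapping.single (Word [k, k]) (1 / 2 * structure_const k k i))"

primrec d_letters :: "'i list \<Rightarrow> ('i word \<Rightarrow>\<^sub>0 'f)" where
  "d_letters [] = 0"
| "d_letters (i # is) =
     d_letter i * Poly_Mapping.single (Word is) 1 - Poly_Mapping.single (Word [i]) 1 * d_letters is"

definition tensor :: "'g \<Rightarrow> ('i word \<Rightarrow>\<^sub>0 'f) \<Rightarrow> ('i word \<Rightarrow>\<^sub>0 'g)"
  where "tensor m t = Poly_Mapping.map (\<lambda>c. scale c m) t"

text \<open>The value of the differential on \<open>m \<otimes> w\<close>; the first sum is \<open>d(m) \<and> w\<close>.\<close>

definition d_pure :: "'g \<Rightarrow> 'i word \<Rightarrow> ('i word \<Rightarrow>\<^sub>0 'g)"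
  where "d_pure m w =
    (\<Sum>i\<in>I. \<Sum>p\<in>{0, 1}. Poly_Mapping.single (Word [i] + w)
       (scale (psign (par i * p)) (br (e i) (component p m)))) +
    tensor m (d_letters (letters w))"

definition tensor_d :: "('i word \<Rightarrow>\<^sub>0 'g) \<Rightarrow> ('i word \<Rightarrow>\<^sub>0 'g)"
  where "tensor_d f = (\<Sum>w \<in> Poly_Mapping.keys f. d_pure (Poly_Mapping.lookup f w) w)"

definition tensor_cup :: "('i word \<Rightarrow>\<^sub>0 'g) \<Rightarrow> ('i word \<Rightarrow>\<^sub>0 'g) \<Rightarrow> ('i word \<Rightarrow>\<^sub>0 'g)"
  where "tensor_cup f g =
    (\<Sum>u \<in> Poly_Mapping.keys f. \<Sum>v \<in> Poly_Mapping.keys g. \<Sum>p\<in>{0, 1}.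
       Poly_Mapping.single (u + v) (scale (psign (word_parity u * p))
         (br (Poly_Mapping.lookup f u) (component p (Poly_Mapping.lookup g v)))))"

subsection \<open>Cochains\<close>

text \<open>
  The tensor product of \<open>\<gg>\<close> with the ideal. Since tensoring is exact over a field, the quotient
  by it is the tensor product of \<open>\<gg>\<close> with the super-exterior algebra of the dual of \<open>\<gg>\<close>.
\<close>

definition null_tensors :: "('i word \<Rightarrow>\<^sub>0 'g) set"
  where "null_tensors =
    {\<Sum>k<n. tensor (m k) (t k) | (n::nat) m t. \<forall>k<n. t k \<in> ext_ideal I par}"

definition congr :: "(('i word \<Rightarrow>\<^sub>0 'g) \<times> ('i word \<Rightarrow>\<^sub>0 'g)) set"
  where "congr =
    {(f, f'). f \<in> tensors_over I \<and> f' \<in> tensors_over I \<and> f - f' \<in> null_tensors}"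

definition cochains :: "('i word \<Rightarrow>\<^sub>0 'g) set set"
  where "cochains = tensors_over I // congr"

definition zero_cochain :: "('i word \<Rightarrow>\<^sub>0 'g) set"
  where "zero_cochain = congr `` {0}"

definition minus_cochain ::
    "('i word \<Rightarrow>\<^sub>0 'g) set \<Rightarrow> ('i word \<Rightarrow>\<^sub>0 'g) set \<Rightarrow> ('i word \<Rightarrow>\<^sub>0 'g) set"
  where "minus_cochain X Y = (\<Union>f\<in>X. \<Union>g\<in>Y. congr `` {f - g})"

definition d :: "('i word \<Rightarrow>\<^sub>0 'g) set \<Rightarrow> ('i word \<Rightarrow>\<^sub>0 'g) set"
  where "d X = (\<Union>f\<in>X. congr `` {tensor_d f})"

definition cup_cochain ::
    "('i word \<Rightarrow>\<^sub>0 'g) set \<Rightarrow> ('i word \<Rightarrow>\<^sub>0 'g) set \<Rightarrow> ('i word \<Rightarrow>\<^sub>0 'g) set"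
  where "cup_cochain X Y = (\<Union>f\<in>X. \<Union>g\<in>Y. congr `` {tensor_cup f g})"

subsection \<open>Cohomology\<close>

definition cocycles :: "('i word \<Rightarrow>\<^sub>0 'g) set set"
  where "cocycles = {X \<in> cochains. d X = zero_cochain}"

definition cohomologous :: "(('i word \<Rightarrow>\<^sub>0 'g) set \<times> ('i word \<Rightarrow>\<^sub>0 'g) set) set"
  where "cohomologous =
    {(X, Y). X \<in> cochains \<and> Y \<in> cochains \<and> (\<exists>W \<in> cochains. minus_cochain X Y = d W)}"

definition adjoint_cohomology :: "('i word \<Rightarrow>\<^sub>0 'g) set set set"
  where "adjoint_cohomology = cocycles // cohomologous"

definition zero_class :: "('i word \<Rightarrow>\<^sub>0 'g) set set"
  where "zero_class = cohomologous `` {zero_cochain}"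

definition cup ::
    "('i word \<Rightarrow>\<^sub>0 'g) set set \<Rightarrow> ('i word \<Rightarrow>\<^sub>0 'g) set set \<Rightarrow> ('i word \<Rightarrow>\<^sub>0 'g) set set"
  where "cup A B = (\<Union>X\<in>A. \<Union>Y\<in>B. cohomologous `` {cup_cochain X Y})"

end

end

theory Submission
  imports Defs
begin

text \<open>
  Let \<open>z\<close> span the centre of the Heisenberg Lie superalgebra \<open>\<gg>\<close>, so that \<open>[x, y] = B(x, y) z\<close> for a
  bilinear form \<open>B\<close> whose radical is spanned by \<open>z\<close>. In the super-exterior algebra \<open>\<Lambda>\<close> of the dual
  space, every form of degree one has as its differential a multiple of one and the same element
  \<open>\<omega>\<close>, namely \<open>d \<xi> = \<xi>(z) \<omega>\<close>. Fix a homogeneous form \<open>\<zeta>\<close> with \<open>\<zeta>(z) = 1\<close> and put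
  \<open>v_i = x_i - x_i(z) \<zeta>\<close> for the dual basis \<open>x_i\<close>; the \<open>v_i\<close> span the closed forms of degree one.

  Write an adjoint cochain in components as \<open>f = \<Sum> e_i \<otimes> f_i\<close>. As brackets lie in the centre,
  \<open>d f = \<Sum> e_i \<otimes> d f_i + z \<otimes> \<Sum> b_l f_l\<close>, where \<open>b_l\<close> is, up to a sign, the form \<open>B(-, e_l)\<close>. Two
  things follow. For closed \<open>t\<close> the cochain \<open>z \<otimes> b_l t\<close> is the coboundary of \<open>e_l \<otimes> t\<close>; since \<open>B\<close> is
  nondegenerate modulo \<open>z\<close>, the \<open>b_l\<close> span the \<open>v_m\<close>, so \<open>z \<otimes> v_m t\<close> is exact for all closed \<open>t\<close>. And
  for a cocycle, after subtracting from each \<open>f_i\<close> the multiple \<open>x_i(z)\<close> of one fixed form, the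
  components \<open>f_i\<close> are closed, \<open>\<Sum> b_l f_l\<close> is exact, and \<open>f_j = 0\<close> for one \<open>j\<close> with \<open>x_j(z) \<noteq> 0\<close>; this subtraction does not affect cup products,
  as \<open>z\<close> is in the radical of \<open>B\<close>. The cup product of two cocycles is \<open>z \<otimes> \<Sum> \<plusminus> B(e_k, e_l) f_k g_l\<close>, and
  it suffices to show that each product \<open>f_k g_l\<close> is a combination of terms \<open>v_m t\<close> with \<open>t\<close> closed.

  First, every \<open>f_k\<close> and \<open>g_l\<close> lies in the ideal generated by the \<open>v_m\<close> (lemma \<open>in_aug\<close>): modulo this
  ideal \<open>f_k\<close> is a polynomial in \<open>\<zeta>\<close>, and comparing the coefficients of \<open>b_l \<zeta>^k\<close> in the exact form
  \<open>\<Sum> b_l f_l\<close> gives a linear relation between the \<open>b_l\<close> with \<open>l \<noteq> j\<close>, which nondegeneracy forbids. The coefficients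
  are read off by contracting with \<open>z\<close> in all slots but one.

  Second, let \<open>U\<close> and \<open>V\<close> be closed elements of that ideal (lemma \<open>closed_mult_v_exact\<close>). Split \<open>V\<close>
  as \<open>V0 + V1\<close> according to whether the degree in \<open>\<zeta>\<close> is zero or positive. The differential vanishes on
  the subalgebra generated by the \<open>v_m\<close>, so moving a \<open>v_m\<close> of \<open>V0 = \<Sum> v_m h_m\<close> to the left of \<open>U\<close> writes
  \<open>U V0\<close> as required. For \<open>V1\<close> the identity \<open>\<zeta> d t = \<plusminus> \<omega> N t\<close>, where the derivation \<open>N\<close> multiplies by
  the degree in \<open>\<zeta>\<close>, shows that \<open>\<omega> V1 = 0\<close>; as every differential is a multiple of \<open>\<omega>\<close>, writing
  \<open>U = \<Sum> v_m r_m\<close> makes each \<open>r_m V1\<close> closed. The argument treats even and odd \<open>z\<close> alike.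

  All identities in \<open>\<Lambda>\<close> are proved in the tensor algebra, as congruences modulo the ideal that defines \<open>\<Lambda>\<close>.
\<close>

text \<open>Signs are computed with sums and products of parities, not with Boolean connectives.\<close>

declare mult_bit_eq_and [simp del] add_bit_eq_xor [simp del]

section \<open>Linear maps on the tensor algebra\<close>

definition smul :: "'f::field \<Rightarrow> ('i word \<Rightarrow>\<^sub>0 'f) \<Rightarrow> ('i word \<Rightarrow>\<^sub>0 'f)"
  where "smul c t = Poly_Mapping.single 0 c * t"

abbreviation word_tensor :: "'i word \<Rightarrow> ('i word \<Rightarrow>\<^sub>0 'f::field)"
  where "word_tensor w \<equiv> Poly_Mapping.single w 1"

definition letter :: "'i \<Rightarrow> ('i word \<Rightarrow>\<^sub>0 'f::field)"
  where "letter i = word_tensor (Word [i])"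

lemma lookup_smul [simp]: "Poly_Mapping.lookup (smul c t) w = c * Poly_Mapping.lookup t w"
proof -
  have "smul c t = Poly_Mapping.map ((*) c) t"
    by (simp add: smul_def mult_map_scale_conv_mult)
  then show ?thesis by (simp add: Poly_Mapping.map.rep_eq when_def)
qed

global_interpretation tensor_space: vector_space smul
  by standard (auto intro!: poly_mapping_eqI simp: lookup_add algebra_simps)

lemma smul_mult_left [simp]: "smul c s * t = smul c (s * t)"
  by (simp add: smul_def mult.assoc)

lemma smul_mult_right [simp]: "s * smul c t = smul c (s * t)"
proof -
  have "s * Poly_Mapping.single 0 c = Poly_Mapping.single 0 c * s"
  proof (induction s rule: update_induct)
    case const then show ?case by simp
  next
    case (update f a b)
    have "Poly_Mapping.update a b f = f + Poly_Mapping.single a b"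
      using update(1) by (intro poly_mapping_eqI) (auto simp: lookup_update lookup_add lookup_single when_def in_keys_iff)
    then show ?case using update(3) by (simp add: distrib_left distrib_right mult_single mult.commute)
  qed
  then show ?thesis by (simp add: smul_def mult.assoc[symmetric])
qed

lemma single_eq_smul: "Poly_Mapping.single w c = smul c (word_tensor w)"
  by (simp add: smul_def mult_single)

lemma word_tensor_Cons: "word_tensor (Word (i # is)) = letter i * word_tensor (Word is)"
  by (simp add: letter_def mult_single plus_word_def)

lemma word_tensor_Nil: "word_tensor (Word []) = 1"
  by (simp flip: zero_word_def)

lemma poly_mapping_sum_keys:
  assumes "finite A" "Poly_Mapping.keys t \<subseteq> A"
  shows "t = (\<Sum>w\<in>A. Poly_Mapping.single w (Poly_Mapping.lookup t w))"
  using assms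
  by (intro poly_mapping_eqI)
    (auto simp: lookup_sum lookup_single when_def in_keys_iff sum.delta)

text \<open>
  The operators on tensors (differential, derivations, sign twists, contractions) are linear extensions
  of functions on words that recurse on the first letter. For each of them one derives its value on
  \<open>letter i * t\<close> and then argues with \<open>tensors_over_induct\<close>.
\<close>

definition lin_ext :: "('i word \<Rightarrow> ('j word \<Rightarrow>\<^sub>0 'f::field)) \<Rightarrow> ('i word \<Rightarrow>\<^sub>0 'f) \<Rightarrow> ('j word \<Rightarrow>\<^sub>0 'f)"
  where "lin_ext F t = (\<Sum>w\<in>Poly_Mapping.keys t. smul (Poly_Mapping.lookup t w) (F w))"

lemma lin_ext_superset:
  assumes "finite A" "Poly_Mapping.keys t \<subseteq> A"
  shows "lin_ext F t = (\<Sum>w\<in>A. smul (Poly_Mapping.lookup t w) (F w))"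
  unfolding lin_ext_def
  by (rule sum.mono_neutral_left) (use assms in \<open>auto simp: in_keys_iff\<close>)

lemma lin_ext_add [simp]: "lin_ext F (s + t) = lin_ext F s + lin_ext F t"
proof -
  let ?A = "Poly_Mapping.keys s \<union> Poly_Mapping.keys t"
  have "lin_ext F u = (\<Sum>w\<in>?A. smul (Poly_Mapping.lookup u w) (F w))" if "u \<in> {s, t, s + t}" for u
    by (rule lin_ext_superset) (use that Poly_Mapping.keys_add[of s t] in auto)
  then show ?thesis
    by (simp add: lookup_add tensor_space.scale_left_distrib sum.distrib)
qed

lemma lin_ext_smul [simp]: "lin_ext F (smul c t) = smul c (lin_ext F t)"
proof -
  have "lin_ext F (smul c t) = (\<Sum>w\<in>Poly_Mapping.keys t. smul (Poly_Mapping.lookup (smul c t) w) (F w))"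
    by (rule lin_ext_superset) (auto simp: in_keys_iff)
  then show ?thesis by (simp add: lin_ext_def tensor_space.scale_sum_right)
qed

lemma lin_ext_zero [simp]: "lin_ext F 0 = 0"
  by (simp add: lin_ext_def)

lemma lin_ext_uminus [simp]: "lin_ext F (- t) = - lin_ext F t"
  using lin_ext_smul[of F "- 1" t] by simp

lemma lin_ext_diff [simp]: "lin_ext F (s - t) = lin_ext F s - lin_ext F t"
  using lin_ext_add[of F s "- t"] by simp

lemma lin_ext_sum: "lin_ext F (\<Sum>a\<in>A. f a) = (\<Sum>a\<in>A. lin_ext F (f a))"
  by (induction A rule: infinite_finite_induct) auto

lemma lin_ext_word [simp]: "lin_ext F (word_tensor w) = F w"
  by (simp add: lin_ext_def)

lemma lin_ext_one: "lin_ext F 1 = F (Word [])"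
  using lin_ext_word[of F "Word []"] by (simp add: word_tensor_Nil)

lemma tensor_eq_sum:
  "t = (\<Sum>w\<in>Poly_Mapping.keys t. smul (Poly_Mapping.lookup t w) (word_tensor w))"
  using poly_mapping_sum_keys[of "Poly_Mapping.keys t" t] by (simp flip: single_eq_smul)

lemma lin_ext_letter_mult:
  "lin_ext F (letter i * t) = lin_ext (\<lambda>w. F (Word (i # letters w))) t"
proof -
  have "letter i * t = (\<Sum>w\<in>Poly_Mapping.keys t. smul (Poly_Mapping.lookup t w) (word_tensor (Word (i # letters w))))"
    by (subst tensor_eq_sum[of t]) (simp add: sum_distrib_left word_tensor_Cons)
  then show ?thesis by (simp add: lin_ext_sum) (simp add: lin_ext_def)
qed

lemma lin_ext_plus_fun: "lin_ext (\<lambda>w. F w + G w) t = lin_ext F t + lin_ext G t"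
  by (simp add: lin_ext_def sum.distrib tensor_space.scale_right_distrib)

lemma lin_ext_smul_fun: "lin_ext (\<lambda>w. smul c (F w)) t = smul c (lin_ext F t)"
  by (simp add: lin_ext_def tensor_space.scale_sum_right mult.commute)

lemma lin_ext_mult_fun: "lin_ext (\<lambda>w. u * F w) t = u * lin_ext F t"
  by (simp add: lin_ext_def sum_distrib_left)

lemma lin_ext_zero_fun [simp]: "lin_ext (\<lambda>w. 0) t = 0"
  by (simp add: lin_ext_def)

lemma lin_ext_word_tensor: "lin_ext word_tensor t = t"
  by (simp add: lin_ext_def flip: tensor_eq_sum)

lemma lookup_letter_mult_zero [simp]: "Poly_Mapping.lookup (letter i * r) 0 = 0"
  unfolding not_in_keys_iff_lookup_eq_zero [symmetric]
  using keys_mult[of "letter i" r] by (auto simp: letter_def zero_word_def plus_word_def)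

lemma tensors_over_closed [simp, intro]:
  "0 \<in> tensors_over I" "(1 :: 'i word \<Rightarrow>\<^sub>0 'f::field) \<in> tensors_over I"
  by (auto simp: tensors_over_def zero_word_def)

lemma tensors_over_add [intro]:
  fixes s t :: "'i word \<Rightarrow>\<^sub>0 'b::monoid_add"
  assumes "s \<in> tensors_over I" "t \<in> tensors_over I"
  shows "s + t \<in> tensors_over I"
  using assms Poly_Mapping.keys_add[of s t] by (auto simp: tensors_over_def)

lemma tensors_over_mult [intro]:
  fixes s t :: "'i word \<Rightarrow>\<^sub>0 'f::field"
  assumes "s \<in> tensors_over I" "t \<in> tensors_over I"
  shows "s * t \<in> tensors_over I"
  unfolding tensors_over_def
proof (intro CollectI ballI)
  fix w assume "w \<in> Poly_Mapping.keys (s * t)"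
  then obtain u v where "w = u + v" "u \<in> Poly_Mapping.keys s" "v \<in> Poly_Mapping.keys t"
    using keys_mult[of s t] by auto
  with assms show "set (letters w) \<subseteq> I"
    by (auto simp: tensors_over_def plus_word_def)
qed

lemma tensors_over_smul [intro]: "t \<in> tensors_over I \<Longrightarrow> smul c t \<in> tensors_over I"
  by (auto simp: tensors_over_def in_keys_iff)

lemma tensors_over_uminus [intro]:
  fixes t :: "'i word \<Rightarrow>\<^sub>0 'f::field"
  shows "t \<in> tensors_over I \<Longrightarrow> - t \<in> tensors_over I"
  by (auto simp: tensors_over_def in_keys_iff)

lemma tensors_over_diff [intro]:
  fixes s t :: "'i word \<Rightarrow>\<^sub>0 'f::field"
  assumes "s \<in> tensors_over I" "t \<in> tensors_over I"
  shows "s - t \<in> tensors_over I"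
  using tensors_over_add[OF assms(1) tensors_over_uminus[OF assms(2)]] by simp

lemma tensors_over_sum [intro]:
  fixes f :: "'a \<Rightarrow> ('i word \<Rightarrow>\<^sub>0 'b::comm_monoid_add)"
  assumes "\<And>a. a \<in> A \<Longrightarrow> f a \<in> tensors_over I"
  shows "(\<Sum>a\<in>A. f a) \<in> tensors_over I"
  using assms by (induction A rule: infinite_finite_induct) auto

lemma tensors_over_power [intro]:
  fixes t :: "'i word \<Rightarrow>\<^sub>0 'f::field"
  shows "t \<in> tensors_over I \<Longrightarrow> t ^ n \<in> tensors_over I"
  by (induction n) auto

lemma letter_in_tensors_over [intro]: "i \<in> I \<Longrightarrow> letter i \<in> tensors_over I"
  by (auto simp: letter_def tensors_over_def)

text \<open>
  Induction on a tensor by splitting off the first letter of its words.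
\<close>

lemma tensors_over_induct [consumes 1, case_names add smul one letter]:
  fixes t :: "'i word \<Rightarrow>\<^sub>0 'f::field"
  assumes t: "t \<in> tensors_over I"
    and add: "\<And>s t. \<lbrakk>s \<in> tensors_over I; t \<in> tensors_over I; P s; P t\<rbrakk> \<Longrightarrow> P (s + t)"
    and smul: "\<And>c t. \<lbrakk>t \<in> tensors_over I; P t\<rbrakk> \<Longrightarrow> P (smul c t)"
    and one: "P 1"
    and letter: "\<And>i t. \<lbrakk>i \<in> I; t \<in> tensors_over I; P t\<rbrakk> \<Longrightarrow> P (letter i * t)"
  shows "P t"
proof -
  have zero: "P 0" using smul[of 1 0] one by auto
  have word: "P (word_tensor (Word is)) \<and> (word_tensor (Word is) :: 'i word \<Rightarrow>\<^sub>0 'f) \<in> tensors_over I" if "set is \<subseteq> I" for "is"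
    using that
  proof (induction "is")
    case Nil
    then show ?case using one by (simp add: word_tensor_Nil)
  next
    case (Cons i "is")
    then show ?case using letter by (auto simp: word_tensor_Cons)
  qed
  have "P (\<Sum>w\<in>A. smul (c w) (word_tensor w)) \<and> (\<Sum>w\<in>A. smul (c w) (word_tensor w)) \<in> tensors_over I"
    if "finite A" "\<forall>w\<in>A. set (letters w) \<subseteq> I" for A and c :: "'i word \<Rightarrow> 'f"
    using that
  proof (induction A rule: finite_induct)
    case empty then show ?case using zero by auto
  next
    case (insert w A)
    then have "P (smul (c w) (word_tensor w)) \<and> smul (c w) (word_tensor w) \<in> tensors_over I"
      using word[of "letters w"] smul by auto
    with insert show ?case using add by auto
  qed
  from this[of "Poly_Mapping.keys t" "Poly_Mapping.lookup t"] t show ?thesis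
    by (simp add: tensors_over_def flip: tensor_eq_sum)
qed

lemma vectors_over_induct [consumes 1, case_names zero add letter]:
  fixes x :: "'i word \<Rightarrow>\<^sub>0 'f::field"
  assumes x: "x \<in> vectors_over I par p"
    and zero: "P 0"
    and add: "\<And>s t. \<lbrakk>P s; P t\<rbrakk> \<Longrightarrow> P (s + t)"
    and letter: "\<And>c i. \<lbrakk>i \<in> I; par i = p\<rbrakk> \<Longrightarrow> P (smul c (letter i))"
  shows "P x"
proof -
  have "P (\<Sum>w\<in>A. smul (c w) (word_tensor w))"
    if "finite A" "A \<subseteq> {Word [i] | i. i \<in> I \<and> par i = p}" for A and c :: "'i word \<Rightarrow> 'f"
    using that
  proof (induction A rule: finite_induct)
    case empty then show ?case using zero by auto
  next
    case (insert w A)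
    then obtain i where "w = Word [i]" "i \<in> I" "par i = p" by auto
    with insert show ?case using add letter[of i "c w"] by (auto simp: letter_def)
  qed
  from this[of "Poly_Mapping.keys x" "Poly_Mapping.lookup x"] x show ?thesis
    by (simp add: vectors_over_def flip: tensor_eq_sum)
qed

lemma vectors_over_closed [intro]:
  "0 \<in> vectors_over I par p"
  "\<lbrakk>s \<in> vectors_over I par p; t \<in> vectors_over I par p\<rbrakk> \<Longrightarrow> s + t \<in> vectors_over I par p"
  "t \<in> vectors_over I par p \<Longrightarrow> smul c t \<in> vectors_over I par p"
  for s t :: "'i word \<Rightarrow>\<^sub>0 'f::field"
  using Poly_Mapping.keys_add[of s t] by (auto simp: vectors_over_def in_keys_iff subset_iff lookup_add) 

lemma letter_in_vectors_over [intro]: "\<lbrakk>i \<in> I; par i = p\<rbrakk> \<Longrightarrow> letter i \<in> vectors_over I par p"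
  by (auto simp: letter_def vectors_over_def)

lemma vectors_over_subset_tensors: "vectors_over I par p \<subseteq> tensors_over I"
  by (auto simp: vectors_over_def tensors_over_def)

text \<open>
  Derivations (\<open>\<epsilon> = 1\<close>) and antiderivations (\<open>\<epsilon> = -1\<close>) with prescribed values \<open>\<delta>\<close> on letters.
\<close>

primrec der_list :: "'f::field \<Rightarrow> ('i \<Rightarrow> ('i word \<Rightarrow>\<^sub>0 'f)) \<Rightarrow> 'i list \<Rightarrow> ('i word \<Rightarrow>\<^sub>0 'f)" where
  "der_list \<epsilon> \<delta> [] = 0"
| "der_list \<epsilon> \<delta> (i # is) = \<delta> i * word_tensor (Word is) + smul \<epsilon> (letter i * der_list \<epsilon> \<delta> is)"

abbreviation der :: "'f::field \<Rightarrow> ('i \<Rightarrow> ('i word \<Rightarrow>\<^sub>0 'f)) \<Rightarrow> ('i word \<Rightarrow>\<^sub>0 'f) \<Rightarrow> ('i word \<Rightarrow>\<^sub>0 'f)"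
  where "der \<epsilon> \<delta> \<equiv> lin_ext (\<lambda>w. der_list \<epsilon> \<delta> (letters w))"

text \<open>
  The algebra endomorphism that scales each letter \<open>i\<close> by \<open>\<chi> i\<close>; it carries the signs that arise from
  permuting factors.
\<close>

abbreviation twist :: "('i \<Rightarrow> 'f::field) \<Rightarrow> ('i word \<Rightarrow>\<^sub>0 'f) \<Rightarrow> ('i word \<Rightarrow>\<^sub>0 'f)"
  where "twist \<chi> \<equiv> lin_ext (\<lambda>w. smul (prod_list (map \<chi> (letters w))) (word_tensor w))"

lemma der_one [simp]: "der \<epsilon> \<delta> 1 = 0"
  by (simp add: lin_ext_one)

lemma der_letter_mult [simp]:
  "der \<epsilon> \<delta> (letter i * t) = \<delta> i * t + smul \<epsilon> (letter i * der \<epsilon> \<delta> t)"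
  by (simp add: lin_ext_letter_mult lin_ext_plus_fun lin_ext_smul_fun lin_ext_mult_fun lin_ext_word_tensor)

lemma der_letter [simp]: "der \<epsilon> \<delta> (letter i) = \<delta> i"
  using der_letter_mult[of \<epsilon> \<delta> i 1] by (simp del: der_letter_mult)

lemma twist_one [simp]: "twist \<chi> 1 = 1"
  by (simp add: lin_ext_one word_tensor_Nil)

lemma twist_letter_mult [simp]: "twist \<chi> (letter i * t) = smul (\<chi> i) (letter i * twist \<chi> t)"
proof -
  have "twist \<chi> (letter i * t) = lin_ext (\<lambda>w. smul (\<chi> i) (letter i * smul (prod_list (map \<chi> (letters w))) (word_tensor w))) t"
    by (simp add: lin_ext_letter_mult word_tensor_Cons)
  also have "\<dots> = smul (\<chi> i) (letter i * twist \<chi> t)"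
    by (subst lin_ext_smul_fun, subst lin_ext_mult_fun) simp
  finally show ?thesis .
qed

lemma twist_letter [simp]: "twist \<chi> (letter i) = smul (\<chi> i) (letter i)"
  using twist_letter_mult[of \<chi> i 1] by (simp del: twist_letter_mult)

lemma in_tensors_over_UNIV: "t \<in> tensors_over UNIV"
  by (simp add: tensors_over_def)

lemma twist_mult: "twist \<chi> (s * t) = twist \<chi> s * twist \<chi> t"
  using in_tensors_over_UNIV[of s]
  by (induction s rule: tensors_over_induct)
    (simp_all add: distrib_right mult.assoc del: word.map)

lemma der_mult: "der \<epsilon> \<delta> (s * t) = der \<epsilon> \<delta> s * t + twist (\<lambda>_. \<epsilon>) s * der \<epsilon> \<delta> t"
  using in_tensors_over_UNIV[of s]
  by (induction s rule: tensors_over_induct)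
    (simp_all add: distrib_right distrib_left mult.assoc tensor_space.scale_right_distrib)

lemma twist_in_tensors_over: "t \<in> tensors_over I \<Longrightarrow> twist \<chi> t \<in> tensors_over I"
  by (induction t rule: tensors_over_induct) auto

lemma der_in_tensors_over:
  assumes "t \<in> tensors_over I" "\<And>i. i \<in> I \<Longrightarrow> \<delta> i \<in> tensors_over I"
  shows "der \<epsilon> \<delta> t \<in> tensors_over I"
  using assms(1) by (induction t rule: tensors_over_induct) (auto intro: assms(2))

lemma twist_trivial: "twist (\<lambda>_. 1) t = t"
  using in_tensors_over_UNIV[of t] by (induction t rule: tensors_over_induct) simp_all

lemma psign_add: "psign (p + q) = psign p * psign q"
  by (cases p; cases q) (simp_all add: psign_def)

lemma psign_square [simp]: "psign p * psign p = 1" "psign p * (psign p * c) = c"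
  by (simp_all add: psign_def)

lemma psign_same [simp]: "psign (p * p) = psign p"
  by (cases p) (simp_all add: psign_def)

section \<open>The super-exterior ideal\<close>

locale super_exterior =
  fixes I :: "'i set" and par :: "'i \<Rightarrow> bit"
begin

abbreviation T :: "('i word \<Rightarrow>\<^sub>0 'f::field) set"
  where "T \<equiv> tensors_over I"

abbreviation J :: "('i word \<Rightarrow>\<^sub>0 'f::field) set"
  where "J \<equiv> ext_ideal I par"

abbreviation vec :: "bit \<Rightarrow> ('i word \<Rightarrow>\<^sub>0 'f::field) set"
  where "vec p \<equiv> vectors_over I par p"

definition eqv :: "('i word \<Rightarrow>\<^sub>0 'f::field) \<Rightarrow> ('i word \<Rightarrow>\<^sub>0 'f) \<Rightarrow> bool"  (infix \<open>\<approx>\<close> 50)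
  where "s \<approx> t \<longleftrightarrow> s - t \<in> J"

lemma vec_T: "x \<in> vec p \<Longrightarrow> x \<in> T"
  using vectors_over_subset_tensors by blast

lemma J_smul: "t \<in> J \<Longrightarrow> smul c t \<in> J"
  using ext_ideal.mult_left[of "smul c 1" I t par] by auto

lemma J_uminus: "t \<in> J \<Longrightarrow> - t \<in> J"
  using J_smul[of t "- 1"] by simp

lemma J_diff: "\<lbrakk>s \<in> J; t \<in> J\<rbrakk> \<Longrightarrow> s - t \<in> J"
  using ext_ideal.add[OF _ J_uminus] by fastforce

lemma J_sum: "(\<And>a. a \<in> A \<Longrightarrow> f a \<in> J) \<Longrightarrow> (\<Sum>a\<in>A. f a) \<in> J"
  by (induction A rule: infinite_finite_induct) (auto intro: ext_ideal.zero ext_ideal.add)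

lemma eqv_refl [simp, intro]: "t \<approx> t"
  by (simp add: eqv_def ext_ideal.zero)

lemma eqv_sym: "s \<approx> t \<Longrightarrow> t \<approx> s"
  using J_uminus[of "s - t"] by (simp add: eqv_def)

lemma eqv_trans [trans]: "\<lbrakk>r \<approx> s; s \<approx> t\<rbrakk> \<Longrightarrow> r \<approx> t"
  using ext_ideal.add[of "r - s" I par "s - t"] by (simp add: eqv_def)

lemma eqv_add: "\<lbrakk>s \<approx> s'; t \<approx> t'\<rbrakk> \<Longrightarrow> s + t \<approx> s' + t'"
  using ext_ideal.add[of "s - s'" I par "t - t'"] by (simp add: eqv_def algebra_simps)

lemma eqv_uminus: "s \<approx> s' \<Longrightarrow> - s \<approx> - s'"
  using J_uminus[of "s - s'"] by (simp add: eqv_def)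

lemma eqv_diff: "\<lbrakk>s \<approx> s'; t \<approx> t'\<rbrakk> \<Longrightarrow> s - t \<approx> s' - t'"
  using eqv_add[OF _ eqv_uminus] by fastforce

lemma eqv_smul: "s \<approx> s' \<Longrightarrow> smul c s \<approx> smul c s'"
  using J_smul[of "s - s'" c] by (simp add: eqv_def tensor_space.scale_right_diff_distrib)

lemma eqv_sum: "(\<And>a. a \<in> A \<Longrightarrow> f a \<approx> g a) \<Longrightarrow> (\<Sum>a\<in>A. f a) \<approx> (\<Sum>a\<in>A. g a)"
  using J_sum[of A "\<lambda>a. f a - g a"] by (simp add: eqv_def sum_subtractf)

lemma eqv_mult_left: "\<lbrakk>s \<approx> s'; u \<in> T\<rbrakk> \<Longrightarrow> u * s \<approx> u * s'"
  using ext_ideal.mult_left[of u I "s - s'" par] by (simp add: eqv_def algebra_simps)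

lemma eqv_mult_right: "\<lbrakk>s \<approx> s'; u \<in> T\<rbrakk> \<Longrightarrow> s * u \<approx> s' * u"
  using ext_ideal.mult_right[of "s - s'" I par u] by (simp add: eqv_def algebra_simps)

lemma eqv_zero_iff: "t \<approx> 0 \<longleftrightarrow> t \<in> J"
  by (simp add: eqv_def)

lemma eqv_in_J: "\<lbrakk>s \<approx> t; t \<in> J\<rbrakk> \<Longrightarrow> s \<in> J"
  using eqv_trans[of s t 0] by (simp add: eqv_zero_iff)

text \<open>
  A vector can be moved to the left of any tensor, at the price of the sign that it picks up when it
  passes each letter.
\<close>

lemma super_commute:
  assumes "t \<in> T" "y \<in> vec q"
  shows "t * y \<approx> y * twist (\<lambda>i. - psign (par i * q)) t"
  using assms(1)
proof (induction t rule: tensors_over_induct)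
  case (add s t)
  then show ?case by (simp add: distrib_left distrib_right eqv_add)
next
  case (smul c t)
  then show ?case by (simp add: eqv_smul)
next
  case one
  then show ?case by simp
next
  case (letter i t)
  let ?\<tau> = "twist (\<lambda>i. - psign (par i * q)) t"
  have \<tau>: "?\<tau> \<in> T" using letter by (intro twist_in_tensors_over)
  have "letter i * t * y \<approx> letter i * (y * ?\<tau>)"
    unfolding mult.assoc using letter by (intro eqv_mult_left) auto
  also have "letter i * y \<approx> - smul (psign (par i * q)) (y * letter i)"
    using ext_ideal.generator[OF letter_in_vectors_over[OF letter(1) refl] assms(2)]
    by (simp add: eqv_def smul_def)
  from eqv_mult_right[OF this \<tau>]
  have "letter i * (y * ?\<tau>) \<approx> y * twist (\<lambda>i. - psign (par i * q)) (letter i * t)"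
    by (simp add: mult.assoc)
  finally show ?case .
qed

lemma twist_in_vec: "x \<in> vec p \<Longrightarrow> twist \<chi> x \<in> vec p"
  by (induction x rule: vectors_over_induct) (auto simp del: twist_letter_mult)

lemma twist_in_J: "t \<in> J \<Longrightarrow> twist \<chi> t \<in> J"
proof (induction rule: ext_ideal.induct)
  case (generator x p y q)
  then show ?case
    using ext_ideal.generator[OF twist_in_vec[OF generator(1)] twist_in_vec[OF generator(2)]]
    by (simp add: twist_mult flip: smul_def)
qed (auto simp: twist_mult intro: ext_ideal.intros twist_in_tensors_over)

lemma eqv_twist: "s \<approx> t \<Longrightarrow> twist \<chi> s \<approx> twist \<chi> t"
  using twist_in_J[of "s - t"] by (simp add: eqv_def)

text \<open>
  A derivation that preserves the parity of letters maps each generator of the ideal to a sum of two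
  generators.
\<close>

lemma der_even_in_J:
  assumes \<delta>: "\<And>i. i \<in> I \<Longrightarrow> \<delta> i \<in> vec (par i)" and "t \<in> J"
  shows "der 1 \<delta> t \<in> J"
proof -
  have vec: "der 1 \<delta> x \<in> vec p" if "x \<in> vec p" for x p
    using that by (induction x rule: vectors_over_induct) (auto intro: \<delta>)
  have T: "der 1 \<delta> u \<in> T" if "u \<in> T" for u
    using that \<delta> vec_T by (blast intro: der_in_tensors_over)
  show ?thesis using assms(2)
  proof (induction rule: ext_ideal.induct)
    case (generator x p y q)
    have "der 1 \<delta> (x * y + smul (psign (p * q)) (y * x)) =
       (der 1 \<delta> x * y + smul (psign (p * q)) (y * der 1 \<delta> x)) +
       (x * der 1 \<delta> y + smul (psign (p * q)) (der 1 \<delta> y * x))"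
      by (simp add: der_mult twist_trivial tensor_space.scale_right_distrib)
    also have "\<dots> \<in> J"
      using ext_ideal.generator[of "der 1 \<delta> x" I par p y q]
        ext_ideal.generator[of x I par p "der 1 \<delta> y" q] vec generator
      by (auto simp: smul_def intro: ext_ideal.add)
    finally show ?case by (simp add: smul_def)
  qed (auto simp: der_mult twist_trivial intro: ext_ideal.intros T)
qed

lemma lookup_zero_of_J:
  assumes "t \<in> J"
  shows "Poly_Mapping.lookup t 0 = 0"
proof -
  have mult0: "Poly_Mapping.lookup (s * t) 0 = Poly_Mapping.lookup s 0 * Poly_Mapping.lookup t 0"
    for s t :: "'i word \<Rightarrow>\<^sub>0 'f::field"
    using in_tensors_over_UNIV[of s]
  proof (induction s rule: tensors_over_induct)
    case (letter i s)
    show ?case by (simp add: mult.assoc)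
  qed (simp_all add: distrib_right lookup_add)
  have vec0: "Poly_Mapping.lookup x 0 = 0" if "x \<in> vec p" for x p
    using that by (auto simp: vectors_over_def zero_word_def in_keys_iff subset_iff)
  show ?thesis using assms
    by (induction rule: ext_ideal.induct) (auto simp: lookup_add mult0 vec0)
qed

end

text \<open>
  Eigenvectors for distinct eigenvalues: an invariant subspace that contains their sum contains each of
  them. Applied to the derivation that counts one variable, it splits a statement on a tensor into
  statements on its parts of fixed degree in this variable.
\<close>

lemma eigen_components:
  fixes s :: "nat \<Rightarrow> ('i word \<Rightarrow>\<^sub>0 'f::field_char_0)"
  assumes K_add: "\<And>s t. \<lbrakk>s \<in> K; t \<in> K\<rbrakk> \<Longrightarrow> s + t \<in> K"
    and K_smul: "\<And>c t. t \<in> K \<Longrightarrow> smul c t \<in> K"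
    and K_inv: "\<And>t. t \<in> K \<Longrightarrow> lin_ext F t \<in> K"
    and "\<And>k. k \<le> n \<Longrightarrow> lin_ext F (s k) = smul (of_nat k) (s k)"
    and "(\<Sum>k\<le>n. s k) \<in> K" and "k \<le> n"
  shows "s k \<in> K"
proof -
  have zero: "0 \<in> K" using K_smul[OF assms(5), of 0] by simp
  have K_sum: "(\<Sum>a\<in>A. g a) \<in> K" if "\<And>a. a \<in> A \<Longrightarrow> g a \<in> K" for A :: "nat set" and g
    using that by (induction A rule: infinite_finite_induct) (auto intro: zero K_add)
  show ?thesis
    using assms(4-)
  proof (induction n arbitrary: s k)
    case 0
    then show ?case by simp
  next
    case (Suc n)
    let ?S = "\<Sum>k\<le>Suc n. s k"
    have low: "s k \<in> K" if "k \<le> n" for k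
    proof -
      \<comment> \<open>Subtracting the top eigenvalue kills the last summand and rescales the others.\<close>
      let ?s = "\<lambda>k. smul (of_nat k - of_nat (Suc n)) (s k)"
      have "lin_ext F ?S - smul (of_nat (Suc n)) ?S = (\<Sum>k\<le>Suc n. ?s k)"
        using Suc.prems(1)
        by (simp add: lin_ext_sum tensor_space.scale_sum_right tensor_space.scale_left_diff_distrib
            sum_subtractf del: of_nat_Suc sum.atMost_Suc)
      then have "(\<Sum>k\<le>n. ?s k) = lin_ext F ?S + smul (- of_nat (Suc n)) ?S"
        by (simp del: of_nat_Suc)
      also have "\<dots> \<in> K" using Suc.prems(2) by (intro K_add K_smul K_inv)
      finally have "?s k \<in> K"
        using Suc.prems(1) \<open>k \<le> n\<close> by (intro Suc.IH[of ?s]) (auto simp: mult.commute)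
      from K_smul[OF this, of "inverse (of_nat k - of_nat (Suc n))"] \<open>k \<le> n\<close>
      have "smul (inverse (of_nat k - of_nat (Suc n)) * (of_nat k - of_nat (Suc n))) (s k) \<in> K"
        by (simp del: of_nat_Suc)
      moreover have "of_nat k - of_nat (Suc n) \<noteq> (0::'f)"
        using \<open>k \<le> n\<close> of_nat_eq_iff[where 'a='f, of k "Suc n"] by (auto simp del: of_nat_Suc of_nat_eq_iff)
      ultimately show ?thesis by simp
    qed
    show ?case
    proof (cases "k \<le> n")
      case False
      then have "s k = ?S + (\<Sum>k\<le>n. smul (- 1) (s k))"
        using Suc.prems(3) by (simp add: le_Suc_eq sum_negf)
      moreover have "(\<Sum>k\<le>n. smul (- 1) (s k)) \<in> K"
        using low by (intro K_sum K_smul) auto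
      ultimately show ?thesis using K_add Suc.prems(2) by auto
    qed (use low in auto)
  qed
qed

section \<open>Chevalley--Eilenberg differential of a Heisenberg Lie superalgebra\<close>

text \<open>
  The data of a Heisenberg Lie superalgebra in a homogeneous basis indexed by \<open>I\<close>: \<open>a\<close> are the coordinates
  of the central element \<open>z\<close>, of parity \<open>zp\<close>, and \<open>\<beta>\<close> is the form with \<open>[e_k, e_l] = \<beta> k l z\<close>. The last
  assumptions on \<open>\<beta>\<close> say that \<open>z\<close> spans its radical and that every linear form vanishing on \<open>z\<close> is
  \<open>\<beta>(-, n)\<close> for some \<open>n\<close>. The basis need not contain \<open>z\<close>; the index \<open>j\<close> of a nonzero coordinate of \<open>z\<close> is
  used to normalise \<open>\<zeta>\<close>.
\<close>

locale heisenberg_constants = super_exterior I par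
  for I :: "'i::linorder set" and par :: "'i \<Rightarrow> bit" +
  fixes zp :: bit and a :: "'i \<Rightarrow> 'f::field_char_0" and \<beta> :: "'i \<Rightarrow> 'i \<Rightarrow> 'f" and j :: 'i
  assumes fin: "finite I"
    and a_par: "\<lbrakk>i \<in> I; a i \<noteq> 0\<rbrakk> \<Longrightarrow> par i = zp"
    and \<beta>_par: "\<lbrakk>k \<in> I; l \<in> I; \<beta> k l \<noteq> 0\<rbrakk> \<Longrightarrow> par k + par l = zp"
    and \<beta>_skew: "\<lbrakk>k \<in> I; l \<in> I\<rbrakk> \<Longrightarrow> \<beta> k l = - psign (par k * par l) * \<beta> l k"
    and \<beta>_center: "k \<in> I \<Longrightarrow> (\<Sum>l\<in>I. \<beta> k l * a l) = 0"
    and \<beta>_nondegenerate: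
      "(\<And>k. k \<in> I \<Longrightarrow> (\<Sum>l\<in>I. \<beta> k l * c l) = 0) \<Longrightarrow> \<exists>s. \<forall>l\<in>I. c l = s * a l"
    and \<beta>_onto:
      "(\<Sum>k\<in>I. c k * a k) = 0 \<Longrightarrow> \<exists>m. \<forall>k\<in>I. c k = (\<Sum>l\<in>I. \<beta> k l * m l)"
    and j: "j \<in> I" "a j \<noteq> 0"
begin

text \<open>
  The two-form with \<open>d x_i = a_i \<omega>\<close>; its coefficients are those of the differential, with the structure
  constants \<open>\<beta> k l * a i\<close> divided by \<open>a i\<close>.
\<close>

definition \<omega> :: "'i word \<Rightarrow>\<^sub>0 'f"
  where "\<omega> = (\<Sum>(k, l) \<in> {(k, l). k \<in> I \<and> l \<in> I \<and> k < l}.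
       smul (psign (par k * par l + 1) * \<beta> k l) (letter k * letter l)) +
    (\<Sum>k\<in>I. smul (1 / 2 * \<beta> k k) (letter k * letter k))"

definition \<zeta> :: "'i word \<Rightarrow>\<^sub>0 'f"
  where "\<zeta> = smul (1 / a j) (letter j)"

definition v :: "'i \<Rightarrow> ('i word \<Rightarrow>\<^sub>0 'f)"
  where "v i = letter i - smul (a i) \<zeta>"

text \<open>
  Where \<open>\<beta> k l\<close> is nonzero, this is the sign \<open>psign (par k * par l)\<close>, expressed through \<open>l\<close> alone
  (lemma \<open>\<eta>_\<beta>\<close>). Hence \<open>b l\<close>, the form that enters the differential of \<open>e_l\<close>, is linear in \<open>e_l\<close>
  up to these signs.
\<close>

definition \<eta> :: "'i \<Rightarrow> 'f"
  where "\<eta> l = psign ((zp + par l) * par l)"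

definition b :: "'i \<Rightarrow> ('i word \<Rightarrow>\<^sub>0 'f)"
  where "b l = (\<Sum>k\<in>I. smul (\<eta> l * \<beta> k l) (letter k))"

abbreviation dif :: "('i word \<Rightarrow>\<^sub>0 'f) \<Rightarrow> ('i word \<Rightarrow>\<^sub>0 'f)"
  where "dif \<equiv> der (- 1) (\<lambda>i. smul (a i) \<omega>)"

abbreviation N :: "('i word \<Rightarrow>\<^sub>0 'f) \<Rightarrow> ('i word \<Rightarrow>\<^sub>0 'f)"
  where "N \<equiv> der 1 (\<lambda>i. smul (a i) \<zeta>)"

lemma psign_eq_if: "psign p = (if p = 0 then 1 else - 1 :: 'f)"
  by (simp add: psign_def)

lemma par_j: "par j = zp"
  using a_par j by blast

lemma \<zeta>_T: "\<zeta> \<in> T"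
  using j by (auto simp: \<zeta>_def)

lemma \<zeta>_vec: "\<zeta> \<in> vec zp"
  using j par_j by (auto simp: \<zeta>_def)

lemma smul_a_\<zeta>_vec: "i \<in> I \<Longrightarrow> smul (a i) \<zeta> \<in> vec (par i)"
  using \<zeta>_vec a_par by (cases "a i = 0") auto

lemma v_vec: "i \<in> I \<Longrightarrow> v i \<in> vec (par i)"
  using vectors_over_closed(2)[OF letter_in_vectors_over vectors_over_closed(3)[OF smul_a_\<zeta>_vec, where c = "- 1"], of i i]
  by (simp add: v_def)

lemma v_T: "i \<in> I \<Longrightarrow> v i \<in> T"
  using v_vec vec_T by blast

lemma \<omega>_T: "\<omega> \<in> T"
  by (auto simp: \<omega>_def intro!: tensors_over_add tensors_over_sum tensors_over_smul tensors_over_mult)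

lemma b_T: "b l \<in> T"
  by (auto simp: b_def)

lemma dif_T: "t \<in> T \<Longrightarrow> dif t \<in> T"
  by (rule der_in_tensors_over) (auto intro: \<omega>_T)

lemma N_T: "t \<in> T \<Longrightarrow> N t \<in> T"
  by (rule der_in_tensors_over) (auto intro: \<zeta>_T)

lemma N_J: "t \<in> J \<Longrightarrow> N t \<in> J"
  using smul_a_\<zeta>_vec by (rule der_even_in_J)

lemma dif_mult: "dif (s * t) = dif s * t + twist (\<lambda>_. - 1) s * dif t"
  by (rule der_mult)

lemma sum_\<beta>_a_left:
  assumes "l \<in> I"
  shows "(\<Sum>k\<in>I. \<beta> k l * a k) = 0"
proof -
  have "\<beta> k l * a k = - psign (zp * par l) * (\<beta> l k * a k)" if "k \<in> I" for k
    using \<beta>_skew[OF that assms] a_par[OF that] by (cases "a k = 0") auto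
  then have "(\<Sum>k\<in>I. \<beta> k l * a k) = - psign (zp * par l) * (\<Sum>k\<in>I. \<beta> l k * a k)"
    by (simp add: sum_distrib_left)
  then show ?thesis using \<beta>_center[OF assms] by simp
qed

lemma \<eta>_a: "l \<in> I \<Longrightarrow> \<eta> l * a l = a l"
  unfolding \<eta>_def using a_par[of l] by (cases "a l = 0"; cases zp) (auto simp: psign_def)

lemma \<eta>_\<beta>: "\<lbrakk>k \<in> I; l \<in> I\<rbrakk> \<Longrightarrow> \<eta> l * \<beta> k l = psign (par k * par l) * \<beta> k l"
  unfolding \<eta>_def using \<beta>_par[of k l]
  by (cases "\<beta> k l = 0"; cases "par k"; cases "par l") (auto simp: psign_def)

lemma sum_a_b: "(\<Sum>l\<in>I. smul (a l) (b l)) = 0"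
proof -
  have "(\<Sum>l\<in>I. smul (a l) (b l)) = (\<Sum>l\<in>I. \<Sum>k\<in>I. smul (\<beta> k l * a l) (letter k))"
    unfolding b_def tensor_space.scale_sum_right
  proof (intro sum.cong refl)
    fix l k assume "l \<in> I"
    then have "a l * (\<eta> l * \<beta> k l) = \<beta> k l * a l"
      by (metis \<eta>_a mult.assoc mult.commute)
    then show "smul (a l) (smul (\<eta> l * \<beta> k l) (letter k)) = smul (\<beta> k l * a l) (letter k)"
      by simp
  qed
  also have "\<dots> = (\<Sum>k\<in>I. smul (\<Sum>l\<in>I. \<beta> k l * a l) (letter k))"
    unfolding tensor_space.scale_sum_left by (rule sum.swap)
  also have "\<dots> = 0" using \<beta>_center by simp
  finally show ?thesis .
qed

text \<open>
  The forms \<open>b l\<close> vanish on \<open>z\<close>, hence are killed by operators that see a form only through its value on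
  \<open>z\<close>, such as \<open>dif\<close> and \<open>N\<close>.
\<close>

lemma linear_on_b:
  assumes "\<And>k. k \<in> I \<Longrightarrow> lin_ext F (letter k) = smul (a k) u" "l \<in> I"
  shows "lin_ext F (b l) = 0"
proof -
  have "lin_ext F (b l) = (\<Sum>k\<in>I. smul (\<eta> l * (\<beta> k l * a k)) u)"
    by (simp add: b_def lin_ext_sum assms(1) mult.assoc)
  also have "\<dots> = smul (\<eta> l * (\<Sum>k\<in>I. \<beta> k l * a k)) u"
    by (simp add: tensor_space.scale_sum_left sum_distrib_left)
  finally show ?thesis using sum_\<beta>_a_left[OF assms(2)] by simp
qed

text \<open>
  As \<open>\<beta>\<close> is homogeneous of parity \<open>zp\<close>, so is \<open>\<omega>\<close>.
\<close>

lemma twist_\<omega>: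
  assumes "\<And>k l. \<lbrakk>k \<in> I; l \<in> I; par k + par l = zp\<rbrakk> \<Longrightarrow> \<chi> k * \<chi> l = c"
  shows "twist \<chi> \<omega> = smul c \<omega>"
proof -
  have "\<beta> k l * (\<chi> k * \<chi> l) = c * \<beta> k l" if "k \<in> I" "l \<in> I" for k l
    using assms[OF that] \<beta>_par[OF that] by (cases "\<beta> k l = 0") auto
  then have *: "twist \<chi> (smul (e * \<beta> k l) (letter k * letter l)) = smul c (smul (e * \<beta> k l) (letter k * letter l))"
    if "k \<in> I" "l \<in> I" for k l e
    using that by (simp add: mult_ac)
  let ?g = "\<lambda>(k, l). smul (psign (par k * par l + 1) * \<beta> k l) (letter k * letter l)"
  let ?h = "\<lambda>k. smul (1 / 2 * \<beta> k k) (letter k * letter k)"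
  let ?P = "{(k, l). k \<in> I \<and> l \<in> I \<and> k < l}"
  have "twist \<chi> (?g kl) = smul c (?g kl)" if "kl \<in> ?P" for kl
    using that by (cases kl) (simp only: mem_Collect_eq prod.case *)
  then have "twist \<chi> (sum ?g ?P) = smul c (sum ?g ?P)"
    unfolding lin_ext_sum tensor_space.scale_sum_right by (rule sum.cong[OF refl])
  moreover have "twist \<chi> (sum ?h I) = smul c (sum ?h I)"
    unfolding lin_ext_sum tensor_space.scale_sum_right by (rule sum.cong[OF refl], rule *)
  ultimately show ?thesis
    unfolding \<omega>_def lin_ext_add tensor_space.scale_right_distrib by (rule arg_cong2)
qed

lemma \<omega>_right:
  assumes "t \<in> T"
  shows "t * \<omega> \<approx> \<omega> * twist (\<lambda>i. psign (par i * zp)) t"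
  using assms
proof (induction t rule: tensors_over_induct)
  case (letter i t)
  let ?t = "twist (\<lambda>i. psign (par i * zp)) t"
  have \<tau>: "twist (\<lambda>k. - psign (par k * par i)) \<omega> = smul (psign (par i * zp)) \<omega>"
    by (rule twist_\<omega>) (auto simp: psign_add distrib_left mult.commute)
  have "letter i * t * \<omega> \<approx> letter i * (\<omega> * ?t)"
    unfolding mult.assoc using letter by (intro eqv_mult_left) auto
  also have "\<omega> * letter i \<approx> smul (psign (par i * zp)) (letter i * \<omega>)"
    using super_commute[OF \<omega>_T letter_in_vectors_over[OF letter(1) refl], unfolded \<tau>] by simp
  from eqv_smul[OF this, of "psign (par i * zp)"]
  have "letter i * \<omega> \<approx> smul (psign (par i * zp)) (\<omega> * letter i)"
    by (auto intro: eqv_sym)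
  from eqv_mult_right[OF this, of ?t]
  have "letter i * (\<omega> * ?t) \<approx> \<omega> * twist (\<lambda>i. psign (par i * zp)) (letter i * t)"
    using letter by (simp add: mult.assoc twist_in_tensors_over)
  finally show ?case .
qed (simp_all add: distrib_left distrib_right eqv_add eqv_smul)

text \<open>
  This replaces the sum over \<open>k < l\<close> by one over all pairs, in which the radical of \<open>\<beta>\<close> becomes
  visible on either side: each \<open>b l\<close> vanishes on \<open>z\<close>, and \<open>\<Sum> a l * b l = 0\<close>.
\<close>

lemma \<omega>_eqv: "\<omega> \<approx> smul (- 1 / 2) (\<Sum>l\<in>I. b l * letter l)"
proof -
  let ?g = "\<lambda>k l. smul (psign (par k * par l) * \<beta> k l) (letter k * letter l)"
  let ?P = "{(k, l). k \<in> I \<and> l \<in> I \<and> k < l}"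
  let ?Q = "{(k, l). k \<in> I \<and> l \<in> I \<and> l < k}"
  have finP: "finite ?P" and finQ: "finite ?Q"
    by (rule finite_subset[of _ "I \<times> I"]; use fin in auto)+
  have "(\<Sum>l\<in>I. b l * letter l) = (\<Sum>l\<in>I. \<Sum>k\<in>I. ?g k l)"
    unfolding b_def sum_distrib_right by (intro sum.cong refl) (simp add: \<eta>_\<beta>)
  also have "\<dots> = (\<Sum>k\<in>I. \<Sum>l\<in>I. ?g k l)" by (rule sum.swap)
  also have "\<dots> = (\<Sum>(k, l)\<in>I \<times> I. ?g k l)" by (rule sum.cartesian_product)
  also have "I \<times> I = ?P \<union> ?Q \<union> (\<lambda>k. (k, k)) ` I"
  proof (intro set_eqI, clarify)
    fix k l show "(k, l) \<in> I \<times> I \<longleftrightarrow> (k, l) \<in> ?P \<union> ?Q \<union> (\<lambda>k. (k, k)) ` I"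
      by (cases k l rule: linorder_cases) auto
  qed
  also have "(\<Sum>(k, l)\<in>?P \<union> ?Q \<union> (\<lambda>k. (k, k)) ` I. ?g k l) =
      (\<Sum>(k, l)\<in>?P \<union> ?Q. ?g k l) + (\<Sum>(k, l)\<in>(\<lambda>k. (k, k)) ` I. ?g k l)"
    by (rule sum.union_disjoint) (use finP finQ fin in auto)
  also have "(\<Sum>(k, l)\<in>?P \<union> ?Q. ?g k l) = (\<Sum>(k, l)\<in>?P. ?g k l) + (\<Sum>(k, l)\<in>?Q. ?g k l)"
    by (rule sum.union_disjoint) (use finP finQ in auto)
  also have "(\<Sum>(k, l)\<in>?Q. ?g k l) = (\<Sum>(k, l)\<in>?P. ?g l k)"
    by (rule sum.reindex_bij_witness[of _ prod.swap prod.swap]) auto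
  also have "(\<Sum>(k, l)\<in>(\<lambda>k. (k, k)) ` I. ?g k l) = (\<Sum>k\<in>I. ?g k k)"
    by (subst sum.reindex) (auto intro!: inj_onI)
  finally have eq: "(\<Sum>l\<in>I. b l * letter l) = (\<Sum>(k, l)\<in>?P. ?g k l) + (\<Sum>(k, l)\<in>?P. ?g l k) + (\<Sum>k\<in>I. ?g k k)" .
  have swap: "?g l k \<approx> ?g k l" if "k \<in> I" "l \<in> I" for k l
  proof -
    have "letter l * letter k \<approx> smul (- psign (par l * par k)) (letter k * letter l)"
      using super_commute[OF letter_in_tensors_over[OF that(2)] letter_in_vectors_over[OF that(1) refl]] by simp
    from eqv_smul[OF this, of "psign (par l * par k) * \<beta> l k"]
    show ?thesis using \<beta>_skew[OF that] by (simp add: mult_ac)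
  qed
  have "(\<Sum>(k, l)\<in>?P. ?g l k) \<approx> (\<Sum>(k, l)\<in>?P. ?g k l)"
    by (rule eqv_sum) (use swap in auto)
  then have "(\<Sum>l\<in>I. b l * letter l) \<approx> (\<Sum>(k, l)\<in>?P. ?g k l) + (\<Sum>(k, l)\<in>?P. ?g k l) + (\<Sum>k\<in>I. ?g k k)"
    unfolding eq by (intro eqv_add) auto
  have half: "smul (- 1 / 2) (X + X + Y) = smul (- 1) X + smul (- 1 / 2) Y" for X Y :: "'i word \<Rightarrow>\<^sub>0 'f"
    by (rule poly_mapping_eqI) (simp add: lookup_add lookup_minus field_simps)
  from eqv_smul[OF \<open>(\<Sum>l\<in>I. b l * letter l) \<approx> _\<close>, of "- 1 / 2"]
  have *: "smul (- 1 / 2) (\<Sum>l\<in>I. b l * letter l) \<approx>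
     smul (- 1) (\<Sum>(k, l)\<in>?P. ?g k l) + smul (- 1 / 2) (\<Sum>k\<in>I. ?g k k)"
    unfolding half .
  have diag: "psign (par k) * \<beta> k k = - \<beta> k k" if "k \<in> I" for k
  proof -
    have "\<beta> k k + psign (par k * par k) * \<beta> k k = 0"
      using \<beta>_skew[OF that that] unfolding mult_minus_left eq_neg_iff_add_eq_0 .
    then show ?thesis by (simp add: eq_neg_iff_add_eq_0 add.commute)
  qed
  have "smul (- 1) (\<Sum>(k, l)\<in>?P. ?g k l) =
      (\<Sum>(k, l)\<in>?P. smul (psign (par k * par l + 1) * \<beta> k l) (letter k * letter l))"
    unfolding tensor_space.scale_sum_right
    by (intro sum.cong refl) (auto simp: psign_add psign_eq_if[of 1])
  moreover have "smul (- 1 / 2) (\<Sum>k\<in>I. ?g k k) = (\<Sum>k\<in>I. smul (1 / 2 * \<beta> k k) (letter k * letter k))"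
    unfolding tensor_space.scale_sum_right
    by (intro sum.cong refl) (simp add: diag)
  ultimately have eq: "smul (- 1) (\<Sum>(k, l)\<in>?P. ?g k l) + smul (- 1 / 2) (\<Sum>k\<in>I. ?g k k) = \<omega>"
    by (simp only: \<omega>_def)
  show ?thesis using * unfolding eq by (rule eqv_sym)
qed

lemma sum_b_a: "(\<Sum>l\<in>I. b l * smul (a l) u) = 0"
proof -
  have "(\<Sum>l\<in>I. b l * smul (a l) u) = (\<Sum>l\<in>I. smul (a l) (b l)) * u"
    unfolding sum_distrib_right by (intro sum.cong refl) simp
  then show ?thesis by (simp only: sum_a_b mult_zero_left)
qed

lemma N_\<omega>: "N \<omega> \<in> J"
proof -
  have Nb: "N (b l) = 0" if "l \<in> I" for l by (rule linear_on_b[OF _ that, of _ \<zeta>]) (rule der_letter)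
  have "N (\<omega> - smul (- 1 / 2) (\<Sum>l\<in>I. b l * letter l)) \<in> J"
    using \<omega>_eqv unfolding eqv_def by (rule N_J)
  moreover have "N (\<Sum>l\<in>I. b l * letter l) = 0"
    using sum_b_a[of \<zeta>] by (simp add: lin_ext_sum der_mult twist_trivial Nb)
  ultimately show ?thesis by simp
qed

lemma dif_vec: "x \<in> vec p \<Longrightarrow> \<exists>c. dif x = smul c \<omega> \<and> (c \<noteq> 0 \<longrightarrow> p = zp)"
proof (induction x rule: vectors_over_induct)
  case zero
  show ?case by (rule exI[of _ 0]) simp
next
  case (add s t)
  from add(1) obtain c where "dif s = smul c \<omega>" "c \<noteq> 0 \<longrightarrow> p = zp" by (elim exE conjE)
  moreover from add(2) obtain c' where "dif t = smul c' \<omega>" "c' \<noteq> 0 \<longrightarrow> p = zp" by (elim exE conjE)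
  ultimately show ?case
    by (intro exI[of _ "c + c'"]) (simp add: tensor_space.scale_left_distrib, cases "c = 0", auto)
next
  case (letter c i)
  then show ?case using a_par[of i] by (intro exI[of _ "c * a i"]) auto
qed

lemma twist_minus_vec: "x \<in> vec p \<Longrightarrow> twist (\<lambda>_. - 1) x = - x"
  by (induction x rule: vectors_over_induct) auto

lemma \<omega>_vec_commute:
  assumes "y \<in> vec q"
  shows "\<omega> * y \<approx> smul (psign (zp * q)) (y * \<omega>)"
proof -
  have \<tau>: "twist (\<lambda>k. - psign (par k * q)) \<omega> = smul (psign (zp * q)) \<omega>"
    by (rule twist_\<omega>) (auto simp: psign_add distrib_right)
  show ?thesis using super_commute[OF \<omega>_T assms, unfolded \<tau>] by simp
qed

text \<open>
  For generators, the two terms with \<open>d x\<close> and the two with \<open>d y\<close> cancel because \<open>\<omega>\<close> supercommutes with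
  vectors and \<open>d x\<close> is a multiple of \<open>\<omega>\<close>, which is nonzero only if \<open>x\<close> has the parity of \<open>\<omega>\<close>.
\<close>

lemma dif_J: "t \<in> J \<Longrightarrow> dif t \<in> J"
proof (induction rule: ext_ideal.induct)
  case (generator x p y q)
  let ?e = "psign (p * q) :: 'f"
  from dif_vec[OF generator(1)] obtain c
    where c: "dif x = smul c \<omega>" "c \<noteq> 0 \<longrightarrow> p = zp" by (elim exE conjE)
  from dif_vec[OF generator(2)] obtain c'
    where c': "dif y = smul c' \<omega>" "c' \<noteq> 0 \<longrightarrow> q = zp" by (elim exE conjE)
  have "smul c (\<omega> * y) \<approx> smul c (smul ?e (y * \<omega>))"
    using eqv_smul[OF \<omega>_vec_commute[OF generator(2)], of c] c(2) by (cases "c = 0") auto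
  moreover have "smul (c' * ?e) (\<omega> * x) \<approx> smul (c' * ?e) (smul ?e (x * \<omega>))"
    using eqv_smul[OF \<omega>_vec_commute[OF generator(1)], of "c' * ?e"] c'(2)
    by (cases "c' = 0") (auto simp: mult_ac)
  ultimately have "smul c (\<omega> * y) + smul (c' * ?e) (\<omega> * x) \<approx>
      smul c (smul ?e (y * \<omega>)) + smul (c' * ?e) (smul ?e (x * \<omega>))" by (rule eqv_add)
  moreover have "dif (x * y + smul ?e (y * x)) =
      smul c (\<omega> * y) + smul (c' * ?e) (\<omega> * x) - (smul c (smul ?e (y * \<omega>)) + smul (c' * ?e) (smul ?e (x * \<omega>)))"
    using generator
    by (simp add: dif_mult c(1) c'(1) twist_minus_vec tensor_space.scale_right_distrib tensor_space.scale_right_diff_distrib mult_ac)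
  ultimately show ?case by (simp add: eqv_def smul_def)
next
  case (mult_left s t)
  then show ?case
    unfolding dif_mult
    by (intro ext_ideal.add ext_ideal.mult_left dif_T twist_in_tensors_over)
next
  case (mult_right s t)
  then show ?case
    unfolding dif_mult
    by (intro ext_ideal.add ext_ideal.mult_right dif_T twist_in_J)
qed (simp_all add: ext_ideal.zero ext_ideal.add)

lemma dif_b: "l \<in> I \<Longrightarrow> dif (b l) = 0"
  by (rule linear_on_b[of _ \<omega>]) (rule der_letter)

lemma b_minus: "twist (\<lambda>_. - 1) (b l) = - b l"
  by (simp add: b_def lin_ext_sum sum_negf)

lemma dif_\<omega>: "dif \<omega> \<in> J"
proof -
  have "dif (\<omega> - smul (- 1 / 2) (\<Sum>l\<in>I. b l * letter l)) \<in> J"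
    using \<omega>_eqv unfolding eqv_def by (rule dif_J)
  moreover have "dif (\<Sum>l\<in>I. b l * letter l) = - (\<Sum>l\<in>I. b l * smul (a l) \<omega>)"
    by (simp add: lin_ext_sum dif_mult dif_b b_minus sum_negf)
  moreover have "(\<Sum>l\<in>I. b l * smul (a l) \<omega>) = 0" by (rule sum_b_a)
  ultimately show ?thesis by simp
qed

lemma dif_dif: "t \<in> T \<Longrightarrow> dif (dif t) \<in> J"
proof (induction t rule: tensors_over_induct)
  case (letter i t)
  have "twist (\<lambda>_. - 1) \<omega> = smul 1 \<omega>" by (rule twist_\<omega>) simp
  then have "dif (dif (letter i * t)) = smul (a i) (dif \<omega> * t) + letter i * dif (dif t)"
    by (simp add: dif_mult[of \<omega>] tensor_space.scale_right_distrib)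
  moreover have "smul (a i) (dif \<omega> * t) \<in> J"
    using letter dif_\<omega> by (intro J_smul ext_ideal.mult_right)
  moreover have "letter i * dif (dif t) \<in> J"
    using letter by (intro ext_ideal.mult_left) auto
  ultimately show ?case using ext_ideal.add by metis
qed (simp_all add: ext_ideal.zero ext_ideal.add J_smul)

end

section \<open>Products of closed forms without constant term\<close>

context heisenberg_constants
begin

lemma dif_\<zeta> [simp]: "dif \<zeta> = \<omega>"
  using j by (simp add: \<zeta>_def)

lemma N_\<zeta> [simp]: "N \<zeta> = \<zeta>"
  using j by (simp add: \<zeta>_def)

lemma dif_v [simp]: "dif (v i) = 0"
  by (simp add: v_def)

lemma N_v [simp]: "N (v i) = 0"
  by (simp add: v_def)

lemma dif_v_mult: "i \<in> I \<Longrightarrow> dif (v i * t) = - (v i * dif t)"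
  using twist_minus_vec[OF v_vec] by (simp add: dif_mult)

lemma N_v_mult: "N (v i * t) = v i * N t"
  by (simp add: der_mult twist_trivial)

lemma N_\<zeta>_mult: "N (\<zeta> * t) = \<zeta> * t + \<zeta> * N t"
  by (simp add: der_mult twist_trivial)

lemma letter_eq: "letter i = v i + smul (a i) \<zeta>"
  by (simp add: v_def)

text \<open>
  The subalgebra generated by the forms that vanish on \<open>z\<close>: the part of degree zero in \<open>\<zeta>\<close>.
\<close>

inductive_set A0 :: "('i word \<Rightarrow>\<^sub>0 'f) set" where
  one: "1 \<in> A0"
| add: "\<lbrakk>s \<in> A0; t \<in> A0\<rbrakk> \<Longrightarrow> s + t \<in> A0"
| smul: "t \<in> A0 \<Longrightarrow> smul c t \<in> A0"
| v_mult: "\<lbrakk>i \<in> I; t \<in> A0\<rbrakk> \<Longrightarrow> v i * t \<in> A0"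

lemma A0_zero: "0 \<in> A0"
  using A0.smul[OF A0.one, of 0] by simp

lemma A0_props: "t \<in> A0 \<Longrightarrow> t \<in> T \<and> dif t = 0 \<and> N t = 0"
  by (induction rule: A0.induct) (auto simp: dif_v_mult N_v_mult v_T)

lemma sum_v_single: "i \<in> I \<Longrightarrow> (\<Sum>m\<in>I. v m * (if m = i then t else 0)) = v i * t"
  by (subst sum.cong[OF refl, of I _ "\<lambda>m. if m = i then v i * t else 0"]) (use fin in auto)

lemma A0_decompose:
  "t \<in> A0 \<Longrightarrow> \<exists>c h. (\<forall>m\<in>I. h m \<in> A0) \<and> t = smul c 1 + (\<Sum>m\<in>I. v m * h m)"
proof (induction rule: A0.induct)
  case one
  show ?case by (rule exI[of _ 1], rule exI[of _ "\<lambda>_. 0"]) (simp add: A0_zero)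
next
  case (add s t)
  from add.IH(1) obtain c h where s: "\<forall>m\<in>I. h m \<in> A0" "s = smul c 1 + (\<Sum>m\<in>I. v m * h m)"
    by (elim exE conjE)
  from add.IH(2) obtain c' h' where t: "\<forall>m\<in>I. h' m \<in> A0" "t = smul c' 1 + (\<Sum>m\<in>I. v m * h' m)"
    by (elim exE conjE)
  show ?case
    by (rule exI[of _ "c + c'"], rule exI[of _ "\<lambda>m. h m + h' m"])
      (simp add: s t A0.add tensor_space.scale_left_distrib distrib_left sum.distrib)
next
  case (smul t d)
  then obtain c h where t: "\<forall>m\<in>I. h m \<in> A0" "t = smul c 1 + (\<Sum>m\<in>I. v m * h m)"
    by (elim exE conjE)
  show ?case
    by (rule exI[of _ "d * c"], rule exI[of _ "\<lambda>m. smul d (h m)"])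
      (simp add: t A0.smul tensor_space.scale_right_distrib tensor_space.scale_sum_right)
next
  case (v_mult i t)
  show ?case
    by (rule exI[of _ 0], rule exI[of _ "\<lambda>m. if m = i then t else 0"])
      (simp add: v_mult sum_v_single A0_zero)
qed

lemma sum_atMost_extend:
  fixes s :: "nat \<Rightarrow> 'i word \<Rightarrow>\<^sub>0 'f"
  assumes "\<forall>k>n. s k = 0" "n \<le> n'"
  shows "(\<Sum>k\<le>n'. s k) = (\<Sum>k\<le>n. s k)"
  by (rule sum.mono_neutral_right) (use assms in auto)

text \<open>
  Substituting \<open>x_i = v_i + a_i \<zeta>\<close> splits a tensor into its parts \<open>s k\<close> of degree \<open>k\<close> in \<open>\<zeta>\<close>, which are
  eigenvectors of \<open>N\<close>.
\<close>

lemma \<zeta>_degree_decompose: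
  assumes "t \<in> T"
  shows "\<exists>n s. s 0 \<in> A0 \<and> (\<forall>k. s k \<in> T \<and> N (s k) = smul (of_nat k) (s k)) \<and>
    (\<forall>k>n. s k = 0) \<and> t = (\<Sum>k\<le>n. s k)"
  using assms
proof (induction t rule: tensors_over_induct)
  case (add t t')
  from add.IH(1) obtain n s where s: "s 0 \<in> A0" "\<forall>k. s k \<in> T \<and> N (s k) = smul (of_nat k) (s k)"
    "\<forall>k>n. s k = 0" "t = (\<Sum>k\<le>n. s k)" by (elim exE conjE)
  from add.IH(2) obtain n' s' where s': "s' 0 \<in> A0" "\<forall>k. s' k \<in> T \<and> N (s' k) = smul (of_nat k) (s' k)"
    "\<forall>k>n'. s' k = 0" "t' = (\<Sum>k\<le>n'. s' k)" by (elim exE conjE)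
  show ?case
    using sum_atMost_extend[OF s(3), of "max n n'"] sum_atMost_extend[OF s'(3), of "max n n'"]
    by (intro exI[of _ "max n n'"] exI[of _ "\<lambda>k. s k + s' k"])
      (use s s' in \<open>auto simp: A0.add sum.distrib tensor_space.scale_right_distrib\<close>)
next
  case (smul c t)
  from smul.IH obtain n s where s: "s 0 \<in> A0" "\<forall>k. s k \<in> T \<and> N (s k) = smul (of_nat k) (s k)"
    "\<forall>k>n. s k = 0" "t = (\<Sum>k\<le>n. s k)" by (elim exE conjE)
  show ?case
    by (rule exI[of _ n], rule exI[of _ "\<lambda>k. smul c (s k)"])
      (use s in \<open>auto simp: A0.smul tensor_space.scale_sum_right mult.commute\<close>)
next
  case one
  show ?case
    by (rule exI[of _ 0], rule exI[of _ "\<lambda>k. if k = 0 then 1 else 0"]) (auto simp: A0.one)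
next
  case (letter i t)
  from letter.IH obtain n s where s: "s 0 \<in> A0" "\<forall>k. s k \<in> T \<and> N (s k) = smul (of_nat k) (s k)"
    "\<forall>k>n. s k = 0" "t = (\<Sum>k\<le>n. s k)" by (elim exE conjE)
  let ?s = "\<lambda>k. v i * s k + (case k of 0 \<Rightarrow> 0 | Suc k \<Rightarrow> smul (a i) (\<zeta> * s k))"
  have eig: "N (?s k) = smul (of_nat k) (?s k)" for k
  proof (cases k)
    case (Suc k')
    have "N (\<zeta> * s k') = smul (of_nat k) (\<zeta> * s k')"
      using s(2) by (simp add: Suc N_\<zeta>_mult tensor_space.scale_left_distrib)
    then show ?thesis using s(2)
      by (simp add: Suc N_v_mult tensor_space.scale_right_distrib tensor_space.scale_left_distrib
          distrib_left mult.commute)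
  qed (use s(2) in \<open>simp add: N_v_mult\<close>)
  have "letter i * t = (\<Sum>k\<le>n. v i * s k) + (\<Sum>k\<le>n. smul (a i) (\<zeta> * s k))"
    unfolding s(4) by (simp add: letter_eq distrib_right sum_distrib_left sum.distrib)
  also have "(\<Sum>k\<le>n. v i * s k) = (\<Sum>k\<le>Suc n. v i * s k)"
    using s(3) by simp
  also have "(\<Sum>k\<le>n. smul (a i) (\<zeta> * s k)) = (\<Sum>k\<le>Suc n. case k of 0 \<Rightarrow> 0 | Suc k \<Rightarrow> smul (a i) (\<zeta> * s k))"
    by (subst sum.atMost_Suc_shift) simp
  finally have "letter i * t = (\<Sum>k\<le>Suc n. ?s k)"
    by (simp only: sum.distrib)
  moreover have "?s k \<in> T" for k
    using s(2) letter(1) v_T \<zeta>_T by (cases k) auto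
  moreover have "?s 0 \<in> A0" using s(1) letter(1) by (simp add: A0.v_mult)
  moreover have "\<forall>k>Suc n. ?s k = 0" using s(3) by (auto split: nat.split)
  ultimately show ?case using eig by (intro exI[of _ "Suc n"] exI[of _ ?s]) blast
qed

lemma \<zeta>_vec_commute: "y \<in> vec q \<Longrightarrow> \<zeta> * y \<approx> smul (- psign (zp * q)) (y * \<zeta>)"
  using super_commute[OF \<zeta>_T, of y q] by (simp add: \<zeta>_def par_j mult.commute)

lemma \<zeta>_\<omega>_commute: "\<zeta> * \<omega> \<approx> smul (psign zp) (\<omega> * \<zeta>)"
  using \<omega>_right[OF \<zeta>_T] by (simp add: \<zeta>_def par_j mult.commute)

text \<open>
  The differential replaces one factor \<open>\<zeta>\<close> after the other by \<open>\<omega>\<close>. Multiplication by \<open>\<zeta>\<close> on the left and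
  moving \<open>\<omega>\<close> to the front turns each of these terms into the same multiple of \<open>\<omega> t\<close>. For even \<open>z\<close>, where
  \<open>\<zeta>\<close> squares to zero, this holds as well.
\<close>

lemma \<zeta>_dif: "t \<in> T \<Longrightarrow> \<zeta> * dif t \<approx> smul (psign zp) (\<omega> * N t)"
proof (induction t rule: tensors_over_induct)
  case (add s t)
  then show ?case by (simp add: distrib_left tensor_space.scale_right_distrib eqv_add)
next
  case (smul c t)
  from eqv_smul[OF smul.IH, of c] show ?case by (simp add: mult.commute)
next
  case (letter i t)
  let ?e = "psign (par i * zp)"
  have "smul (a i) (\<zeta> * \<omega> * t) \<approx> smul (a i) (smul (psign zp) (\<omega> * \<zeta>) * t)"
    using letter by (intro eqv_smul eqv_mult_right \<zeta>_\<omega>_commute)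
  moreover have "\<zeta> * letter i * dif t \<approx> smul (- ?e) (letter i * \<zeta>) * dif t"
    using letter \<zeta>_vec_commute[of "letter i" "par i"]
    by (intro eqv_mult_right dif_T) (auto simp: mult.commute[of _ zp])
  then have "- (\<zeta> * letter i * dif t) \<approx> smul ?e (letter i * (\<zeta> * dif t))"
    using eqv_uminus by (fastforce simp: mult.assoc)
  moreover have "smul ?e (letter i * (\<zeta> * dif t)) \<approx> smul ?e (letter i * (smul (psign zp) (\<omega> * N t)))"
    using letter by (intro eqv_smul eqv_mult_left) auto
  moreover have "smul (?e * psign zp) (letter i * \<omega> * N t) \<approx> smul (?e * psign zp) (smul ?e (\<omega> * letter i) * N t)"
    using \<omega>_right[of "letter i"] letter by (intro eqv_smul eqv_mult_right N_T) auto
  ultimately have "smul (a i) (\<zeta> * \<omega> * t) + - (\<zeta> * letter i * dif t) \<approx>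
      smul (a i) (smul (psign zp) (\<omega> * \<zeta>) * t) + smul (?e * psign zp) (smul ?e (\<omega> * letter i) * N t)"
    by (intro eqv_add) (auto intro: eqv_trans simp: mult.assoc)
  then show ?case
    by (simp add: distrib_left right_diff_distrib tensor_space.scale_right_distrib mult.assoc mult.left_commute[of _ "psign zp"] mult.commute[of "a i"])
qed simp

lemma dif_left_\<omega>: "t \<in> T \<Longrightarrow> \<exists>t'\<in>T. dif t \<approx> \<omega> * t'"
proof (induction t rule: tensors_over_induct)
  case (add s t)
  then obtain s' t' where "s' \<in> T" "t' \<in> T" "dif s \<approx> \<omega> * s'" "dif t \<approx> \<omega> * t'" by (elim bexE)
  then show ?case by (intro bexI[of _ "s' + t'"]) (auto simp: distrib_left eqv_add)
next
  case (smul c t)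
  then obtain t' where "t' \<in> T" "dif t \<approx> \<omega> * t'" by (elim bexE)
  then show ?case by (intro bexI[of _ "smul c t'"]) (auto simp: eqv_smul)
next
  case one
  show ?case by (intro bexI[of _ 0]) auto
next
  case (letter i t)
  then obtain t' where t': "t' \<in> T" "dif t \<approx> \<omega> * t'" by (elim bexE)
  let ?e = "psign (par i * zp)"
  have "letter i * dif t \<approx> letter i * (\<omega> * t')" using t' letter by (intro eqv_mult_left) auto
  also have "letter i * \<omega> * t' \<approx> smul ?e (\<omega> * letter i) * t'"
    using \<omega>_right[of "letter i"] letter t' by (intro eqv_mult_right) auto
  then have "letter i * (\<omega> * t') \<approx> smul ?e (\<omega> * (letter i * t'))" by (simp add: mult.assoc)
  finally have "dif (letter i * t) \<approx> smul (a i) (\<omega> * t) - smul ?e (\<omega> * (letter i * t'))"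
    by (simp add: eqv_diff)
  also have "\<dots> = \<omega> * (smul (a i) t - smul ?e (letter i * t'))"
    by (simp add: right_diff_distrib)
  finally show ?case using t' letter
    by (intro bexI[of _ "smul (a i) t - smul ?e (letter i * t')"]) auto
qed

text \<open>
  The tensors that lie, modulo the ideal of relations, in the right ideal generated by the \<open>v m\<close>.
\<close>

definition aug :: "('i word \<Rightarrow>\<^sub>0 'f) set"
  where "aug = {t \<in> T. \<exists>r. (\<forall>m\<in>I. r m \<in> T) \<and> t \<approx> (\<Sum>m\<in>I. v m * r m)}"

text \<open>
  Those \<open>t\<close> for which \<open>z \<otimes> t\<close> will turn out to be a coboundary.
\<close>

definition v_exact :: "('i word \<Rightarrow>\<^sub>0 'f) set"
  where "v_exact = {t. \<exists>r. (\<forall>m\<in>I. r m \<in> T \<and> dif (r m) \<in> J) \<and> t \<approx> (\<Sum>m\<in>I. v m * r m)}"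

lemma v_exactI: "\<lbrakk>\<And>m. m \<in> I \<Longrightarrow> r m \<in> T \<and> dif (r m) \<in> J; t \<approx> (\<Sum>m\<in>I. v m * r m)\<rbrakk> \<Longrightarrow> t \<in> v_exact"
  unfolding v_exact_def by blast

lemma v_exact_add: "\<lbrakk>s \<in> v_exact; t \<in> v_exact\<rbrakk> \<Longrightarrow> s + t \<in> v_exact"
proof -
  assume "s \<in> v_exact" "t \<in> v_exact"
  then obtain r r' where r: "\<forall>m\<in>I. r m \<in> T \<and> dif (r m) \<in> J" "s \<approx> (\<Sum>m\<in>I. v m * r m)"
    and r': "\<forall>m\<in>I. r' m \<in> T \<and> dif (r' m) \<in> J" "t \<approx> (\<Sum>m\<in>I. v m * r' m)"
    by (auto simp: v_exact_def)
  show ?thesis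
    by (rule v_exactI[of "\<lambda>m. r m + r' m"])
      (use r r' eqv_add[OF r(2) r'(2)] in \<open>auto simp: distrib_left sum.distrib intro: ext_ideal.add\<close>)
qed

lemma v_exact_smul: "t \<in> v_exact \<Longrightarrow> smul c t \<in> v_exact"
proof -
  assume "t \<in> v_exact"
  then obtain r where r: "\<forall>m\<in>I. r m \<in> T \<and> dif (r m) \<in> J" "t \<approx> (\<Sum>m\<in>I. v m * r m)"
    by (auto simp: v_exact_def)
  show ?thesis
    by (rule v_exactI[of "\<lambda>m. smul c (r m)"])
      (use r eqv_smul[OF r(2), of c] in \<open>auto simp: tensor_space.scale_sum_right J_smul\<close>)
qed

lemma v_exact_zero: "0 \<in> v_exact"
  by (rule v_exactI[of "\<lambda>_. 0"]) (auto simp: ext_ideal.zero)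

lemma v_exact_sum: "(\<And>x. x \<in> A \<Longrightarrow> f x \<in> v_exact) \<Longrightarrow> (\<Sum>x\<in>A. f x) \<in> v_exact"
  by (induction A rule: infinite_finite_induct) (auto simp: v_exact_zero v_exact_add)

lemma lookup_zero_v_sum: "Poly_Mapping.lookup (\<Sum>m\<in>I. v m * r m) 0 = 0"
  by (simp add: lookup_sum v_def \<zeta>_def left_diff_distrib lookup_minus)

text \<open>
  The heart of the proof. The part of \<open>V\<close> of degree zero in \<open>\<zeta>\<close> contributes a form \<open>v m\<close> that can be moved
  to the front, the remaining factors being closed. The part of positive degree is annihilated by \<open>\<omega>\<close>, so
  multiplication by it makes every element closed, in particular the cofactors \<open>r m\<close> of \<open>U\<close>.
\<close>

lemma closed_mult_v_exact:
  assumes U: "U \<in> aug" "dif U \<in> J" and V: "V \<in> aug" "dif V \<in> J"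
  shows "U * V \<in> v_exact"
proof -
  have UT: "U \<in> T" and VT: "V \<in> T" using U V by (auto simp: aug_def)
  from \<zeta>_degree_decompose[OF VT] obtain n s where s: "s 0 \<in> A0"
    "\<forall>k. s k \<in> T \<and> N (s k) = smul (of_nat k) (s k)" "\<forall>k>n. s k = 0" "V = (\<Sum>k\<le>n. s k)"
    by (elim exE conjE)
  let ?V = "\<Sum>k\<in>{1..n}. s k"
  have V_eq: "V = s 0 + ?V"
    unfolding s(4) by (simp add: atMost_atLeast0 sum.atLeast_Suc_atMost)
  have V'T: "?V \<in> T" using s(2) by auto
  have V0: "s 0 \<in> T" "dif (s 0) = 0" "N (s 0) = 0" using A0_props[OF s(1)] by auto
  have V'_closed: "dif ?V \<in> J" using V(2) V0(2) unfolding V_eq by simp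
  \<comment> \<open>The part of positive degree is closed, so \<open>\<zeta>_dif\<close> applies; the factor \<open>N\<close> is then removed degree by degree.\<close>
  have "\<omega> * N ?V \<in> J"
  proof -
    have "smul (psign zp) (\<omega> * N ?V) \<approx> \<zeta> * dif ?V"
      by (rule eqv_sym[OF \<zeta>_dif[OF V'T]])
    also have "\<zeta> * dif ?V \<in> J" using V'_closed \<zeta>_T by (intro ext_ideal.mult_left)
    finally (eqv_in_J) show ?thesis using J_smul[of "smul (psign zp) (\<omega> * N ?V)" "psign zp"] by simp
  qed
  moreover have "N ?V = (\<Sum>k\<le>n. smul (of_nat k) (s k))"
    using s(2) by (simp add: lin_ext_sum atMost_atLeast0 sum.atLeast_Suc_atMost)
  ultimately have sum_K: "(\<Sum>k\<le>n. smul (of_nat k) (s k)) \<in> {t \<in> T. \<omega> * t \<in> J}"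
    using s(2) by auto
  have K: "smul (of_nat k) (s k) \<in> {t \<in> T. \<omega> * t \<in> J}" if "k \<le> n" for k
  proof (rule eigen_components[OF _ _ _ _ sum_K that])
    fix t assume t: "t \<in> {t \<in> T. \<omega> * t \<in> J}"
    then have "N (\<omega> * t) - N \<omega> * t \<in> J" using N_J N_\<omega> by (intro J_diff ext_ideal.mult_right) auto
    then show "N t \<in> {t \<in> T. \<omega> * t \<in> J}"
      using t by (simp add: der_mult twist_trivial N_T)
  qed (use s(2) in \<open>auto simp: distrib_left ext_ideal.add J_smul\<close>)
  have \<omega>s: "\<omega> * s k \<in> J" if "k \<in> {1..n}" for k
    using K[of k] J_smul[of "smul (of_nat k) (\<omega> * s k)" "1 / of_nat k"] that by auto
  have \<omega>V: "\<omega> * ?V \<in> J"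
    unfolding sum_distrib_left using \<omega>s by (rule J_sum)
  from U(1) obtain r where r: "\<forall>m\<in>I. r m \<in> T" "U \<approx> (\<Sum>m\<in>I. v m * r m)"
    by (auto simp: aug_def)
  \<comment> \<open>Each \<open>dif (r m)\<close> has a left factor \<open>\<omega>\<close>, which can be moved next to \<open>?V\<close>.\<close>
  have UV': "U * ?V \<in> v_exact"
  proof (rule v_exactI[of "\<lambda>m. r m * ?V"])
    fix m assume m: "m \<in> I"
    with r dif_left_\<omega> obtain r' where r': "r' \<in> T" "dif (r m) \<approx> \<omega> * r'" by blast
    have "dif (r m) * ?V \<approx> \<omega> * r' * ?V" using r' V'T by (intro eqv_mult_right)
    moreover have "\<omega> * r' * ?V \<in> J"
    proof -
      let ?\<tau> = "twist (\<lambda>i. psign (par i * zp))"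
      have "?\<tau> r' * \<omega> \<approx> \<omega> * ?\<tau> (?\<tau> r')" using r' by (intro \<omega>_right twist_in_tensors_over)
      also have "?\<tau> (?\<tau> r') = r'"
        using r'(1) by (induction r' rule: tensors_over_induct) simp_all
      finally have "\<omega> * r' * ?V \<approx> ?\<tau> r' * \<omega> * ?V"
        using V'T by (rule eqv_mult_right[OF eqv_sym])
      moreover have "?\<tau> r' * \<omega> * ?V \<in> J"
        unfolding mult.assoc by (rule ext_ideal.mult_left[OF twist_in_tensors_over[OF r'(1)] \<omega>V])
      ultimately show ?thesis by (rule eqv_in_J)
    qed
    ultimately have "dif (r m) * ?V \<in> J" by (rule eqv_in_J)
    moreover have "twist (\<lambda>_. - 1) (r m) * dif ?V \<in> J"
      using r(1) m V'_closed by (intro ext_ideal.mult_left twist_in_tensors_over) auto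
    ultimately show "r m * ?V \<in> T \<and> dif (r m * ?V) \<in> J"
      using r(1) m V'T unfolding dif_mult by (intro conjI tensors_over_mult ext_ideal.add) auto
  next
    show "U * ?V \<approx> (\<Sum>m\<in>I. v m * (r m * ?V))"
      using eqv_mult_right[OF r(2) V'T] by (simp add: sum_distrib_right mult.assoc)
  qed
  from A0_decompose[OF s(1)] obtain c h where h: "\<forall>m\<in>I. h m \<in> A0" "s 0 = smul c 1 + (\<Sum>m\<in>I. v m * h m)"
    by (elim exE conjE)
  \<comment> \<open>A combination of the \<open>v m\<close> has no constant term, nor has an eigenvector of \<open>N\<close> of positive degree.\<close>
  have c: "c = 0"
  proof -
    from V(1) obtain q where q: "\<forall>m\<in>I. q m \<in> T" "V \<approx> (\<Sum>m\<in>I. v m * q m)"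
      by (auto simp: aug_def)
    have "Poly_Mapping.lookup V 0 = 0"
      using lookup_zero_of_J[OF q(2)[unfolded eqv_def]] lookup_zero_v_sum[of q]
      by (simp add: lookup_minus)
    moreover have "Poly_Mapping.lookup (s k) 0 = 0" if "k \<ge> 1" for k
    proof -
      have "Poly_Mapping.lookup (N t) 0 = 0" if "t \<in> T" for t using that
      proof (induction t rule: tensors_over_induct)
        case (letter i t)
        show ?case by (simp add: \<zeta>_def lookup_add)
      qed (simp_all add: lookup_add)
      from this[of "s k"] s(2) that show ?thesis by auto
    qed
    then have "Poly_Mapping.lookup ?V 0 = 0" by (simp add: lookup_sum)
    moreover have "Poly_Mapping.lookup (s 0) 0 = c"
      using lookup_zero_v_sum[of h] h(2) by (simp add: lookup_add)
    ultimately show ?thesis unfolding V_eq by (simp add: lookup_add)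
  qed
  have UV0: "U * s 0 \<in> v_exact"
  proof (rule v_exactI[of "\<lambda>m. twist (\<lambda>i. - psign (par i * par m)) U * h m"])
    fix m assume m: "m \<in> I"
    let ?\<tau> = "twist (\<lambda>i. - psign (par i * par m))"
    have h': "h m \<in> T" "dif (h m) = 0" using h m A0_props by auto
    have "dif (?\<tau> t) = - ?\<tau> (dif t)" if "t \<in> T" for t using that
    proof (induction t rule: tensors_over_induct)
      case (letter i t)
      have "?\<tau> \<omega> = smul (psign (zp * par m)) \<omega>"
        by (rule twist_\<omega>) (auto simp: psign_add distrib_right)
      then show ?case using letter a_par[of i]
        by (cases "a i = 0") (simp_all add: twist_mult tensor_space.scale_right_distrib tensor_space.scale_right_diff_distrib mult.commute)
    qed simp_all
    then have "dif (?\<tau> U) \<in> J" using UT U(2) by (simp add: J_uminus twist_in_J)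
    then show "?\<tau> U * h m \<in> T \<and> dif (?\<tau> U * h m) \<in> J"
      using h' UT by (auto simp: dif_mult twist_in_tensors_over intro: ext_ideal.mult_right)
  next
    have "U * v m * h m \<approx> v m * twist (\<lambda>i. - psign (par i * par m)) U * h m" if "m \<in> I" for m
      using that h A0_props UT by (intro eqv_mult_right super_commute v_vec) auto
    then show "U * s 0 \<approx> (\<Sum>m\<in>I. v m * (twist (\<lambda>i. - psign (par i * par m)) U * h m))"
      unfolding h(2) c by (auto simp: sum_distrib_left mult.assoc intro!: eqv_sum)
  qed
  show ?thesis unfolding V_eq distrib_left using UV0 UV' by (rule v_exact_add)
qed

end

section \<open>Components of adjoint cocycles have no pure powers of the central form\<close>

context heisenberg_constants
begin

primrec m_list :: "'i list \<Rightarrow> 'f" where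
  "m_list [] = 1"
| "m_list (i # is) = a i * m_list is"

primrec l_list :: "'i \<Rightarrow> 'i list \<Rightarrow> 'f" where
  "l_list m [] = 0"
| "l_list m (i # is) =
     (if i = m then m_list is else 0) - psign (par m * zp) * a i * l_list m is"

text \<open>
  On tensors of degree \<open>k\<close>, \<open>M k\<close> evaluates at \<open>(z, ..., z)\<close>, and \<open>L m k\<close> sums, with signs, the evaluations that
  have \<open>e_m\<close> in one slot and \<open>z\<close> in all others. Other degrees are sent to zero. The values are scalars,
  embedded as multiples of \<open>1\<close> to make these maps instances of \<open>lin_ext\<close>.
\<close>

definition m_word :: "nat \<Rightarrow> 'i word \<Rightarrow> ('i word \<Rightarrow>\<^sub>0 'f)"
  where "m_word k w = smul (if length (letters w) = k then m_list (letters w) else 0) 1"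

definition l_word :: "'i \<Rightarrow> nat \<Rightarrow> 'i word \<Rightarrow> ('i word \<Rightarrow>\<^sub>0 'f)"
  where "l_word m k w = smul (if length (letters w) = k then l_list m (letters w) else 0) 1"

abbreviation M :: "nat \<Rightarrow> ('i word \<Rightarrow>\<^sub>0 'f) \<Rightarrow> ('i word \<Rightarrow>\<^sub>0 'f)"
  where "M k \<equiv> lin_ext (m_word k)"

abbreviation L :: "'i \<Rightarrow> nat \<Rightarrow> ('i word \<Rightarrow>\<^sub>0 'f) \<Rightarrow> ('i word \<Rightarrow>\<^sub>0 'f)"
  where "L m k \<equiv> lin_ext (l_word m k)"

lemma M_one: "M k 1 = (if k = 0 then 1 else 0)"
  by (simp add: lin_ext_one m_word_def)

lemma M_letter_0: "M 0 (letter i * t) = 0"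
  by (simp add: lin_ext_letter_mult m_word_def)

lemma M_letter_Suc: "M (Suc k) (letter i * t) = smul (a i) (M k t)"
proof -
  have "M (Suc k) (letter i * t) =
      lin_ext (\<lambda>w. smul (a i) (m_word k w)) t"
    unfolding lin_ext_letter_mult
    by (rule arg_cong[of _ _ "\<lambda>F. lin_ext F t"]) (simp add: fun_eq_iff m_word_def)
  then show ?thesis by (simp only: lin_ext_smul_fun)
qed

lemma L_one: "L m k 1 = 0"
  by (simp add: lin_ext_one l_word_def)

lemma L_0: "L m 0 t = 0"
  using in_tensors_over_UNIV[of t]
proof (induction t rule: tensors_over_induct)
  case (letter i t)
  show ?case by (simp add: lin_ext_letter_mult l_word_def)
qed (simp_all add: L_one)

lemma L_letter_Suc:
  "L m (Suc k) (letter i * t) =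
    smul (if i = m then 1 else 0) (M k t) - smul (psign (par m * zp) * a i) (L m k t)"
proof -
  have "L m (Suc k) (letter i * t) =
      lin_ext (\<lambda>w. smul (if i = m then 1 else 0) (m_word k w)
        + smul (- (psign (par m * zp) * a i)) (l_word m k w)) t"
    unfolding lin_ext_letter_mult
    by (rule arg_cong[of _ _ "\<lambda>F. lin_ext F t"])
      (simp add: fun_eq_iff m_word_def l_word_def tensor_space.scale_left_diff_distrib)
  then show ?thesis by (simp only: lin_ext_plus_fun lin_ext_smul_fun) simp
qed

lemma M_v: "M k (v i * t) = 0"
  using j by (cases k) (simp_all add: v_def \<zeta>_def left_diff_distrib M_letter_0 M_letter_Suc)

lemma M_\<zeta>: "M (Suc k) (\<zeta> * t) = M k t" "M 0 (\<zeta> * t) = 0"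
  using j by (simp_all add: \<zeta>_def M_letter_Suc M_letter_0)

lemma M_\<zeta>_power: "M k (\<zeta> ^ n) = (if n = k then 1 else 0)"
proof (induction n arbitrary: k)
  case 0
  then show ?case by (simp add: M_one)
next
  case (Suc n)
  then show ?case by (cases k) (simp_all add: M_\<zeta>)
qed

text \<open>
  As \<open>b i\<close> vanishes on \<open>z\<close>, the slot with \<open>e_m\<close> has to be the first one.
\<close>

lemma L_b:
  assumes "m \<in> I" "i \<in> I"
  shows "L m (Suc k) (b i * t) = smul (\<eta> i * \<beta> m i) (M k t)"
proof -
  let ?e = "psign (par m * zp) :: 'f"
  have "L m (Suc k) (b i * t) =
     (\<Sum>l\<in>I. smul (\<eta> i * \<beta> l i) (smul (if l = m then 1 else 0) (M k t) - smul (?e * a l) (L m k t)))"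
    by (simp only: b_def sum_distrib_right lin_ext_sum smul_mult_left lin_ext_smul L_letter_Suc)
  also have "\<dots> = (\<Sum>l\<in>I. smul (if l = m then \<eta> i * \<beta> l i else 0) (M k t)) -
      (\<Sum>l\<in>I. smul (?e * \<eta> i * (\<beta> l i * a l)) (L m k t))"
    unfolding sum_subtractf [symmetric]
    by (intro sum.cong refl) (simp add: tensor_space.scale_right_diff_distrib mult_ac)
  also have "\<dots> = smul (\<Sum>l\<in>I. if l = m then \<eta> i * \<beta> l i else 0) (M k t) -
      smul (?e * \<eta> i * (\<Sum>l\<in>I. \<beta> l i * a l)) (L m k t)"
    by (simp only: tensor_space.scale_sum_left sum_distrib_left)
  finally show ?thesis using assms fin sum_\<beta>_a_left by simp
qed

text \<open>
  For odd \<open>z\<close> the form \<open>\<zeta>\<close> is a polynomial variable and all contractions with \<open>z\<close> are defined on \<open>\<Lambda>\<close>.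
  For even \<open>z\<close> its square is zero, so one may insert \<open>z\<close> only once; this is what the bounds on \<open>k\<close>
  express.
\<close>

lemma J_functionals:
  assumes "t \<in> J"
  shows "(zp = 1 \<or> k \<le> 2 \<longrightarrow> L m k t = 0) \<and> (zp = 1 \<or> k \<le> 1 \<longrightarrow> M k t = 0)"
proof -
  let ?Q = "\<lambda>k t. (zp = 1 \<or> k \<le> 2 \<longrightarrow> L m k t = 0) \<and> (zp = 1 \<or> k \<le> 1 \<longrightarrow> M k t = 0)"
  have Q_add: "?Q k s \<Longrightarrow> ?Q k t \<Longrightarrow> ?Q k (s + t)" for k s t by auto
  have Q_smul: "?Q k t \<Longrightarrow> ?Q k (smul c t)" for k c t by auto
  have Q_zero: "?Q k 0" for k by auto
  have letters: "?Q k ((letter i * letter i' + smul (psign (par i * par i')) (letter i' * letter i)) * u)"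
    if "i \<in> I" "i' \<in> I" for i i' k u
  proof (cases k)
    case 0
    then show ?thesis by (simp add: L_0 M_letter_0 distrib_right mult.assoc)
  next
    case (Suc k')
    show ?thesis
    proof (cases k')
      case 0
      then show ?thesis
        by (simp add: Suc L_0 M_letter_0 M_letter_Suc L_letter_Suc distrib_right mult.assoc)
    next
      case (Suc k'')
      let ?s = "psign (par i * par i') :: 'f" and ?e = "psign (par m * zp) :: 'f"
      have MM: "M (Suc (Suc k'')) ((letter i * letter i' + smul ?s (letter i' * letter i)) * u) =
          smul ((1 + ?s) * (a i * a i')) (M k'' u)"
        by (rule poly_mapping_eqI)
          (simp add: M_letter_Suc distrib_right mult.assoc lookup_add algebra_simps)
      have LL: "L m (Suc (Suc k'')) ((letter i * letter i' + smul ?s (letter i' * letter i)) * u) =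
          smul ((if i = m then a i' else 0) * (1 - ?s * ?e) + (if i' = m then a i else 0) * (?s - ?e)) (M k'' u) +
          smul ((1 + ?s) * (a i * a i')) (L m k'' u)"
        by (rule poly_mapping_eqI)
          (auto simp: L_letter_Suc M_letter_Suc distrib_right mult.assoc lookup_add lookup_minus algebra_simps)
      \<comment> \<open>Terms with \<open>e_m\<close> in one of the two slots cancel by the sign in \<open>l_list\<close>; with \<open>z\<close> in both slots the
          two terms cancel if \<open>z\<close> is odd, and for even \<open>z\<close> the degree leaves no slot for \<open>e_m\<close>.\<close>
      have cross: "(if i = m then a i' else 0) * (1 - ?s * ?e) + (if i' = m then a i else 0) * (?s - ?e) = 0"
        using a_par[of i] a_par[of i'] that
        by (cases "a i = 0"; cases "a i' = 0") (auto simp: mult.commute)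
      have odd: "(1 + ?s) * (a i * a i') = 0" if "zp = 1"
        using a_par[of i] a_par[of i'] \<open>i \<in> I\<close> \<open>i' \<in> I\<close> that
        by (cases "a i = 0"; cases "a i' = 0") (auto simp: psign_def)
      show ?thesis
        unfolding \<open>k = Suc k'\<close> Suc MM LL cross
        using odd by (auto simp: L_0)
    qed
  qed
  have "\<forall>u\<in>T. \<forall>k. ?Q k (t * u)" using assms
  proof (induction rule: ext_ideal.induct)
    case (generator x p y q)
    have vec_letter: "?Q k ((x * letter i' + smul (psign (p * par i')) (letter i' * x)) * u)"
      if "i' \<in> I" for i' k u
      using generator(1)
    proof (induction x rule: vectors_over_induct)
      case zero
      show ?case using Q_zero by simp
    next
      case (add s t)
      from Q_add[OF add] show ?case
        by (simp add: distrib_left distrib_right tensor_space.scale_right_distrib algebra_simps)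
    next
      case (letter c i)
      have "?Q k (smul c ((letter i * letter i' + smul (psign (par i * par i')) (letter i' * letter i)) * u))"
        by (rule Q_smul[OF letters[OF letter(1) that]])
      with letter(2) show ?case
        by (simp add: distrib_right tensor_space.scale_right_distrib mult.commute)
    qed
    have "?Q k ((x * y + smul (psign (p * q)) (y * x)) * u)" for k u
      using generator(2)
    proof (induction y rule: vectors_over_induct)
      case zero
      show ?case using Q_zero by simp
    next
      case (add s t)
      from Q_add[OF add] show ?case
        by (simp add: distrib_left distrib_right tensor_space.scale_right_distrib algebra_simps)
    next
      case (letter c i)
      have "?Q k (smul c ((x * letter i + smul (psign (p * par i)) (letter i * x)) * u))"
        by (rule Q_smul[OF vec_letter[OF letter(1)]])
      with letter(2) show ?case
        by (simp add: distrib_right tensor_space.scale_right_distrib mult.commute)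
    qed
    then show ?case by (simp only: smul_def) blast
  next
    case zero
    then show ?case using Q_zero by simp
  next
    case (add s t)
    then show ?case using Q_add by (simp add: distrib_right)
  next
    case (mult_left s t)
    have "?Q k (s * (t * u))" if "u \<in> T" for k u
      using mult_left(1)
    proof (induction s arbitrary: k rule: tensors_over_induct)
      case (add s s')
      then show ?case using Q_add by (simp add: distrib_right)
    next
      case (smul c s)
      then show ?case using Q_smul by simp
    next
      case one
      then show ?case using mult_left(3) that by simp
    next
      case (letter i s)
      then show ?case
        by (cases k) (auto simp: L_0 M_letter_0 L_letter_Suc M_letter_Suc mult.assoc)
    qed
    then show ?case by (simp add: mult.assoc)
  next
    case (mult_right s t)
    then show ?case by (simp add: mult.assoc tensors_over_mult)
  qed
  then have "?Q k (t * 1)" by blast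
  then show ?thesis by simp
qed

text \<open>
  Every differential is a multiple of \<open>\<omega>\<close>, which vanishes as soon as one argument is \<open>z\<close>.
\<close>

lemma L_dif:
  assumes "t \<in> T" "m \<in> I" "zp = 1 \<or> k \<le> 2"
  shows "L m k (dif t) = 0"
proof -
  obtain t' where t': "t' \<in> T" "dif t \<approx> \<omega> * t'" using dif_left_\<omega>[OF assms(1)] by blast
  note t'(2)
  also have "\<omega> * t' \<approx> smul (- 1 / 2) (\<Sum>l\<in>I. b l * letter l) * t'"
    using t'(1) by (intro eqv_mult_right \<omega>_eqv)
  finally have "dif t - smul (- 1 / 2) (\<Sum>l\<in>I. b l * letter l) * t' \<in> J"
    by (simp only: eqv_def)
  from J_functionals[OF this, of k m] assms(3)
  have "L m k (dif t - smul (- 1 / 2) (\<Sum>l\<in>I. b l * letter l) * t') = 0" by blast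
  then have "L m k (dif t) = smul (- 1 / 2) (L m k (\<Sum>l\<in>I. b l * (letter l * t')))"
    by (simp add: sum_distrib_right mult.assoc eq_neg_iff_add_eq_0)
  also have "L m k (\<Sum>l\<in>I. b l * (letter l * t')) = 0"
  proof (cases k)
    case (Suc k')
    have "L m k (\<Sum>l\<in>I. b l * (letter l * t')) = (\<Sum>l\<in>I. smul (\<eta> l * \<beta> m l) (M k' (letter l * t')))"
      using assms(2) by (simp add: Suc lin_ext_sum L_b)
    also have "\<dots> = 0"
    proof (cases k')
      case (Suc k'')
      have "(\<Sum>l\<in>I. smul (\<eta> l * \<beta> m l) (M k' (letter l * t'))) =
          (\<Sum>l\<in>I. smul (\<beta> m l * a l) (M k'' t'))"
      proof (intro sum.cong refl)
        fix l assume "l \<in> I"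
        then have "\<eta> l * \<beta> m l * a l = \<beta> m l * a l" by (metis \<eta>_a mult.assoc mult.commute)
        then show "smul (\<eta> l * \<beta> m l) (M k' (letter l * t')) = smul (\<beta> m l * a l) (M k'' t')"
          by (simp add: Suc M_letter_Suc)
      qed
      also have "\<dots> = smul (\<Sum>l\<in>I. \<beta> m l * a l) (M k'' t')"
        by (simp only: tensor_space.scale_sum_left)
      finally show ?thesis using \<beta>_center[OF assms(2)] by simp
    qed (simp add: M_letter_0)
    finally show ?thesis .
  qed (simp add: L_0)
  finally show ?thesis by simp
qed

lemma \<zeta>_power_decompose:
  assumes "t \<in> T"
  shows "\<exists>n c r. (\<forall>m\<in>I. r m \<in> T) \<and> (\<forall>k>n. c k = 0) \<and>
    t \<approx> (\<Sum>k\<le>n. smul (c k) (\<zeta> ^ k)) + (\<Sum>m\<in>I. v m * r m)"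
  using assms
proof (induction t rule: tensors_over_induct)
  case (add t t')
  from add.IH(1) obtain n c r where t: "\<forall>m\<in>I. r m \<in> T" "\<forall>k>n. c k = 0"
    "t \<approx> (\<Sum>k\<le>n. smul (c k) (\<zeta> ^ k)) + (\<Sum>m\<in>I. v m * r m)" by (elim exE conjE)
  from add.IH(2) obtain n' c' r' where t': "\<forall>m\<in>I. r' m \<in> T" "\<forall>k>n'. c' k = 0"
    "t' \<approx> (\<Sum>k\<le>n'. smul (c' k) (\<zeta> ^ k)) + (\<Sum>m\<in>I. v m * r' m)" by (elim exE conjE)
  have "(\<Sum>k\<le>n. smul (c k) (\<zeta> ^ k)) = (\<Sum>k\<le>max n n'. smul (c k) (\<zeta> ^ k))"
    "(\<Sum>k\<le>n'. smul (c' k) (\<zeta> ^ k)) = (\<Sum>k\<le>max n n'. smul (c' k) (\<zeta> ^ k))"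
    by (rule sum_atMost_extend[symmetric]; use t(2) t'(2) in simp)+
  then show ?case
    using eqv_add[OF t(3) t'(3)] t(1,2) t'(1,2)
    by (intro exI[of _ "max n n'"] exI[of _ "\<lambda>k. c k + c' k"] exI[of _ "\<lambda>m. r m + r' m"])
      (auto simp: tensor_space.scale_left_distrib distrib_left sum.distrib algebra_simps)
next
  case (smul d t)
  from smul.IH obtain n c r where t: "\<forall>m\<in>I. r m \<in> T" "\<forall>k>n. c k = 0"
    "t \<approx> (\<Sum>k\<le>n. smul (c k) (\<zeta> ^ k)) + (\<Sum>m\<in>I. v m * r m)" by (elim exE conjE)
  then show ?case
    using eqv_smul[OF t(3), of d]
    by (intro exI[of _ n] exI[of _ "\<lambda>k. d * c k"] exI[of _ "\<lambda>m. smul d (r m)"])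
      (auto simp: tensor_space.scale_right_distrib tensor_space.scale_sum_right)
next
  case one
  show ?case
    by (intro exI[of _ 0] exI[of _ "\<lambda>k. if k = 0 then 1 else 0"] exI[of _ "\<lambda>m. 0"]) auto
next
  case (letter i t)
  from letter.IH obtain n c r where t: "\<forall>m\<in>I. r m \<in> T" "\<forall>k>n. c k = 0"
    "t \<approx> (\<Sum>k\<le>n. smul (c k) (\<zeta> ^ k)) + (\<Sum>m\<in>I. v m * r m)" by (elim exE conjE)
  let ?e = "\<lambda>m. - psign (zp * par m) :: 'f"
  let ?c = "\<lambda>k. case k of 0 \<Rightarrow> 0 | Suc k \<Rightarrow> a i * c k"
  have "\<zeta> * t \<approx> \<zeta> * ((\<Sum>k\<le>n. smul (c k) (\<zeta> ^ k)) + (\<Sum>m\<in>I. v m * r m))"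
    by (rule eqv_mult_left[OF t(3) \<zeta>_T])
  also have "\<dots> = (\<Sum>k\<le>n. smul (c k) (\<zeta> ^ Suc k)) + (\<Sum>m\<in>I. \<zeta> * v m * r m)"
    by (simp add: distrib_left sum_distrib_left mult.assoc)
  also have "\<dots> \<approx> (\<Sum>k\<le>n. smul (c k) (\<zeta> ^ Suc k)) + (\<Sum>m\<in>I. smul (?e m) (v m * \<zeta>) * r m)"
    using t(1) by (intro eqv_add eqv_sum eqv_mult_right \<zeta>_vec_commute v_vec eqv_refl) auto
  finally have \<zeta>t: "\<zeta> * t \<approx> (\<Sum>k\<le>n. smul (c k) (\<zeta> ^ Suc k)) + (\<Sum>m\<in>I. smul (?e m) (v m * \<zeta>) * r m)" .
  have "v i * t + smul (a i) (\<zeta> * t) \<approx>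
      v i * t + smul (a i) ((\<Sum>k\<le>n. smul (c k) (\<zeta> ^ Suc k)) + (\<Sum>m\<in>I. smul (?e m) (v m * \<zeta>) * r m))"
    by (intro eqv_add eqv_smul \<zeta>t eqv_refl)
  also have "\<dots> = (\<Sum>k\<le>n. smul (a i * c k) (\<zeta> ^ Suc k)) +
      (v i * t + (\<Sum>m\<in>I. smul (a i * ?e m) (v m * (\<zeta> * r m))))"
    by (simp only: tensor_space.scale_right_distrib tensor_space.scale_sum_right smul_mult_left
        tensor_space.scale_scale mult.assoc add_ac)
  also have "(\<Sum>k\<le>n. smul (a i * c k) (\<zeta> ^ Suc k)) = (\<Sum>k\<le>Suc n. smul (?c k) (\<zeta> ^ k))"
    by (subst sum.atMost_Suc_shift) simp
  also have "v i * t + (\<Sum>m\<in>I. smul (a i * ?e m) (v m * (\<zeta> * r m))) =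
      (\<Sum>m\<in>I. v m * ((if m = i then t else 0) + smul (a i * ?e m) (\<zeta> * r m)))"
    using sum_v_single[OF letter(1), of t]
    by (simp add: right_diff_distrib sum_subtractf sum_negf)
  finally have "letter i * t \<approx> (\<Sum>k\<le>Suc n. smul (?c k) (\<zeta> ^ k)) +
      (\<Sum>m\<in>I. v m * ((if m = i then t else 0) + smul (a i * ?e m) (\<zeta> * r m)))"
    by (simp only: letter_eq[of i] distrib_right smul_mult_left)
  moreover have "\<forall>k>Suc n. ?c k = 0" using t(2) by (auto split: nat.split)
  moreover have "\<forall>m\<in>I. (if m = i then t else 0) + smul (a i * ?e m) (\<zeta> * r m) \<in> T"
    using t(1) letter \<zeta>_T by auto
  ultimately show ?case
    by (intro exI[of _ "Suc n"] exI[of _ ?c]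
        exI[of _ "\<lambda>m. (if m = i then t else 0) + smul (a i * ?e m) (\<zeta> * r m)"] conjI)
qed

text \<open>
  Let \<open>c i k\<close> be the coefficient of \<open>\<zeta> ^ k\<close> in \<open>f i\<close>. Applying \<open>L m (k + 1)\<close> to the hypothesis on \<open>F\<close> yields
  \<open>\<Sum> \<eta> i * \<beta> m i * c i k = 0\<close> for all \<open>m\<close>, so nondegeneracy makes \<open>\<eta> i * c i k\<close> a multiple of \<open>a i\<close>; the normalisation
  \<open>f j = 0\<close> makes this multiple zero. For even \<open>z\<close> and \<open>k \<ge> 2\<close>, where \<open>L\<close> is not available, \<open>\<zeta> ^ k\<close> is itself
  zero in \<open>\<Lambda>\<close>.
\<close>

lemma in_aug:
  assumes f: "\<And>i. i \<in> I \<Longrightarrow> f i \<in> T" "f j = 0" and F: "F \<in> T" "(\<Sum>i\<in>I. b i * f i) \<approx> dif F"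
    and i: "i \<in> I"
  shows "f i \<in> aug"
proof -
  \<comment> \<open>At \<open>j\<close> the zero coefficients are chosen; they fix the multiple of \<open>a\<close> found below to be zero.\<close>
  have "\<exists>n c r. (i = j \<longrightarrow> c = (\<lambda>_. 0)) \<and> (\<forall>m\<in>I. r m \<in> T) \<and> (\<forall>k>n. c k = 0) \<and>
      f i \<approx> (\<Sum>k\<le>n. smul (c k) (\<zeta> ^ k)) + (\<Sum>m\<in>I. v m * r m)" if "i \<in> I" for i
  proof (cases "i = j")
    case True
    then show ?thesis using f(2)
      by (intro exI[of _ 0] exI[of _ "\<lambda>_. 0"] exI[of _ "\<lambda>_. 0"]) auto
  qed (use \<zeta>_power_decompose[OF f(1)[OF that]] in simp)
  then have "\<forall>i. \<exists>n c r. i \<in> I \<longrightarrow> (i = j \<longrightarrow> c = (\<lambda>_. 0)) \<and> (\<forall>m\<in>I. r m \<in> T) \<and> (\<forall>k>n. c k = 0) \<and>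
      f i \<approx> (\<Sum>k\<le>n. smul (c k) (\<zeta> ^ k)) + (\<Sum>m\<in>I. v m * r m)"
    by blast
  then obtain n c r where ncr: "\<forall>i. i \<in> I \<longrightarrow> (i = j \<longrightarrow> c i = (\<lambda>_. 0)) \<and> (\<forall>m\<in>I. r i m \<in> T) \<and>
      (\<forall>k>n i. c i k = 0) \<and> f i \<approx> (\<Sum>k\<le>n i. smul (c i k) (\<zeta> ^ k)) + (\<Sum>m\<in>I. v m * r i m)"
    unfolding choice_iff by (elim exE)
  then have nz: "c j = (\<lambda>_. 0)" and r: "\<And>i m. \<lbrakk>i \<in> I; m \<in> I\<rbrakk> \<Longrightarrow> r i m \<in> T"
    and c: "\<And>i k. \<lbrakk>i \<in> I; k > n i\<rbrakk> \<Longrightarrow> c i k = 0"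
    and fe: "\<And>i. i \<in> I \<Longrightarrow> f i \<approx> (\<Sum>k\<le>n i. smul (c i k) (\<zeta> ^ k)) + (\<Sum>m\<in>I. v m * r i m)"
    using j(1) by blast+
  let ?g = "\<lambda>i. (\<Sum>k\<le>n i. smul (c i k) (\<zeta> ^ k)) + (\<Sum>m\<in>I. v m * r i m)"
  have Mg: "M k (?g i) = smul (c i k) 1" if "i \<in> I" for i k
  proof -
    have "M k (?g i) = (\<Sum>k'\<le>n i. if k' = k then smul (c i k) 1 else 0)"
      by (simp only: lin_ext_add lin_ext_sum lin_ext_smul M_v M_\<zeta>_power sum.neutral_const add_0_right)
        (intro sum.cong refl, simp)
    then show ?thesis using c[OF that, of k] by (simp add: sum.delta')
  qed
  have ck: "c i k = 0" if "zp = 1 \<or> k \<le> 1" "i \<in> I" for i k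
  proof -
    have "(\<Sum>i\<in>I. b i * ?g i) \<approx> (\<Sum>i\<in>I. b i * f i)"
      by (intro eqv_sum eqv_mult_left b_T eqv_sym[OF fe])
    also note F(2)
    finally have "(\<Sum>i\<in>I. b i * ?g i) - dif F \<in> J" by (simp only: eqv_def)
    note vanish = J_functionals[OF this]
    have "(\<Sum>i\<in>I. \<beta> m i * (\<eta> i * c i k)) = 0" if m: "m \<in> I" for m
    proof -
      have "L m (Suc k) (\<Sum>i\<in>I. b i * ?g i) = 0"
        using vanish[of "Suc k" m] L_dif[OF F(1) m, of "Suc k"] \<open>zp = 1 \<or> k \<le> 1\<close> by auto
      also have "L m (Suc k) (\<Sum>i\<in>I. b i * ?g i) = (\<Sum>i\<in>I. smul (\<eta> i * \<beta> m i) (M k (?g i)))"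
        unfolding lin_ext_sum by (intro sum.cong refl L_b m)
      also have "\<dots> = smul (\<Sum>i\<in>I. \<beta> m i * (\<eta> i * c i k)) 1"
        unfolding tensor_space.scale_sum_left
        by (intro sum.cong refl) (simp only: Mg tensor_space.scale_scale mult_ac)
      finally show ?thesis by simp
    qed
    from \<beta>_nondegenerate[OF this] obtain s where s: "\<forall>i\<in>I. \<eta> i * c i k = s * a i" by blast
    with j nz have "s = 0" by force
    then show ?thesis using s \<open>i \<in> I\<close> by (auto simp: \<eta>_def psign_def split: if_splits)
  qed
  have power: "smul (c i k) (\<zeta> ^ k) \<approx> 0" for k
  proof (cases "zp = 1 \<or> k \<le> 1")
    case True
    then show ?thesis using ck i by simp
  next
    case False
    then have "zp = 0" by simp
    have "\<zeta> * \<zeta> + smul (psign (zp * zp)) (\<zeta> * \<zeta>) \<in> J"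
      using ext_ideal.generator[OF \<zeta>_vec \<zeta>_vec] by (simp add: smul_def)
    from J_smul[OF this, of "1 / 2"] have "\<zeta> * \<zeta> \<in> J"
      unfolding \<open>zp = 0\<close>
      by (simp add: psign_def tensor_space.scale_right_distrib flip: tensor_space.scale_left_distrib)
    then have "\<zeta> * \<zeta> * \<zeta> ^ (k - 2) \<in> J"
      by (rule ext_ideal.mult_right[OF _ tensors_over_power[OF \<zeta>_T]])
    moreover have "\<zeta> * \<zeta> * \<zeta> ^ (k - 2) = \<zeta> ^ k"
      using False by (cases k; cases "k - 1") (auto simp: mult.assoc)
    ultimately show ?thesis by (simp add: eqv_zero_iff J_smul)
  qed
  have "(\<Sum>k\<le>n i. smul (c i k) (\<zeta> ^ k)) \<approx> (\<Sum>k\<le>n i. 0)"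
    using power by (intro eqv_sum)
  then have "?g i \<approx> 0 + (\<Sum>m\<in>I. v m * r i m)"
    by (intro eqv_add) auto
  from eqv_trans[OF fe[OF i] this] have "f i \<approx> (\<Sum>m\<in>I. v m * r i m)" by simp
  moreover have "\<forall>m\<in>I. r i m \<in> T" using r[OF i] by blast
  ultimately show ?thesis unfolding aug_def using f(1)[OF i] by blast
qed

text \<open>
  A family \<open>f\<close> stands for the adjoint cochain \<open>\<Sum> e_i \<otimes> f_i\<close>. The summand with \<open>a i\<close> is the component at
  \<open>e_i\<close> of \<open>z \<otimes> \<Sum> b_l f_l\<close>.
\<close>

end

section \<open>Adjoint cocycles in components\<close>

context heisenberg_constants
begin

definition cocycle :: "('i \<Rightarrow> ('i word \<Rightarrow>\<^sub>0 'f)) \<Rightarrow> bool"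
  where "cocycle f \<longleftrightarrow> (\<forall>i\<in>I. f i \<in> T \<and> dif (f i) + smul (a i) (\<Sum>l\<in>I. b l * f l) \<in> J)"

text \<open>
  The coefficient of \<open>z\<close> in the cup product of two adjoint cochains.
\<close>

definition cup_form :: "('i \<Rightarrow> ('i word \<Rightarrow>\<^sub>0 'f)) \<Rightarrow> ('i \<Rightarrow> ('i word \<Rightarrow>\<^sub>0 'f)) \<Rightarrow> ('i word \<Rightarrow>\<^sub>0 'f)"
  where "cup_form f g =
    (\<Sum>k\<in>I. \<Sum>l\<in>I. smul (\<beta> k l) (twist (\<lambda>i. psign (par i * par l)) (f k) * g l))"

text \<open>
  Components modulo \<open>z\<close>: this subtracts \<open>z \<otimes> t\<close>, with \<open>t\<close> chosen to make the component at \<open>e_j\<close> zero.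
\<close>

definition reduce :: "('i \<Rightarrow> ('i word \<Rightarrow>\<^sub>0 'f)) \<Rightarrow> 'i \<Rightarrow> ('i word \<Rightarrow>\<^sub>0 'f)"
  where "reduce f i = f i - smul (a i) (smul (1 / a j) (f j))"

text \<open>
  The cocycle condition at \<open>j\<close> says that \<open>\<Sum> b_l f_l\<close> is the differential of a multiple of \<open>f j\<close>.
  Subtracting it from the condition at \<open>i\<close> gives closedness, and as the \<open>b_l\<close> satisfy \<open>\<Sum> a_l b_l = 0\<close>, the
  sum \<open>\<Sum> b_l f_l\<close> is unchanged by the reduction and stays exact.
\<close>

lemma reduce_cocycle:
  assumes "cocycle f" "i \<in> I"
  shows "dif (reduce f i) \<in> J" and "reduce f i \<in> aug"
proof -
  let ?E = "\<Sum>l\<in>I. b l * f l"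
  have fT: "f i \<in> T" and fJ: "dif (f i) + smul (a i) ?E \<in> J" if "i \<in> I" for i
    using assms(1) that by (auto simp: cocycle_def)
  have jJ: "smul (1 / a j) (dif (f j) + smul (a j) ?E) \<in> J" using fJ[OF j(1)] by (rule J_smul)
  then have "dif (smul (1 / a j) (f j)) + ?E \<in> J"
    using j by (simp add: tensor_space.scale_right_distrib)
  note FJ = this
  have "dif (reduce f i) = (dif (f i) + smul (a i) ?E) - smul (a i) (dif (smul (1 / a j) (f j)) + ?E)"
    by (simp add: reduce_def tensor_space.scale_right_distrib)
  also have "\<dots> \<in> J" using fJ[OF assms(2)] J_smul[OF FJ] by (rule J_diff)
  finally show "dif (reduce f i) \<in> J" .
  have "(\<Sum>l\<in>I. b l * reduce f l) = ?E - (\<Sum>l\<in>I. b l * smul (a l) (smul (1 / a j) (f j)))"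
    by (simp only: reduce_def right_diff_distrib sum_subtractf)
  also have "\<dots> = ?E" by (simp only: sum_b_a diff_0_right)
  also have "?E \<approx> dif (- smul (1 / a j) (f j))" using FJ by (simp add: eqv_def add.commute)
  finally have E: "(\<Sum>l\<in>I. b l * reduce f l) \<approx> dif (- smul (1 / a j) (f j))" .
  show "reduce f i \<in> aug"
    by (rule in_aug[OF _ _ _ E assms(2)])
      (use fT j in \<open>auto simp: reduce_def\<close>)
qed

text \<open>
  Brackets with \<open>z\<close> vanish.
\<close>

lemma cup_form_reduce: "cup_form f g = cup_form (reduce f) (reduce g)"
proof -
  let ?\<sigma> = "\<lambda>p. twist (\<lambda>i. psign (par i * p))"
  let ?F = "smul (1 / a j) (f j)" and ?G = "smul (1 / a j) (g j)"
  have left: "cup_form f g = cup_form (reduce f) g"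
  proof -
    have "cup_form f g - cup_form (reduce f) g =
        (\<Sum>k\<in>I. \<Sum>l\<in>I. smul (\<beta> k l) (?\<sigma> (par l) (smul (a k) ?F) * g l))"
      unfolding cup_form_def sum_subtractf[symmetric] reduce_def
      by (intro sum.cong refl)
        (simp only: lin_ext_diff left_diff_distrib tensor_space.scale_right_diff_distrib diff_diff_eq2 add_diff_cancel_left')
    also have "\<dots> = (\<Sum>l\<in>I. \<Sum>k\<in>I. smul (\<beta> k l * a k) (?\<sigma> (par l) ?F * g l))"
      by (subst sum.swap) (simp only: lin_ext_smul smul_mult_left tensor_space.scale_scale mult.assoc)
    also have "\<dots> = (\<Sum>l\<in>I. smul (\<Sum>k\<in>I. \<beta> k l * a k) (?\<sigma> (par l) ?F * g l))"
      by (simp only: tensor_space.scale_sum_left)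
    also have "\<dots> = 0" using sum_\<beta>_a_left by simp
    finally show ?thesis by simp
  qed
  have right: "cup_form h g = cup_form h (reduce g)" for h
  proof -
    have "cup_form h g - cup_form h (reduce g) =
        (\<Sum>k\<in>I. \<Sum>l\<in>I. smul (\<beta> k l) (?\<sigma> (par l) (h k) * smul (a l) ?G))"
      unfolding cup_form_def sum_subtractf[symmetric] reduce_def
      by (intro sum.cong refl)
        (simp only: right_diff_distrib tensor_space.scale_right_diff_distrib diff_diff_eq2 add_diff_cancel_left')
    also have "\<dots> = (\<Sum>k\<in>I. \<Sum>l\<in>I. smul (\<beta> k l * a l) (?\<sigma> zp (h k) * ?G))"
    proof (intro sum.cong refl)
      fix k l assume "l \<in> I"
      then show "smul (\<beta> k l) (?\<sigma> (par l) (h k) * smul (a l) ?G) = smul (\<beta> k l * a l) (?\<sigma> zp (h k) * ?G)"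
        using a_par[of l] by (cases "a l = 0") simp_all
    qed
    also have "\<dots> = (\<Sum>k\<in>I. smul (\<Sum>l\<in>I. \<beta> k l * a l) (?\<sigma> zp (h k) * ?G))"
      by (simp only: tensor_space.scale_sum_left)
    also have "\<dots> = 0" using \<beta>_center by simp
    finally show ?thesis by simp
  qed
  show ?thesis by (rule trans[OF left right])
qed

lemma twist_parity_dif:
  assumes "t \<in> T"
  shows "dif (twist (\<lambda>i. psign (par i * p)) t) = twist (\<lambda>i. psign (par i * p)) (dif t)"
  using assms
proof (induction t rule: tensors_over_induct)
  case (letter i t)
  let ?\<tau> = "twist (\<lambda>i. psign (par i * p))"
  have "?\<tau> \<omega> = smul (psign (zp * p)) \<omega>"
    by (rule twist_\<omega>) (auto simp: psign_add distrib_right)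
  then show ?case using letter a_par[of i]
    by (cases "a i = 0") (simp_all add: twist_mult tensor_space.scale_right_diff_distrib mult.commute)
qed simp_all

lemma twist_parity_aug:
  assumes "t \<in> aug"
  shows "twist (\<lambda>i. psign (par i * p)) t \<in> aug"
proof -
  let ?\<tau> = "twist (\<lambda>i. psign (par i * p))"
  have vec: "?\<tau> x = smul (psign (q * p)) x" if "x \<in> vec q" for x q
    using that by (induction x rule: vectors_over_induct)
      (auto simp: tensor_space.scale_right_distrib mult.commute)
  from assms obtain r where r: "t \<in> T" "\<forall>m\<in>I. r m \<in> T" "t \<approx> (\<Sum>m\<in>I. v m * r m)"
    by (auto simp: aug_def)
  have "?\<tau> t \<approx> ?\<tau> (\<Sum>m\<in>I. v m * r m)" using r(3) by (rule eqv_twist)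
  also have "\<dots> = (\<Sum>m\<in>I. v m * smul (psign (par m * p)) (?\<tau> (r m)))"
    unfolding lin_ext_sum twist_mult by (intro sum.cong refl) (simp add: vec[OF v_vec])
  finally have "?\<tau> t \<approx> (\<Sum>m\<in>I. v m * smul (psign (par m * p)) (?\<tau> (r m)))" .
  then show ?thesis
    unfolding aug_def using r(1,2)
    by (auto intro!: twist_in_tensors_over exI[of _ "\<lambda>m. smul (psign (par m * p)) (?\<tau> (r m))"])
qed

text \<open>
  The form \<open>v m\<close> vanishes on \<open>z\<close>, so it is \<open>\<beta>(-, n)\<close> for some \<open>n\<close>.
\<close>

lemma v_eq_sum_b:
  assumes "m \<in> I"
  shows "\<exists>\<kappa>. v m = (\<Sum>l\<in>I. smul (\<kappa> l) (b l))"
proof -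
  let ?c = "\<lambda>k. (if k = m then 1 else 0) - a m / a j * (if k = j then 1 else 0)"
  have "(\<Sum>k\<in>I. ?c k * a k) = (\<Sum>k\<in>I. if k = m then a m else 0) - (\<Sum>k\<in>I. if k = j then a m else 0)"
    unfolding sum_subtractf[symmetric] by (intro sum.cong refl) (use j in auto)
  also have "\<dots> = 0" using assms j fin by simp
  finally obtain \<mu> where \<mu>: "\<forall>k\<in>I. ?c k = (\<Sum>l\<in>I. \<beta> k l * \<mu> l)"
    using \<beta>_onto[of ?c] by blast
  have "v m = (\<Sum>k\<in>I. if k = m then letter m else 0) - (\<Sum>k\<in>I. if k = j then smul (a m / a j) (letter j) else 0)"
    using assms j fin by (simp add: v_def \<zeta>_def)
  also have "\<dots> = (\<Sum>k\<in>I. smul (?c k) (letter k))"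
    unfolding sum_subtractf[symmetric]
    by (intro sum.cong refl) (auto simp: tensor_space.scale_left_diff_distrib)
  also have "\<dots> = (\<Sum>k\<in>I. \<Sum>l\<in>I. smul (\<beta> k l * \<mu> l) (letter k))"
    using \<mu> by (intro sum.cong refl) (simp only: tensor_space.scale_sum_left)
  also have "\<dots> = (\<Sum>l\<in>I. \<Sum>k\<in>I. smul (\<beta> k l * \<mu> l) (letter k))" by (rule sum.swap)
  also have "\<dots> = (\<Sum>l\<in>I. smul (\<eta> l * \<mu> l) (b l))"
    unfolding b_def tensor_space.scale_sum_right
    by (intro sum.cong refl) (simp add: \<eta>_def mult_ac)
  finally show ?thesis by (rule exI[of _ "\<lambda>l. \<eta> l * \<mu> l"])
qed

lemma cup_form_exact:
  assumes "cocycle f" "cocycle g"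
  shows "\<exists>t. (\<forall>l\<in>I. t l \<in> T \<and> dif (t l) \<in> J) \<and> cup_form f g \<approx> (\<Sum>l\<in>I. b l * t l)"
proof -
  have "cup_form (reduce f) (reduce g) \<in> v_exact"
    unfolding cup_form_def
  proof (intro v_exact_sum v_exact_smul closed_mult_v_exact twist_parity_aug)
    fix k l assume kl: "k \<in> I" "l \<in> I"
    show "reduce f k \<in> aug" "dif (reduce g l) \<in> J" "reduce g l \<in> aug"
      using reduce_cocycle assms kl by auto
    then have "reduce f k \<in> T" by (simp add: aug_def)
    then show "dif (twist (\<lambda>i. psign (par i * par l)) (reduce f k)) \<in> J"
      using reduce_cocycle(1)[OF assms(1) kl(1)] by (simp add: twist_parity_dif twist_in_J)
  qed
  then obtain r where r: "\<forall>m\<in>I. r m \<in> T \<and> dif (r m) \<in> J" "cup_form f g \<approx> (\<Sum>m\<in>I. v m * r m)"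
    by (auto simp: v_exact_def cup_form_reduce[of f g])
  from v_eq_sum_b obtain \<kappa> where \<kappa>: "\<And>m. m \<in> I \<Longrightarrow> v m = (\<Sum>l\<in>I. smul (\<kappa> m l) (b l))" by metis
  have "(\<Sum>m\<in>I. v m * r m) = (\<Sum>m\<in>I. \<Sum>l\<in>I. b l * smul (\<kappa> m l) (r m))"
    by (intro sum.cong refl) (simp add: \<kappa> sum_distrib_right)
  also have "\<dots> = (\<Sum>l\<in>I. b l * (\<Sum>m\<in>I. smul (\<kappa> m l) (r m)))"
    by (subst sum.swap) (simp only: sum_distrib_left)
  finally have "cup_form f g \<approx> (\<Sum>l\<in>I. b l * (\<Sum>m\<in>I. smul (\<kappa> m l) (r m)))" using r(2) by simp
  moreover have "(\<Sum>m\<in>I. smul (\<kappa> m l) (r m)) \<in> T" "dif (\<Sum>m\<in>I. smul (\<kappa> m l) (r m)) \<in> J" for l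
    using r(1) by (auto simp: lin_ext_sum intro: J_sum J_smul)
  ultimately show ?thesis by (intro exI[of _ "\<lambda>l. \<Sum>m\<in>I. smul (\<kappa> m l) (r m)"] conjI ballI)
qed

end

context heisenberg_constants
begin

text \<open>
  The differential of adjoint cochains in components.
\<close>

definition fam_dif :: "('i \<Rightarrow> ('i word \<Rightarrow>\<^sub>0 'f)) \<Rightarrow> 'i \<Rightarrow> ('i word \<Rightarrow>\<^sub>0 'f)"
  where "fam_dif \<phi> i = dif (\<phi> i) + smul (a i) (\<Sum>l\<in>I. b l * \<phi> l)"

lemma cocycle_iff: "cocycle \<phi> \<longleftrightarrow> (\<forall>i\<in>I. \<phi> i \<in> T \<and> fam_dif \<phi> i \<in> J)"
  by (simp add: cocycle_def fam_dif_def)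

lemma fam_dif_T: "\<lbrakk>\<And>l. l \<in> I \<Longrightarrow> \<phi> l \<in> T; i \<in> I\<rbrakk> \<Longrightarrow> fam_dif \<phi> i \<in> T"
  unfolding fam_dif_def
  by (intro tensors_over_add dif_T tensors_over_smul tensors_over_sum tensors_over_mult b_T) auto

lemma fam_dif_J: "\<lbrakk>\<And>l. l \<in> I \<Longrightarrow> \<phi> l \<in> J; i \<in> I\<rbrakk> \<Longrightarrow> fam_dif \<phi> i \<in> J"
  unfolding fam_dif_def
  by (intro ext_ideal.add dif_J J_smul J_sum ext_ideal.mult_left b_T)

lemma fam_dif_diff: "fam_dif (\<lambda>l. \<phi> l - \<psi> l) i = fam_dif \<phi> i - fam_dif \<psi> i"
  by (simp add: fam_dif_def right_diff_distrib sum_subtractf tensor_space.scale_right_diff_distrib)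

lemma fam_dif_add: "fam_dif (\<lambda>l. \<phi> l + \<psi> l) i = fam_dif \<phi> i + fam_dif \<psi> i"
  by (simp add: fam_dif_def distrib_left sum.distrib tensor_space.scale_right_distrib)

text \<open>
  The mixed terms cancel, and \<open>\<Sum> b_l fam_dif \<phi> l\<close> has no contribution from the second summand of
  \<open>fam_dif\<close> because \<open>\<Sum> a_l b_l = 0\<close>, which reflects that \<open>\<gg>\<close> is two-step nilpotent.
\<close>

lemma fam_dif_fam_dif:
  assumes "\<And>l. l \<in> I \<Longrightarrow> \<phi> l \<in> T" "i \<in> I"
  shows "fam_dif (fam_dif \<phi>) i \<in> J"
proof -
  let ?E = "\<Sum>l\<in>I. b l * \<phi> l" and ?D = "\<Sum>l\<in>I. b l * dif (\<phi> l)"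
  have "dif ?E = (\<Sum>l\<in>I. - (b l * dif (\<phi> l)))"
    unfolding lin_ext_sum by (intro sum.cong refl) (simp add: dif_mult dif_b b_minus)
  then have "dif ?E = - ?D" by (simp add: sum_negf)
  moreover have "(\<Sum>l\<in>I. b l * fam_dif \<phi> l) = ?D + (\<Sum>l\<in>I. b l * smul (a l) ?E)"
    by (simp only: fam_dif_def distrib_left sum.distrib)
  then have "(\<Sum>l\<in>I. b l * fam_dif \<phi> l) = ?D" by (simp only: sum_b_a add_0_right)
  ultimately have "fam_dif (fam_dif \<phi>) i = dif (dif (\<phi> i))"
    by (subst fam_dif_def) (simp add: fam_dif_def)
  then show ?thesis using dif_dif assms by simp
qed

lemma cup_form_diff:
  "cup_form (\<lambda>k. f k - f' k) g = cup_form f g - cup_form f' g"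
  "cup_form f (\<lambda>k. g k - g' k) = cup_form f g - cup_form f g'"
  by (simp_all add: cup_form_def left_diff_distrib right_diff_distrib sum_subtractf
      tensor_space.scale_right_diff_distrib)

lemma cup_form_J:
  assumes "\<And>k. k \<in> I \<Longrightarrow> f k \<in> T" "\<And>k. k \<in> I \<Longrightarrow> g k \<in> T"
    and "(\<forall>k\<in>I. f k \<in> J) \<or> (\<forall>k\<in>I. g k \<in> J)"
  shows "cup_form f g \<in> J"
  unfolding cup_form_def using assms(3)
proof
  assume "\<forall>k\<in>I. f k \<in> J"
  then show "(\<Sum>k\<in>I. \<Sum>l\<in>I. smul (\<beta> k l) (twist (\<lambda>i. psign (par i * par l)) (f k) * g l)) \<in> J"
    using assms(2) by (intro J_sum J_smul ext_ideal.mult_right twist_in_J) auto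
next
  assume "\<forall>k\<in>I. g k \<in> J"
  then show "(\<Sum>k\<in>I. \<Sum>l\<in>I. smul (\<beta> k l) (twist (\<lambda>i. psign (par i * par l)) (f k) * g l)) \<in> J"
    using assms(1) by (intro J_sum J_smul ext_ideal.mult_left twist_in_tensors_over) auto
qed

lemma cup_form_T:
  "\<lbrakk>\<And>k. k \<in> I \<Longrightarrow> f k \<in> T; \<And>k. k \<in> I \<Longrightarrow> g k \<in> T\<rbrakk> \<Longrightarrow> cup_form f g \<in> T"
  unfolding cup_form_def
  by (intro tensors_over_sum tensors_over_smul tensors_over_mult twist_in_tensors_over)

text \<open>
  The primitive is \<open>\<Sum> e_l \<otimes> t_l\<close>: as the \<open>t_l\<close> are closed, its differential is \<open>z \<otimes> \<Sum> b_l t_l\<close>.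
\<close>

lemma cup_family_exact:
  assumes "cocycle f" "cocycle g"
  shows "\<exists>t. (\<forall>i\<in>I. t i \<in> T) \<and> (\<forall>i\<in>I. smul (a i) (cup_form f g) \<approx> fam_dif t i)"
proof -
  from cup_form_exact[OF assms] obtain t where
    "(\<forall>l\<in>I. t l \<in> T \<and> dif (t l) \<in> J) \<and> cup_form f g \<approx> (\<Sum>l\<in>I. b l * t l)" ..
  then have t: "\<forall>l\<in>I. t l \<in> T \<and> dif (t l) \<in> J" "cup_form f g \<approx> (\<Sum>l\<in>I. b l * t l)"
    by simp_all
  have "smul (a i) (cup_form f g) \<approx> fam_dif t i" if "i \<in> I" for i
  proof -
    have "0 \<approx> dif (t i)" 
      by (rule eqv_sym) (use t(1) that in \<open>simp add: eqv_zero_iff\<close>)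
    from eqv_add[OF this eqv_smul[OF t(2)], of "a i"] show ?thesis by (simp add: fam_dif_def)
  qed
  with t(1) show ?thesis by (intro exI[of _ t]) simp
qed

end

section \<open>Structure constants in a homogeneous basis\<close>

lemma bit_add_self [simp]: "p + p = (0::bit)" "p + (p + q) = (q::bit)"
  by (cases p; cases q; simp)+

context superspace
begin

lemma gr_closed:
  "0 \<in> gr p" "\<lbrakk>x \<in> gr p; y \<in> gr p\<rbrakk> \<Longrightarrow> x + y \<in> gr p" "\<lbrakk>x \<in> gr p; y \<in> gr p\<rbrakk> \<Longrightarrow> x - y \<in> gr p"
  "x \<in> gr p \<Longrightarrow> scale c x \<in> gr p"
  using gr_subspace[of p] subspace_0 subspace_add subspace_diff subspace_scale by blast+

lemma gr_disjoint:
  assumes "x \<in> gr p" "x \<in> gr q" "p \<noteq> q"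
  shows "x = 0"
proof -
  have x: "x \<in> gr 0" "x \<in> gr 1" using assms by (cases p; cases q; auto)+
  from gr_direct_sum[of x] obtain u where "\<And>y. y \<in> gr 0 \<and> x - y \<in> gr 1 \<Longrightarrow> y = u" by blast
  from this[of 0] this[of x] x gr_closed(1) show ?thesis by auto
qed

lemma component_unique:
  assumes "u \<in> gr p" "v - u \<in> gr (p + 1)"
  shows "component p v = u"
  unfolding component_def
proof (rule the_equality)
  fix u' assume u': "u' \<in> gr p \<and> v - u' \<in> gr (p + 1)"
  have "u' - u \<in> gr p" using u' assms(1) by (intro gr_closed) auto
  moreover have "(v - u) - (v - u') \<in> gr (p + 1)" using u' assms(2) by (intro gr_closed(3)[of "v - u" _ "v - u'"]) auto
  then have "u' - u \<in> gr (p + 1)" by simp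
  moreover have "p \<noteq> p + 1" by (cases p) auto
  ultimately have "u' - u = 0" by (rule gr_disjoint)
  then show "u' = u" by simp
qed (use assms in auto)

lemma component_split: "component p v \<in> gr p" "v - component p v \<in> gr (p + 1)"
proof -
  from gr_direct_sum[of v] obtain u where u: "u \<in> gr 0" "v - u \<in> gr 1" by blast
  have "component 0 v = u" using u by (intro component_unique) auto
  moreover have "component 1 v = v - u" using u by (intro component_unique) auto
  ultimately show "component p v \<in> gr p" "v - component p v \<in> gr (p + 1)"
    using u by (cases p; auto)+
qed

lemma component_homogeneous: "x \<in> gr q \<Longrightarrow> component p x = (if q = p then x else 0)"
  by (rule component_unique) (cases p; cases q; auto simp: gr_closed)+

lemma component_add: "component p (x + y) = component p x + component p y"
proof (rule component_unique)
  have "(x - component p x) + (y - component p y) \<in> gr (p + 1)"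
    by (intro gr_closed component_split)
  then show "x + y - (component p x + component p y) \<in> gr (p + 1)" by (simp add: algebra_simps)
qed (intro gr_closed component_split)

lemma component_scale: "component p (scale c x) = scale c (component p x)"
proof (rule component_unique)
  have "scale c (x - component p x) \<in> gr (p + 1)" by (intro gr_closed component_split)
  then show "scale c x - scale c (component p x) \<in> gr (p + 1)" by (simp add: scale_right_diff_distrib)
qed (intro gr_closed component_split)

lemma component_zero: "component p 0 = 0"
  using component_scale[of p 0 0] by simp

lemma component_sum: "component p (\<Sum>a\<in>A. f a) = (\<Sum>a\<in>A. component p (f a))"
  by (induction A rule: infinite_finite_induct) (auto simp: component_zero component_add)

lemma sum_components: "component 0 v + component 1 v = v"
proof -
  have "component 1 v = v - component 0 v"
    using component_split(1)[of 0 v] component_split(2)[where p = 0 and v = v] by (intro component_unique) auto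
  then show ?thesis by simp
qed

end

context lie_superalgebra
begin

lemma br_add_left: "br (x + y) w = br x w + br y w"
  and br_scale_left: "br (scale c x) w = scale c (br x w)"
  and br_zero_left: "br 0 w = 0"
proof -
  interpret l: Vector_Spaces.linear scale scale "\<lambda>x. br x w" by (rule br_linear_left)
  show "br (x + y) w = br x w + br y w" by (rule l.add)
  show "br (scale c x) w = scale c (br x w)" by (rule l.scale)
  show "br 0 w = 0" by (rule l.zero)
qed

lemma br_add_right: "br w (x + y) = br w x + br w y"
  and br_scale_right: "br w (scale c x) = scale c (br w x)"
  and br_zero_right: "br w 0 = 0"
proof -
  interpret l: Vector_Spaces.linear scale scale "br w" by (rule br_linear_right)
  show "br w (x + y) = br w x + br w y" by (rule l.add)
  show "br w (scale c x) = scale c (br w x)" by (rule l.scale)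
  show "br w 0 = 0" by (rule l.zero)
qed

lemma center_subspace: "subspace center"
  by (rule subspaceI) (auto simp: center_def br_add_left br_scale_left br_zero_left)

lemma skew_zero: "\<lbrakk>x \<in> gr p; y \<in> gr q; br x y = 0\<rbrakk> \<Longrightarrow> br y x = 0"
  using skew_supersymmetry[of y q x p] by simp

lemma graded_sum_zero:
  assumes "x \<in> gr p" "y \<in> gr (p + 1)" "x + y = 0"
  shows "x = 0 \<and> y = 0"
proof -
  have "x = scale (- 1) y" using assms(3) by (simp add: eq_neg_iff_add_eq_0)
  then have "x \<in> gr (p + 1)" using gr_closed(4)[OF assms(2), of "- 1"] by simp
  then have "x = 0" using gr_disjoint[OF assms(1)] by (cases p) auto
  then show ?thesis using assms(3) by simp
qed

text \<open>
  The left and the right radical of the bracket are graded, because brackets of homogeneous elements with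
  the two components of \<open>n\<close> have different parities. By supersymmetry they coincide
  (lemma \<open>center_iff_right\<close>).
\<close>

lemma radical_components:
  assumes "(\<forall>x. br x n = 0) \<or> (\<forall>x. br n x = 0)"
  shows "br x (component p n) = 0" "br (component p n) x = 0"
proof -
  let ?n = "component p n" and ?n' = "n - component p n"
  have hom: "br y ?n = 0 \<and> br ?n y = 0" if y: "y \<in> gr q" for y q
    using assms
  proof
    assume n: "\<forall>x. br x n = 0"
    have "br y ?n \<in> gr (q + p)" "br y ?n' \<in> gr (q + (p + 1))"
      by (intro br_graded y component_split)+
    moreover have "br y ?n + br y ?n' = 0" using n by (simp flip: br_add_right)
    ultimately have "br y ?n = 0" using graded_sum_zero by (auto simp: add.assoc)
    then show ?thesis using skew_zero[OF y component_split(1)] by simp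
  next
    assume n: "\<forall>x. br n x = 0"
    have "br ?n y \<in> gr (p + q)" "br ?n' y \<in> gr (p + 1 + q)"
      by (intro br_graded y component_split)+
    moreover have "br ?n y + br ?n' y = 0" using n by (simp flip: br_add_left)
    ultimately have "br ?n y = 0" using graded_sum_zero by (auto simp: add_ac)
    then show ?thesis using skew_zero[OF component_split(1) y] by simp
  qed
  have "br (component 0 x + component 1 x) ?n = 0" "br ?n (component 0 x + component 1 x) = 0"
    using hom[OF component_split(1)[of 0 x]] hom[OF component_split(1)[of 1 x]]
    by (simp_all add: br_add_left br_add_right)
  then show "br x ?n = 0" "br ?n x = 0" by (simp_all add: sum_components)
qed

lemma center_iff_right: "n \<in> center \<longleftrightarrow> (\<forall>x. br x n = 0)"
proof
  assume "n \<in> center"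
  then have "br x (component 0 n + component 1 n) = 0" for x
    unfolding center_def using radical_components(1)[of n] by (simp add: br_add_right)
  then show "\<forall>x. br x n = 0" by (simp add: sum_components)
next
  assume n: "\<forall>x. br x n = 0"
  then have "br (component 0 n + component 1 n) x = 0" for x
    using radical_components(2)[of n] by (simp add: br_add_left)
  then show "n \<in> center" by (simp add: sum_components center_def)
qed

lemma component_in_center: "n \<in> center \<Longrightarrow> component p n \<in> center"
  using radical_components(2)[of n] by (simp add: center_def)

end

context heisenberg_lie_superalgebra
begin

lemma br_in_center: "br x y \<in> center"
  unfolding center_iff_right
proof
  fix w
  have "br x y \<in> lower_central 1"
    by (auto intro!: span_base)
  then have "br w (br x y) \<in> lower_central 2"
    by (auto simp: numeral_2_eq_2 intro!: span_base)
  then show "br w (br x y) = 0" using two_step by (simp add: two_step_nilpotent_def)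
qed

text \<open>
  The centre is one-dimensional and graded, hence spanned by a homogeneous element.
\<close>

lemma center_generator:
  obtains z zp where "z \<in> gr zp" "z \<noteq> 0" "center = range (\<lambda>c. scale c z)"
proof -
  obtain B where B: "B \<subseteq> center" "independent B" "center \<subseteq> span B" "card B = 1"
    using basis_exists[of center] dim_center by metis
  then obtain z0 where z0: "B = {z0}" by (auto simp: card_1_singleton_iff)
  have c0: "center = range (\<lambda>c. scale c z0)"
    using B(1,3) center_subspace by (auto simp: z0 span_singleton subspace_scale)
  have "z0 \<noteq> 0" using B(2) by (auto simp: z0)
  then obtain zp where nz: "component zp z0 \<noteq> 0"
    using sum_components[of z0] by force
  have "z0 \<in> center" using B(1) z0 by auto
  then have "component zp z0 \<in> center" by (rule component_in_center)
  with c0 obtain c where c: "component zp z0 = scale c z0" by auto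
  with nz have "c \<noteq> 0" by auto
  then have "scale d z0 = scale (d / c) (component zp z0)" for d by (simp add: c)
  then have "scale d z0 \<in> range (\<lambda>c. scale c (component zp z0))" for d by blast
  moreover have "scale d (component zp z0) \<in> range (\<lambda>c. scale c z0)" for d
    unfolding c scale_scale by (rule rangeI)
  ultimately have "center = range (\<lambda>c. scale c (component zp z0))" unfolding c0 by blast
  with nz component_split(1) that show thesis by blast
qed

end

locale heisenberg_basis = lie_superalgebra_basis scale gr br I e
  for scale :: "'f::field_char_0 \<Rightarrow> 'g::ab_group_add \<Rightarrow> 'g" and gr :: "bit \<Rightarrow> 'g set"
    and br :: "'g \<Rightarrow> 'g \<Rightarrow> 'g" and I :: "'i::linorder set" and e :: "'i \<Rightarrow> 'g" +
  fixes z :: 'g and zp :: bit and B :: "'g \<Rightarrow> 'g \<Rightarrow> 'f"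
  assumes finite_I: "finite I"
    and z: "z \<in> gr zp" "z \<noteq> 0"
    and center_eq: "center = range (\<lambda>c. scale c z)"
    and br_eq: "br x y = scale (B x y) z"
begin

definition coord :: "'g \<Rightarrow> 'i \<Rightarrow> 'f"
  where "coord x i = representation (e ` I) x (e i)"

lemma coord_linear [simp]:
  "coord (x + y) i = coord x i + coord y i" "coord (scale c x) i = c * coord x i" "coord 0 i = 0"
  "coord (x - y) i = coord x i - coord y i"
  by (simp_all add: coord_def representation_add representation_scale representation_zero
      representation_diff basis_independent basis_span)

lemma coord_sum: "coord (\<Sum>a\<in>A. f a) i = (\<Sum>a\<in>A. coord (f a) i)"
  by (induction A rule: infinite_finite_induct) auto

lemma coord_basis: "\<lbrakk>i \<in> I; l \<in> I\<rbrakk> \<Longrightarrow> coord (e l) i = (if l = i then 1 else 0)"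
  using representation_basis[OF basis_independent, of "e l"] basis_inj
  by (auto simp: coord_def inj_on_def)

lemma coord_combination: "i \<in> I \<Longrightarrow> coord (\<Sum>l\<in>I. scale (c l) (e l)) i = c i"
  using finite_I by (simp add: coord_sum coord_basis if_distrib cong: if_cong)

lemma expand: "x = (\<Sum>i\<in>I. scale (coord x i) (e i))"
proof -
  have "(\<Sum>b\<in>e ` I. scale (representation (e ` I) x b) b) = x"
    using finite_I by (intro sum_representation_eq basis_independent) (auto simp: basis_span)
  then show ?thesis using basis_inj by (simp add: sum.reindex coord_def)
qed

lemma coord_eqI: "(\<And>i. i \<in> I \<Longrightarrow> coord x i = coord y i) \<Longrightarrow> x = y"
  by (subst expand[of x], subst expand[of y]) simp

lemma basis_graded: "i \<in> I \<Longrightarrow> e i \<in> gr (par i)"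
  using basis_homogeneous by (auto simp: parity_def)

lemma component_expand: "component p x = (\<Sum>i\<in>I. scale (if par i = p then coord x i else 0) (e i))"
proof -
  have "component p x = (\<Sum>i\<in>I. scale (coord x i) (component p (e i)))"
    by (subst expand[of x]) (simp add: component_sum component_scale)
  also have "\<dots> = (\<Sum>i\<in>I. scale (if par i = p then coord x i else 0) (e i))"
    by (intro sum.cong refl) (simp add: component_homogeneous[OF basis_graded])
  finally show ?thesis .
qed

lemma coord_homogeneous: "\<lbrakk>x \<in> gr p; i \<in> I; coord x i \<noteq> 0\<rbrakk> \<Longrightarrow> par i = p"
  using component_homogeneous[of x p p] component_expand[of p x]
    coord_combination[of i "\<lambda>i. if par i = p then coord x i else 0"] by (auto split: if_splits)

lemma B_linear:
  "B (x + y) w = B x w + B y w" "B (scale c x) w = c * B x w" "B 0 w = 0"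
  "B w (x + y) = B w x + B w y" "B w (scale c x) = c * B w x" "B w 0 = 0"
proof -
  have cancel: "scale c z = scale d z \<Longrightarrow> c = d" for c d
    using z(2) by simp
  show "B (x + y) w = B x w + B y w" "B (scale c x) w = c * B x w" "B 0 w = 0"
    "B w (x + y) = B w x + B w y" "B w (scale c x) = c * B w x" "B w 0 = 0"
    by (rule cancel; simp add: scale_left_distrib br_add_left br_scale_left br_zero_left
        br_add_right br_scale_right br_zero_right flip: br_eq scale_scale)+
qed

lemma B_sum: "B (\<Sum>a\<in>A. f a) w = (\<Sum>a\<in>A. B (f a) w)" "B w (\<Sum>a\<in>A. f a) = (\<Sum>a\<in>A. B w (f a))"
  by (induction A rule: infinite_finite_induct) (simp_all add: B_linear)

lemma B_zero_iff: "B x y = 0 \<longleftrightarrow> br x y = 0"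
  using z(2) by (simp add: br_eq)

lemma B_center: "B z x = 0" "B x z = 0"
proof -
  have "z \<in> center" unfolding center_eq using rangeI[of "\<lambda>c. scale c z" 1] by simp
  then show "B z x = 0" "B x z = 0"
    by (simp_all add: B_zero_iff) (simp add: center_def, simp add: center_iff_right)
qed

lemma B_expand_right: "B x y = (\<Sum>l\<in>I. B x (e l) * coord y l)"
  by (subst expand[of y]) (simp add: B_sum B_linear mult.commute)

lemma B_nondegenerate:
  assumes "\<And>k. k \<in> I \<Longrightarrow> B (e k) n = 0"
  shows "\<exists>s. n = scale s z"
proof -
  have "B x n = 0" for x
    by (subst expand[of x]) (simp add: B_sum B_linear assms)
  then have "n \<in> center" by (simp add: center_iff_right B_zero_iff)
  then show ?thesis unfolding center_eq by auto
qed

lemma exists_z_coordinate: "\<exists>j\<in>I. coord z j \<noteq> 0"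
  using coord_eqI[of z 0] z(2) by force

text \<open>
  Rank--nullity for \<open>n \<mapsto> B(-, n)\<close>, turned into an endomorphism \<open>\<Phi>\<close> of \<open>\<gg>\<close> by the basis: it is injective on
  the span of all \<open>e_k\<close> with \<open>k \<noteq> j\<close>, because \<open>z\<close> has a nonzero coordinate at \<open>j\<close>, and its image lies in
  a hyperplane, which it therefore fills.
\<close>

lemma B_onto:
  assumes "(\<Sum>k\<in>I. c k * coord z k) = 0"
  shows "\<exists>n. \<forall>k\<in>I. c k = B (e k) n"
proof -
  interpret fd: finite_dimensional_vector_space_pair_1 scale "e ` I" scale
    using finite_I basis_independent basis_span by unfold_locales auto
  obtain j where j: "j \<in> I" "coord z j \<noteq> 0" using exists_z_coordinate by blast
  let ?\<Phi> = "\<lambda>n. \<Sum>k\<in>I. scale (B (e k) n) (e k)"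
  let ?S = "e ` (I - {j})" and ?H = "{y. (\<Sum>k\<in>I. coord y k * coord z k) = 0}"
  have lin: "Vector_Spaces.linear scale scale ?\<Phi>"
    by unfold_locales (simp_all add: B_linear scale_left_distrib scale_sum_right sum.distrib)
  have S_j: "coord n j = 0" if "n \<in> span ?S" for n
    using that by (induction rule: span_induct_alt) (use j in \<open>auto simp: coord_basis\<close>)
  have inj: "inj_on ?\<Phi> (span ?S)"
  proof (rule inj_onI)
    fix x y assume xy: "x \<in> span ?S" "y \<in> span ?S" "?\<Phi> x = ?\<Phi> y"
    have "B (e k) (x - y) = 0" if k: "k \<in> I" for k
      using arg_cong[OF xy(3), of "\<lambda>x. coord x k"] coord_combination[OF k]
        B_linear(4)[of "e k" "x - y" y] by simp
    then obtain s where s: "x - y = scale s z" using B_nondegenerate by blast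
    have "coord (x - y) j = 0" by (rule S_j[OF span_diff[OF xy(1,2)]])
    with s j have "s = 0" by simp
    with s show "x = y" by simp
  qed
  have "dim (?\<Phi> ` span ?S) = dim ?S"
    using fd.dim_image_eq[OF lin, of "span ?S"] inj by (simp only: span_span dim_span)
  also have "dim ?S = card I - 1"
  proof -
    have "independent ?S" by (rule independent_mono[OF basis_independent]) auto
    then have "dim ?S = card ?S" by (rule dim_eq_card_independent)
    also have "\<dots> = card (I - {j})" by (rule card_image) (rule inj_on_subset[OF basis_inj], auto)
    finally show ?thesis using j finite_I by simp
  qed
  finally have dim_image: "dim (?\<Phi> ` span ?S) = card I - 1" .
  have H: "subspace ?H"
    by (rule subspaceI) (auto simp: distrib_right sum.distrib mult.assoc simp flip: sum_distrib_left)
  have image_H: "?\<Phi> ` span ?S \<subseteq> ?H"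
  proof safe
    fix n
    have "(\<Sum>k\<in>I. coord (?\<Phi> n) k * coord z k) = (\<Sum>k\<in>I. B (e k) n * coord z k)"
      by (intro sum.cong refl) (simp only: coord_combination)
    also have "\<dots> = B (\<Sum>k\<in>I. scale (coord z k) (e k)) n"
      by (simp add: B_sum B_linear mult.commute)
    also have "\<dots> = 0" by (simp only: expand[of z, symmetric] B_center)
    finally show "(\<Sum>k\<in>I. coord (?\<Phi> n) k * coord z k) = 0" .
  qed
  have "e j \<notin> ?H"
    using j finite_I by (simp add: coord_basis if_distrib[of "\<lambda>t. t * _"] cong: if_cong)
  then have psub: "?H \<subset> UNIV" by blast
  have span_H: "span ?H = ?H" using H by (simp only: span_eq_iff)
  have "span ?H \<subset> span UNIV" using psub unfolding span_H span_UNIV .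
  then have "dim ?H < dim (UNIV :: 'g set)" by (rule fd.vs1.dim_psubset)
  also have "dim (UNIV :: 'g set) = card I"
    using dim_eq_card[of "e ` I" UNIV] basis_span basis_independent basis_inj
    by (simp add: card_image)
  finally have "dim ?H \<le> dim (?\<Phi> ` span ?S)" using dim_image by simp
  moreover have "subspace (?\<Phi> ` span ?S)"
    using module_hom.subspace_image[OF Vector_Spaces.linear.axioms(3)[OF lin]] by simp
  ultimately have H_eq: "?\<Phi> ` span ?S = ?H"
    using fd.vs1.subspace_dim_equal[OF _ H image_H] by simp
  have "(\<Sum>k\<in>I. scale (c k) (e k)) \<in> ?H"
    using assms by (simp add: coord_combination)
  then obtain n where n: "(\<Sum>k\<in>I. scale (c k) (e k)) = ?\<Phi> n" unfolding H_eq[symmetric] by auto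
  have "c k = B (e k) n" if "k \<in> I" for k
    using arg_cong[OF n, of "\<lambda>x. coord x k"] coord_combination[OF that] by simp
  then show ?thesis by blast
qed

lemma basis_structure_constants:
  assumes "j \<in> I" "coord z j \<noteq> 0"
  shows "heisenberg_constants I par zp (coord z) (\<lambda>k l. B (e k) (e l)) j"
proof
  show "finite I" by (rule finite_I)
  show "par i = zp" if "i \<in> I" "coord z i \<noteq> 0" for i
    using coord_homogeneous[OF z(1)] that by blast
  show "par k + par l = zp" if "k \<in> I" "l \<in> I" "B (e k) (e l) \<noteq> 0" for k l
  proof (rule ccontr)
    assume "par k + par l \<noteq> zp"
    moreover have "br (e k) (e l) \<in> gr (par k + par l)"
      by (intro br_graded basis_graded that)
    moreover have "br (e k) (e l) \<in> gr zp" using z(1) by (simp add: br_eq gr_closed)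
    ultimately have "br (e k) (e l) = 0" using gr_disjoint by blast
    with that show False by (simp add: B_zero_iff)
  qed
  show "B (e k) (e l) = - psign (par k * par l) * B (e l) (e k)" if "k \<in> I" "l \<in> I" for k l
  proof -
    have "scale (B (e k) (e l)) z = scale (- psign (par k * par l) * B (e l) (e k)) z"
      using skew_supersymmetry[OF basis_graded[OF that(1)] basis_graded[OF that(2)]]
      by (simp add: br_eq)
    then show ?thesis using z(2) by (simp only: scale_cancel_right) simp
  qed
  show "(\<Sum>l\<in>I. B (e k) (e l) * coord z l) = 0" if "k \<in> I" for k
    using B_expand_right[of "e k" z] B_center by simp
  show "\<exists>s. \<forall>l\<in>I. c l = s * coord z l"
    if "\<And>k. k \<in> I \<Longrightarrow> (\<Sum>l\<in>I. B (e k) (e l) * c l) = 0" for c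
  proof -
    let ?n = "\<Sum>l\<in>I. scale (c l) (e l)"
    have "B (e k) ?n = 0" if "k \<in> I" for k
      using \<open>\<And>k. k \<in> I \<Longrightarrow> (\<Sum>l\<in>I. B (e k) (e l) * c l) = 0\<close>[OF that]
      by (simp add: B_sum B_linear mult.commute)
    then obtain s where "?n = scale s z" using B_nondegenerate by blast
    then have "c l = s * coord z l" if "l \<in> I" for l
      using coord_combination[OF that, of c] by simp
    then show ?thesis by blast
  qed
  show "\<exists>m. \<forall>k\<in>I. c k = (\<Sum>l\<in>I. B (e k) (e l) * m l)"
    if c: "(\<Sum>k\<in>I. c k * coord z k) = 0" for c
  proof -
    from B_onto[OF c] obtain n where "\<forall>k\<in>I. c k = B (e k) n" by blast
    then show ?thesis using B_expand_right[of _ n] by (intro exI[of _ "coord n"]) simp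
  qed
qed (use assms in auto)

end

section \<open>Components of adjoint cochains\<close>

context heisenberg_basis
begin

definition pivot :: 'i
  where "pivot = (SOME j. j \<in> I \<and> coord z j \<noteq> 0)"

lemma pivot: "pivot \<in> I" "coord z pivot \<noteq> 0"
  using someI_ex[of "\<lambda>j. j \<in> I \<and> coord z j \<noteq> 0"] exists_z_coordinate by (auto simp: pivot_def)

sublocale H: heisenberg_constants I "\<lambda>i. parity (e i)" zp "coord z" "\<lambda>k l. B (e k) (e l)" pivot
  by (rule basis_structure_constants[OF pivot])

end

context heisenberg_basis
begin

definition coord_tensor :: "'i \<Rightarrow> ('i word \<Rightarrow>\<^sub>0 'g) \<Rightarrow> ('i word \<Rightarrow>\<^sub>0 'f)"
  where "coord_tensor i f = Poly_Mapping.map (\<lambda>m. coord m i) f"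

definition assemble :: "('i \<Rightarrow> ('i word \<Rightarrow>\<^sub>0 'f)) \<Rightarrow> ('i word \<Rightarrow>\<^sub>0 'g)"
  where "assemble t = (\<Sum>l\<in>I. tensor (e l) (t l))"

lemma lookup_coord_tensor [simp]: "Poly_Mapping.lookup (coord_tensor i f) w = coord (Poly_Mapping.lookup f w) i"
  by (simp add: coord_tensor_def Poly_Mapping.map.rep_eq when_def)

lemma lookup_tensor [simp]: "Poly_Mapping.lookup (tensor m t) w = scale (Poly_Mapping.lookup t w) m"
  by (simp add: tensor_def Poly_Mapping.map.rep_eq when_def)

lemma coord_tensor_add: "coord_tensor i (f + g) = coord_tensor i f + coord_tensor i g"
  and coord_tensor_diff: "coord_tensor i (f - g) = coord_tensor i f - coord_tensor i g"
  and coord_tensor_zero: "coord_tensor i 0 = 0"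
  by (rule poly_mapping_eqI; simp add: lookup_add lookup_minus)+

lemma coord_tensor_sum: "coord_tensor i (\<Sum>a\<in>A. f a) = (\<Sum>a\<in>A. coord_tensor i (f a))"
  by (induction A rule: infinite_finite_induct) (auto simp: coord_tensor_zero coord_tensor_add)

lemma coord_tensor_single: "coord_tensor i (Poly_Mapping.single w m) = smul (coord m i) (word_tensor w)"
  by (rule poly_mapping_eqI) (simp add: lookup_single when_def)

lemma coord_tensor_tensor: "coord_tensor i (tensor m t) = smul (coord m i) t"
  by (rule poly_mapping_eqI) (simp add: mult.commute)

lemma coord_tensor_assemble: "i \<in> I \<Longrightarrow> coord_tensor i (assemble t) = t i"
  unfolding assemble_def coord_tensor_sum coord_tensor_tensor
  using finite_I by (simp add: coord_basis if_distrib[of "\<lambda>c. smul c _"] cong: if_cong)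

lemma coord_tensor_eqI: "(\<And>i. i \<in> I \<Longrightarrow> coord_tensor i f = coord_tensor i g) \<Longrightarrow> f = g"
proof (rule poly_mapping_eqI, rule coord_eqI)
  fix w i assume *: "\<And>i. i \<in> I \<Longrightarrow> coord_tensor i f = coord_tensor i g" and i: "i \<in> I"
  show "coord (Poly_Mapping.lookup f w) i = coord (Poly_Mapping.lookup g w) i"
    using arg_cong[OF *[OF i], of "\<lambda>t. Poly_Mapping.lookup t w"] by simp
qed

lemma tensors_over_iff: "f \<in> tensors_over I \<longleftrightarrow> (\<forall>i\<in>I. coord_tensor i f \<in> tensors_over I)"
proof
  assume "f \<in> tensors_over I"
  then show "\<forall>i\<in>I. coord_tensor i f \<in> tensors_over I"
    by (auto simp: tensors_over_def in_keys_iff)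
next
  assume *: "\<forall>i\<in>I. coord_tensor i f \<in> tensors_over I"
  show "f \<in> tensors_over I"
    unfolding tensors_over_def
  proof (intro CollectI ballI)
    fix w assume "w \<in> Poly_Mapping.keys f"
    then obtain i where "i \<in> I" "coord (Poly_Mapping.lookup f w) i \<noteq> 0"
      using coord_eqI[of "Poly_Mapping.lookup f w" 0] by (auto simp: in_keys_iff)
    with * show "set (letters w) \<subseteq> I" by (auto simp: tensors_over_def in_keys_iff)
  qed
qed

text \<open>
  Congruence of cochains can be tested in each component, which reduces the complex to families of
  tensors with scalar coefficients.
\<close>

lemma null_tensors_iff: "f \<in> null_tensors \<longleftrightarrow> (\<forall>i\<in>I. coord_tensor i f \<in> H.J)"
proof
  assume "f \<in> null_tensors"
  then obtain n m t where f: "f = (\<Sum>k<(n::nat). tensor (m k) (t k))" "\<forall>k<n. t k \<in> H.J"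
    unfolding null_tensors_def by blast
  then show "\<forall>i\<in>I. coord_tensor i f \<in> H.J"
    by (auto simp: coord_tensor_sum coord_tensor_tensor intro!: H.J_sum H.J_smul)
next
  assume *: "\<forall>i\<in>I. coord_tensor i f \<in> H.J"
  obtain h where h: "bij_betw h {0..<card I} I"
    using ex_bij_betw_nat_finite[OF finite_I] by blast
  have "f = assemble (\<lambda>i. coord_tensor i f)"
    by (rule coord_tensor_eqI) (simp add: coord_tensor_assemble)
  also have "\<dots> = (\<Sum>k<card I. tensor (e (h k)) (coord_tensor (h k) f))"
    unfolding assemble_def
    using sum.reindex_bij_betw[OF h, of "\<lambda>i. tensor (e i) (coord_tensor i f)"] by (simp add: atLeast0LessThan)
  finally have f: "f = (\<Sum>k<card I. tensor (e (h k)) (coord_tensor (h k) f))" .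
  moreover have "\<forall>k<card I. coord_tensor (h k) f \<in> H.J"
    using * bij_betwE[OF h] by auto
  ultimately show "f \<in> null_tensors"
    unfolding null_tensors_def
    by (intro CollectI exI[of _ "card I"] exI[of _ "\<lambda>k. e (h k)"] exI[of _ "\<lambda>k. coord_tensor (h k) f"] conjI)
qed

lemma coord_tensor_eq_sum:
  assumes "finite A" "Poly_Mapping.keys f \<subseteq> A"
  shows "coord_tensor i f = (\<Sum>w\<in>A. smul (coord (Poly_Mapping.lookup f w) i) (word_tensor w))"
proof -
  have "f = (\<Sum>w\<in>A. Poly_Mapping.single w (Poly_Mapping.lookup f w))"
    by (rule poly_mapping_sum_keys[OF assms])
  then have "coord_tensor i f = coord_tensor i (\<Sum>w\<in>A. Poly_Mapping.single w (Poly_Mapping.lookup f w))" by simp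
  then show ?thesis by (simp only: coord_tensor_sum coord_tensor_single)
qed

lemma structure_const_eq: "structure_const k l i = B (e k) (e l) * coord z i"
  unfolding structure_const_def br_eq coord_def[symmetric] by simp

lemma d_letter_eq: "d_letter i = smul (coord z i) H.\<omega>"
proof -
  have two: "Poly_Mapping.single (Word [k, l]) c = smul c (letter k * letter l)" for k l :: 'i and c :: 'f
    by (simp add: single_eq_smul[of _ c] word_tensor_Cons word_tensor_Nil)
  show ?thesis
    unfolding d_letter_def H.\<omega>_def tensor_space.scale_right_distrib tensor_space.scale_sum_right two
      structure_const_eq
    by (intro arg_cong2[of _ _ _ _ "(+)"] sum.cong refl) (auto simp: mult_ac)
qed

lemma d_letters_eq: "d_letters is = der_list (- 1) (\<lambda>i. smul (coord z i) H.\<omega>) is"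
  by (induction "is") (simp_all add: d_letter_eq letter_def[symmetric])

text \<open>
  Signs attached to the homogeneous components of \<open>m\<close> become signs attached to basis vectors.
\<close>

lemma sum_components_B:
  "(\<Sum>p\<in>{0, 1}. c p * B x (component p m)) = (\<Sum>k\<in>I. c (par k) * B x (e k) * coord m k)"
proof -
  have "B x (component p m) = (\<Sum>k\<in>I. if par k = p then B x (e k) * coord m k else 0)" for p
    unfolding component_expand B_sum by (intro sum.cong refl) (simp add: B_linear)
  then have "(\<Sum>p\<in>{0, 1}. c p * B x (component p m)) =
      (\<Sum>p\<in>{0, 1}. \<Sum>k\<in>I. c p * (if par k = p then B x (e k) * coord m k else 0))"
    by (simp only: sum_distrib_left)
  also have "\<dots> = (\<Sum>k\<in>I. \<Sum>p\<in>{0, 1}. c p * (if par k = p then B x (e k) * coord m k else 0))"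
    by (rule sum.swap)
  also have "\<dots> = (\<Sum>k\<in>I. c (par k) * B x (e k) * coord m k)"
  proof (intro sum.cong refl)
    fix k
    show "(\<Sum>p\<in>{0, 1}. c p * (if par k = p then B x (e k) * coord m k else 0)) = c (par k) * B x (e k) * coord m k"
      by (cases "par k") simp_all
  qed
  finally show ?thesis .
qed

lemma coord_tensor_d_pure:
  "coord_tensor i (d_pure m w) = smul (coord z i) (\<Sum>k\<in>I. H.b k * smul (coord m k) (word_tensor w)) +
    smul (coord m i) (der_list (- 1) (\<lambda>i. smul (coord z i) H.\<omega>) (letters w))"
proof -
  let ?s = "\<lambda>l p. psign (par l * p) :: 'f"
  have "coord_tensor i (\<Sum>l\<in>I. \<Sum>p\<in>{0, 1}. Poly_Mapping.single (Word [l] + w)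
       (scale (?s l p) (br (e l) (component p m)))) =
     (\<Sum>l\<in>I. \<Sum>p\<in>{0, 1}. smul (?s l p * B (e l) (component p m)) (smul (coord z i) (letter l * word_tensor w)))"
    unfolding coord_tensor_sum
    by (intro sum.cong refl) (simp add: coord_tensor_single br_eq letter_def mult_single mult_ac)
  also have "\<dots> = (\<Sum>l\<in>I. smul (\<Sum>k\<in>I. ?s l (par k) * B (e l) (e k) * coord m k) (smul (coord z i) (letter l * word_tensor w)))"
    by (simp only: tensor_space.scale_sum_left[symmetric] sum_components_B)
  also have "\<dots> = (\<Sum>l\<in>I. \<Sum>k\<in>I. smul (coord z i * coord m k * (H.\<eta> k * B (e l) (e k))) (letter l * word_tensor w))"
    unfolding tensor_space.scale_sum_left
  proof (intro sum.cong refl)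
    fix l k assume "l \<in> I" "k \<in> I"
    then have "H.\<eta> k * B (e l) (e k) = ?s l (par k) * B (e l) (e k)" by (rule H.\<eta>_\<beta>)
    then show "smul (?s l (par k) * B (e l) (e k) * coord m k) (smul (coord z i) (letter l * word_tensor w)) =
        smul (coord z i * coord m k * (H.\<eta> k * B (e l) (e k))) (letter l * word_tensor w)"
      by (simp only:) (simp add: mult_ac)
  qed
  also have "\<dots> = (\<Sum>k\<in>I. \<Sum>l\<in>I. smul (coord z i * coord m k * (H.\<eta> k * B (e l) (e k))) (letter l * word_tensor w))"
    by (rule sum.swap)
  also have "\<dots> = smul (coord z i) (\<Sum>k\<in>I. H.b k * smul (coord m k) (word_tensor w))"
    unfolding H.b_def tensor_space.scale_sum_right sum_distrib_right
    by (intro sum.cong refl) (simp add: tensor_space.scale_sum_right mult_ac)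
  finally show ?thesis
    by (simp only: d_pure_def coord_tensor_add coord_tensor_tensor d_letters_eq)
qed

lemma coord_tensor_tensor_d: "coord_tensor i (tensor_d f) = H.fam_dif (\<lambda>i. coord_tensor i f) i"
proof -
  let ?K = "Poly_Mapping.keys f" and ?f = "Poly_Mapping.lookup f"
  have "coord_tensor i (tensor_d f) = (\<Sum>w\<in>?K. smul (coord z i) (\<Sum>k\<in>I. H.b k * smul (coord (?f w) k) (word_tensor w))) +
     (\<Sum>w\<in>?K. smul (coord (?f w) i) (der_list (- 1) (\<lambda>i. smul (coord z i) H.\<omega>) (letters w)))"
    by (simp only: tensor_d_def coord_tensor_sum coord_tensor_d_pure sum.distrib)
  also have "(\<Sum>w\<in>?K. smul (coord (?f w) i) (der_list (- 1) (\<lambda>i. smul (coord z i) H.\<omega>) (letters w))) = H.dif (coord_tensor i f)"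
    by (subst lin_ext_superset[of ?K]) (auto simp: in_keys_iff)
  also have "(\<Sum>w\<in>?K. smul (coord z i) (\<Sum>k\<in>I. H.b k * smul (coord (?f w) k) (word_tensor w))) =
      smul (coord z i) (\<Sum>k\<in>I. H.b k * coord_tensor k f)"
    unfolding coord_tensor_eq_sum[OF finite_keys subset_refl] tensor_space.scale_sum_right[symmetric] sum_distrib_left
    by (rule arg_cong[of _ _ "smul (coord z i)"], rule sum.swap)
  finally show ?thesis by (simp add: H.fam_dif_def)
qed

lemma twist_word:
  "twist (\<lambda>i. psign (par i * p)) (word_tensor w) =
    smul (psign (word_parity w * p)) (word_tensor w :: 'i word \<Rightarrow>\<^sub>0 'f)"
proof -
  have "prod_list (map (\<lambda>i. psign (par i * p)) is) = (psign (sum_list (map par is) * p) :: 'f)" for "is"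
    by (induction "is") (simp_all add: psign_add distrib_right psign_def)
  then show ?thesis by (simp add: word_parity_def)
qed

lemma coord_tensor_tensor_cup:
  "coord_tensor i (tensor_cup f g) = smul (coord z i) (H.cup_form (\<lambda>k. coord_tensor k f) (\<lambda>k. coord_tensor k g))"
proof -
  let ?U = "Poly_Mapping.keys f" and ?V = "Poly_Mapping.keys g"
  let ?f = "Poly_Mapping.lookup f" and ?g = "Poly_Mapping.lookup g"
  let ?s = "\<lambda>u p. psign (word_parity u * p) :: 'f"
  let ?X = "\<lambda>(k, l) (u, v). smul (B (e k) (e l) * (coord (?f u) k * coord (?g v) l * ?s u (par l))) (word_tensor (u + v))"
  have B_sum_pairs: "(\<Sum>p\<in>{0, 1}. ?s u p * B (?f u) (component p (?g v))) =
      (\<Sum>(k, l)\<in>I \<times> I. B (e k) (e l) * (coord (?f u) k * coord (?g v) l * ?s u (par l)))" for u v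
  proof -
    have "(\<Sum>p\<in>{0, 1}. ?s u p * B (?f u) (component p (?g v))) =
        (\<Sum>l\<in>I. ?s u (par l) * B (?f u) (e l) * coord (?g v) l)"
      by (rule sum_components_B)
    also have "\<dots> = (\<Sum>l\<in>I. \<Sum>k\<in>I. B (e k) (e l) * (coord (?f u) k * coord (?g v) l * ?s u (par l)))"
    proof (intro sum.cong refl)
      fix l
      have "B (?f u) (e l) = (\<Sum>k\<in>I. coord (?f u) k * B (e k) (e l))"
        by (subst expand[of "?f u"]) (simp add: B_sum B_linear)
      then show "?s u (par l) * B (?f u) (e l) * coord (?g v) l =
          (\<Sum>k\<in>I. B (e k) (e l) * (coord (?f u) k * coord (?g v) l * ?s u (par l)))"
        by (simp add: sum_distrib_left sum_distrib_right mult_ac)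
    qed
    also have "\<dots> = (\<Sum>k\<in>I. \<Sum>l\<in>I. B (e k) (e l) * (coord (?f u) k * coord (?g v) l * ?s u (par l)))"
      by (rule sum.swap)
    finally show ?thesis by (simp only: sum.cartesian_product)
  qed
  have "coord_tensor i (tensor_cup f g) = (\<Sum>u\<in>?U. \<Sum>v\<in>?V. \<Sum>p\<in>{0, 1}.
      smul (?s u p * B (?f u) (component p (?g v))) (smul (coord z i) (word_tensor (u + v))))"
    unfolding tensor_cup_def coord_tensor_sum
    by (intro sum.cong refl) (simp add: coord_tensor_single br_eq mult_ac)
  also have "\<dots> = smul (coord z i) (\<Sum>u\<in>?U. \<Sum>v\<in>?V. \<Sum>kl\<in>I \<times> I. ?X kl (u, v))"
    unfolding tensor_space.scale_sum_left[symmetric] B_sum_pairs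
    unfolding tensor_space.scale_sum_left tensor_space.scale_sum_right
    by (intro sum.cong refl) (auto simp: mult_ac)
  also have "(\<Sum>u\<in>?U. \<Sum>v\<in>?V. \<Sum>kl\<in>I \<times> I. ?X kl (u, v)) = (\<Sum>uv\<in>?U \<times> ?V. \<Sum>kl\<in>I \<times> I. ?X kl uv)"
    by (rule sum.cartesian_product'[symmetric])
  also have "\<dots> = (\<Sum>kl\<in>I \<times> I. \<Sum>uv\<in>?U \<times> ?V. ?X kl uv)" by (rule sum.swap)
  also have "\<dots> = (\<Sum>k\<in>I. \<Sum>l\<in>I. \<Sum>u\<in>?U. \<Sum>v\<in>?V. ?X (k, l) (u, v))"
    by (simp only: sum.cartesian_product')
  also have "\<dots> = H.cup_form (\<lambda>k. coord_tensor k f) (\<lambda>k. coord_tensor k g)"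
  proof -
    have "(\<Sum>u\<in>?U. \<Sum>v\<in>?V. ?X (k, l) (u, v)) =
        smul (B (e k) (e l)) (twist (\<lambda>i. psign (par i * par l)) (coord_tensor k f) * coord_tensor l g)" for k l
      unfolding coord_tensor_eq_sum[OF finite_keys subset_refl] lin_ext_sum lin_ext_smul twist_word
        sum_product tensor_space.scale_sum_right
      by (intro sum.cong refl) (simp add: mult_single mult_ac)
    then show ?thesis by (simp add: H.cup_form_def)
  qed
  finally show ?thesis .
qed

end

section \<open>Cohomology classes\<close>

context heisenberg_basis
begin

abbreviation TI :: "('i word \<Rightarrow>\<^sub>0 'g) set"
  where "TI \<equiv> tensors_over I"

abbreviation cls :: "('i word \<Rightarrow>\<^sub>0 'g) \<Rightarrow> ('i word \<Rightarrow>\<^sub>0 'g) set"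
  where "cls f \<equiv> congr `` {f}"

lemma TI_diff: "\<lbrakk>f \<in> TI; g \<in> TI\<rbrakk> \<Longrightarrow> f - g \<in> TI"
  by (auto simp: tensors_over_iff coord_tensor_diff)

lemma congr_iff:
  "(f, g) \<in> congr \<longleftrightarrow> f \<in> TI \<and> g \<in> TI \<and> (\<forall>i\<in>I. H.eqv (coord_tensor i f) (coord_tensor i g))"
  by (auto simp: congr_def null_tensors_iff coord_tensor_diff H.eqv_def)

lemma equiv_congr: "equiv TI congr"
proof (rule equivI)
  show "congr \<subseteq> TI \<times> TI" by (auto simp: congr_iff)
  show "refl_on TI congr" by (rule refl_onI) (simp add: congr_iff)
  show "sym congr" by (rule symI) (simp add: congr_iff H.eqv_sym)
  show "trans congr"
  proof (rule transI)
    fix f g h assume "(f, g) \<in> congr" "(g, h) \<in> congr"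
    then show "(f, h) \<in> congr" unfolding congr_iff using H.eqv_trans by blast
  qed
qed

lemma tensor_d_TI: "f \<in> TI \<Longrightarrow> tensor_d f \<in> TI"
  unfolding tensors_over_iff coord_tensor_tensor_d by (auto intro: H.fam_dif_T)

lemma tensor_cup_TI: "\<lbrakk>f \<in> TI; g \<in> TI\<rbrakk> \<Longrightarrow> tensor_cup f g \<in> TI"
  unfolding tensors_over_iff coord_tensor_tensor_cup by (auto intro!: tensors_over_smul H.cup_form_T)

lemma tensor_d_add: "tensor_d (f + g) = tensor_d f + tensor_d g"
  by (rule coord_tensor_eqI) (simp add: coord_tensor_tensor_d coord_tensor_add H.fam_dif_add)

lemma tensor_d_diff: "tensor_d (f - g) = tensor_d f - tensor_d g"
  by (rule coord_tensor_eqI) (simp add: coord_tensor_tensor_d coord_tensor_diff H.fam_dif_diff)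

lemma tensor_d_zero: "tensor_d 0 = 0"
  using tensor_d_diff[of 0 0] by simp

lemma congr_diff: "\<lbrakk>(f, f') \<in> congr; (g, g') \<in> congr\<rbrakk> \<Longrightarrow> (f - g, f' - g') \<in> congr"
  by (simp add: congr_iff TI_diff coord_tensor_diff H.eqv_diff)

lemma congr_add:
  assumes "(f, f') \<in> congr" "(g, g') \<in> congr"
  shows "(f + g, f' + g') \<in> congr"
  using assms by (auto simp: congr_iff coord_tensor_add H.eqv_add)

lemma congr_tensor_d:
  assumes "(f, g) \<in> congr"
  shows "(tensor_d f, tensor_d g) \<in> congr"
proof -
  have "H.fam_dif (\<lambda>l. coord_tensor l f - coord_tensor l g) i \<in> H.J" if "i \<in> I" for i
    using assms that by (intro H.fam_dif_J) (auto simp: congr_iff H.eqv_def)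
  then show ?thesis
    using assms by (simp add: congr_iff tensor_d_TI coord_tensor_tensor_d H.fam_dif_diff H.eqv_def)
qed

lemma congr_tensor_cup:
  assumes "(f, f') \<in> congr" "(g, g') \<in> congr"
  shows "(tensor_cup f g, tensor_cup f' g') \<in> congr"
proof -
  let ?c = "\<lambda>f k. coord_tensor k f"
  have T: "coord_tensor k h \<in> H.T" if "h \<in> {f, f', g, g'}" "k \<in> I" for h k
    using assms that by (auto simp: congr_iff tensors_over_iff)
  have "H.cup_form (\<lambda>k. ?c f k - ?c f' k) (?c g) \<in> H.J"
    by (rule H.cup_form_J) (use assms T in \<open>auto simp: congr_iff H.eqv_def\<close>)
  moreover have "H.cup_form (?c f') (\<lambda>k. ?c g k - ?c g' k) \<in> H.J"
    by (rule H.cup_form_J) (use assms T in \<open>auto simp: congr_iff H.eqv_def\<close>)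
  ultimately have "H.cup_form (\<lambda>k. ?c f k - ?c f' k) (?c g) + H.cup_form (?c f') (\<lambda>k. ?c g k - ?c g' k) \<in> H.J"
    by (rule ext_ideal.add)
  then have "H.eqv (H.cup_form (?c f) (?c g)) (H.cup_form (?c f') (?c g'))"
    by (simp add: H.cup_form_diff H.eqv_def)
  then show ?thesis
    using assms by (auto simp: congr_iff tensor_cup_TI coord_tensor_tensor_cup H.eqv_smul)
qed

lemma cls_eq_iff: "\<lbrakk>f \<in> TI; g \<in> TI\<rbrakk> \<Longrightarrow> cls f = cls g \<longleftrightarrow> (f, g) \<in> congr"
  by (rule eq_equiv_class_iff[OF equiv_congr])

lemma congr_refl: "f \<in> TI \<Longrightarrow> (f, f) \<in> congr"
  by (simp add: congr_iff)

lemma cls_in_cochains: "f \<in> TI \<Longrightarrow> cls f \<in> cochains"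
  unfolding cochains_def by (rule quotientI)

lemma cochainE: assumes "X \<in> cochains" obtains f where "f \<in> TI" "X = cls f"
  using assms unfolding cochains_def by (auto elim: quotientE)

lemma d_cls: "f \<in> TI \<Longrightarrow> d (cls f) = cls (tensor_d f)"
  unfolding d_def
  by (rule UN_equiv_class[OF equiv_congr])
    (auto intro!: congruentI equiv_class_eq[OF equiv_congr] congr_tensor_d)

lemma minus_cls: "\<lbrakk>f \<in> TI; g \<in> TI\<rbrakk> \<Longrightarrow> minus_cochain (cls f) (cls g) = cls (f - g)"
  unfolding minus_cochain_def
  by (rule UN_equiv_class2[OF equiv_congr equiv_congr])
    (auto intro!: congruent2I' equiv_class_eq[OF equiv_congr] congr_diff)

lemma cup_cls: "\<lbrakk>f \<in> TI; g \<in> TI\<rbrakk> \<Longrightarrow> cup_cochain (cls f) (cls g) = cls (tensor_cup f g)"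
  unfolding cup_cochain_def
  by (rule UN_equiv_class2[OF equiv_congr equiv_congr])
    (auto intro!: congruent2I' equiv_class_eq[OF equiv_congr] congr_tensor_cup)

lemma cls_in_cocycles_iff:
  assumes "f \<in> TI"
  shows "cls f \<in> cocycles \<longleftrightarrow> (tensor_d f, 0) \<in> congr"
  using assms by (simp add: cocycles_def cls_in_cochains d_cls zero_cochain_def cls_eq_iff tensor_d_TI)

lemma cocycle_coord_tensor: "\<lbrakk>f \<in> TI; (tensor_d f, 0) \<in> congr\<rbrakk> \<Longrightarrow> H.cocycle (\<lambda>i. coord_tensor i f)"
  by (auto simp: H.cocycle_iff congr_iff tensors_over_iff[of f] coord_tensor_tensor_d coord_tensor_zero H.eqv_zero_iff)

lemma tensor_d_tensor_d:
  assumes "f \<in> TI"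
  shows "(tensor_d (tensor_d f), 0) \<in> congr"
proof -
  have "H.fam_dif (H.fam_dif (\<lambda>i. coord_tensor i f)) i \<in> H.J" if "i \<in> I" for i
    using assms that by (intro H.fam_dif_fam_dif) (auto simp: tensors_over_iff)
  then show ?thesis
    using assms by (simp add: congr_iff tensor_d_TI coord_tensor_tensor_d coord_tensor_zero H.eqv_zero_iff)
qed

lemma cohomologous_iff:
  assumes "f \<in> TI" "g \<in> TI"
  shows "(cls f, cls g) \<in> cohomologous \<longleftrightarrow> (\<exists>h\<in>TI. (f - g, tensor_d h) \<in> congr)"
proof
  assume "(cls f, cls g) \<in> cohomologous"
  then obtain W where "W \<in> cochains" "minus_cochain (cls f) (cls g) = d W"
    by (auto simp: cohomologous_def)
  then obtain h where "h \<in> TI" "cls (f - g) = cls (tensor_d h)"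
    using minus_cls[OF assms] d_cls by (metis cochainE)
  then show "\<exists>h\<in>TI. (f - g, tensor_d h) \<in> congr"
    using cls_eq_iff TI_diff[OF assms] tensor_d_TI by blast
next
  assume "\<exists>h\<in>TI. (f - g, tensor_d h) \<in> congr"
  then obtain h where h: "h \<in> TI" "(f - g, tensor_d h) \<in> congr" by blast
  then have "minus_cochain (cls f) (cls g) = d (cls h)"
    using minus_cls[OF assms] d_cls[OF h(1)] equiv_class_eq[OF equiv_congr h(2)] by simp
  then show "(cls f, cls g) \<in> cohomologous"
    unfolding cohomologous_def using assms h(1) cls_in_cochains by blast
qed

lemma cohomologous_cochains: "(X, Y) \<in> cohomologous \<Longrightarrow> X \<in> cochains \<and> Y \<in> cochains"
  by (auto simp: cohomologous_def)

lemma equiv_cohomologous: "equiv cochains cohomologous"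
proof (rule equivI)
  show "cohomologous \<subseteq> cochains \<times> cochains" by (auto dest: cohomologous_cochains)
  show "refl_on cochains cohomologous"
  proof (rule refl_onI)
    fix X assume "X \<in> cochains"
    then obtain f where f: "f \<in> TI" "X = cls f" by (rule cochainE)
    show "(X, X) \<in> cohomologous"
      unfolding f(2) cohomologous_iff[OF f(1) f(1)]
      by (intro bexI[of _ 0]) (auto simp: tensor_d_zero congr_refl)
  qed
  show "sym cohomologous"
  proof (rule symI)
    fix X Y assume XY: "(X, Y) \<in> cohomologous"
    with cohomologous_cochains obtain f g where f: "f \<in> TI" "X = cls f" and g: "g \<in> TI" "Y = cls g"
      by (metis cochainE)
    from XY obtain h where h: "h \<in> TI" "(f - g, tensor_d h) \<in> congr"
      unfolding f(2) g(2) cohomologous_iff[OF f(1) g(1)] by blast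
    have "(0 - (f - g), 0 - tensor_d h) \<in> congr"
      using h(2) by (intro congr_diff) (auto simp: congr_refl)
    then have "(g - f, tensor_d (0 - h)) \<in> congr"
      by (simp only: tensor_d_diff tensor_d_zero) simp
    then show "(Y, X) \<in> cohomologous"
      unfolding f(2) g(2) cohomologous_iff[OF g(1) f(1)] using h(1) TI_diff by blast
  qed
  show "trans cohomologous"
  proof (rule transI)
    fix X Y Z assume XY: "(X, Y) \<in> cohomologous" and YZ: "(Y, Z) \<in> cohomologous"
    with cohomologous_cochains obtain f g k where f: "f \<in> TI" "X = cls f"
      and g: "g \<in> TI" "Y = cls g" and k: "k \<in> TI" "Z = cls k"
      by (metis cochainE)
    from XY obtain h where h: "h \<in> TI" "(f - g, tensor_d h) \<in> congr"
      unfolding f(2) g(2) cohomologous_iff[OF f(1) g(1)] by blast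
    from YZ obtain h' where h': "h' \<in> TI" "(g - k, tensor_d h') \<in> congr"
      unfolding g(2) k(2) cohomologous_iff[OF g(1) k(1)] by blast
    have "(f - k, tensor_d (h + h')) \<in> congr"
      using congr_add[OF h(2) h'(2)] by (simp add: tensor_d_add)
    then show "(X, Z) \<in> cohomologous"
      unfolding f(2) k(2) cohomologous_iff[OF f(1) k(1)] using h(1) h'(1) by blast
  qed
qed

text \<open>
  A cohomology class is a set of cochains that are cohomologous to one cocycle; that all its members are
  cocycles is the identity \<open>d (d h) = 0\<close>.
\<close>

lemma cohomologous_cocycle:
  assumes "X \<in> cocycles" "(X, Y) \<in> cohomologous"
  shows "Y \<in> cocycles"
proof -
  from assms(2) cohomologous_cochains obtain f g where f: "f \<in> TI" "X = cls f" and g: "g \<in> TI" "Y = cls g"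
    by (metis cochainE)
  from assms(2) obtain h where h: "h \<in> TI" "(f - g, tensor_d h) \<in> congr"
    unfolding f(2) g(2) cohomologous_iff[OF f(1) g(1)] by blast
  have "(tensor_d f, 0) \<in> congr" using assms(1) cls_in_cocycles_iff[OF f(1)] f(2) by simp
  moreover have "(tensor_d (f - g), 0) \<in> congr"
    using congr_tensor_d[OF h(2)] tensor_d_tensor_d[OF h(1)] equiv_congr
    by (meson equivE transE)
  ultimately have "(tensor_d f - tensor_d (f - g), 0 - 0) \<in> congr" by (rule congr_diff)
  then show ?thesis
    unfolding g(2) cls_in_cocycles_iff[OF g(1)] by (simp add: tensor_d_diff)
qed

lemma cup_of_cocycles_exact:
  assumes "X \<in> cocycles" "Y \<in> cocycles"
  shows "(cup_cochain X Y, zero_cochain) \<in> cohomologous"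
proof -
  obtain f where f: "f \<in> TI" "X = cls f" using assms(1) by (auto simp: cocycles_def elim: cochainE)
  obtain g where g: "g \<in> TI" "Y = cls g" using assms(2) by (auto simp: cocycles_def elim: cochainE)
  have "H.cocycle (\<lambda>i. coord_tensor i f)" "H.cocycle (\<lambda>i. coord_tensor i g)"
    using assms f g cls_in_cocycles_iff cocycle_coord_tensor by simp_all
  from H.cup_family_exact[OF this] obtain t where "(\<forall>i\<in>I. t i \<in> H.T) \<and>
      (\<forall>i\<in>I. H.eqv (smul (coord z i) (H.cup_form (\<lambda>i. coord_tensor i f) (\<lambda>i. coord_tensor i g))) (H.fam_dif t i))" ..
  then have t: "\<And>i. i \<in> I \<Longrightarrow> t i \<in> H.T"
    "\<And>i. i \<in> I \<Longrightarrow> H.eqv (smul (coord z i) (H.cup_form (\<lambda>i. coord_tensor i f) (\<lambda>i. coord_tensor i g))) (H.fam_dif t i)"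
    by auto
  have h: "assemble t \<in> TI" using t(1) by (simp add: tensors_over_iff coord_tensor_assemble)
  have "H.fam_dif (\<lambda>l. coord_tensor l (assemble t)) i = H.fam_dif t i" if "i \<in> I" for i
    using that by (simp add: H.fam_dif_def coord_tensor_assemble)
  then have "(tensor_cup f g - 0, tensor_d (assemble t)) \<in> congr"
    using t(2) f(1) g(1) h
    by (simp add: congr_iff tensor_cup_TI tensor_d_TI coord_tensor_tensor_cup coord_tensor_tensor_d)
  then show ?thesis
    unfolding f(2) g(2) cup_cls[OF f(1) g(1)] zero_cochain_def
    using cohomologous_iff[OF tensor_cup_TI[OF f(1) g(1)], of 0] h by auto
qed

lemma cup_trivial:
  assumes "\<alpha> \<in> adjoint_cohomology" "\<beta> \<in> adjoint_cohomology"
  shows "cup \<alpha> \<beta> = zero_class"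
proof -
  have cocycles: "A \<noteq> {} \<and> A \<subseteq> cocycles" if A: "A \<in> adjoint_cohomology" for A
  proof -
    obtain X where X: "X \<in> cocycles" "A = cohomologous `` {X}"
      using A unfolding adjoint_cohomology_def by (rule quotientE)
    then have "X \<in> A" using equiv_cohomologous by (auto simp: cocycles_def elim: equivE dest: refl_onD)
    then show ?thesis using X cohomologous_cocycle by auto
  qed
  have "cohomologous `` {cup_cochain X Y} = zero_class" if "X \<in> \<alpha>" "Y \<in> \<beta>" for X Y
    unfolding zero_class_def
    using cup_of_cocycles_exact cocycles[OF assms(1)] cocycles[OF assms(2)] that
    by (intro equiv_class_eq[OF equiv_cohomologous]) blast
  then show ?thesis
    unfolding cup_def using cocycles[OF assms(1)] cocycles[OF assms(2)] by blast
qed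

end

theorem theorem5:
  fixes scale :: "'f::{alg_closed_field, field_char_0} \<Rightarrow> 'g::ab_group_add \<Rightarrow> 'g"
    and gr :: "bit \<Rightarrow> 'g set"
    and br :: "'g \<Rightarrow> 'g \<Rightarrow> 'g"
    and I :: "'i::linorder set"
    and e :: "'i \<Rightarrow> 'g"
  assumes "heisenberg_lie_superalgebra scale gr br"
    and "\<exists>B. finite_dimensional_vector_space scale B"
    and "homogeneous_basis scale gr I e"
    and "\<alpha> \<in> lie_superalgebra_basis.adjoint_cohomology scale gr br I e"
    and "\<beta> \<in> lie_superalgebra_basis.adjoint_cohomology scale gr br I e"
  shows "lie_superalgebra_basis.cup scale gr br I e \<alpha> \<beta> =
    lie_superalgebra_basis.zero_class scale gr br I e"
proof -
  interpret h: heisenberg_lie_superalgebra scale gr br by (rule assms(1))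
  interpret b: homogeneous_basis scale gr I e by (rule assms(3))
  have basis: "lie_superalgebra_basis scale gr br I e" by unfold_locales
  obtain C where "finite_dimensional_vector_space scale C" using assms(2) by blast
  then interpret fd: finite_dimensional_vector_space scale C .
  have "finite I"
    using fd.finiteI_independent[OF b.basis_independent] b.basis_inj by (simp add: finite_image_iff)
  obtain z zp where z: "z \<in> gr zp" "z \<noteq> 0" "h.center = range (\<lambda>c. scale c z)"
    by (rule h.center_generator)
  have "\<forall>x y. \<exists>c. br x y = scale c z" using h.br_in_center unfolding z(3) by blast
  then obtain B where "\<And>x y. br x y = scale (B x y) z" by metis
  with \<open>finite I\<close> z basis interpret H: heisenberg_basis scale gr br I e z zp B
    by (intro heisenberg_basis.intro heisenberg_basis_axioms.intro) auto
  show ?thesis using assms(4,5) by (rule H.cup_trivial)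
qed

end
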